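(* Let $p$ be a prime and $n \in \mathbb{N}$. The blocks of the symmetric group $S_n$ (in characteristic $p$) are labelled by the pairs $(\gamma, w)$, where $\gamma$ is a $p$-core and $w \in \mathbb{N}_0$ is such that $n = |\gamma| + pw$. This labelling is such that, for each partition $\lambda$ of $n$, the Specht module $S^\lambda$ lies in the block labelled by $(\gamma, w)$ if and only if $c_p(\lambda) = \gamma$.
   Context: Let $\mathbb{F}$ be a field of characteristic $p$. A block of a finite group $G$ is a primitive idempotent $e$ in the centre of the group algebra $\mathbb{F}_p G$. An $\mathbb{F}G$-module $U$ lies in the block $e$ if $eU = U$. A partition of $n$ is a sequence $\lambda = (\lambda_1,\lambda_2,\ldots)$ of non-increasing non-negative integers with $\sum_i \lambda_i = n =: |\lambda|$; its Young diagram $[\lambda]$ has $\lambda_i$ boxes in row $i$. A node $(i,j) \in [\lambda]$ is part of the rim if $(i+1,j+1) \notin [\lambda]$. A collection of $p$ edge-connected nodes in the rim of $[\lambda]$ is a $p$-hook if their removal from $[\lambda]$ leaves the Young diagram of a partition. The $p$-core $c_p(\lambda)$ is the partition obtained from $\lambda$ by repeatedly removing $p$-hooks until none remain (it is independent of the choices made). The number of $p$-hooks removed is the $p$-weight of $\lambda$. A $p$-core is a partition with no $p$-hooks. The Specht module $S^\lambda$ is the $\mathbb{F}S_n$-submodule of the permutation module $M^\lambda$ (with basis the $\lambda$-tabloids) spanned by the polytabloids $\kappa_t\{t\}$, where $t$ ranges over the $\lambda$-tableaux and $\kappa_t$ is the signed sum of the elements of the column stabiliser of $t$. *)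

theory Defs
  imports
    "HOL-Algebra.Ring"
    "HOL-Algebra.Sym_Groups"
    "HOL-Library.Function_Algebras"
    "HOL-Computational_Algebra.Primes"
    "HOL.Vector_Spaces"
begin

text \<open>
  For \<open>'f\<close> of prime characteristic \<open>p\<close>, the multiples of \<open>1\<close> already form a field: the copy of
  \<open>F\<^sub>p\<close> inside \<open>'f\<close>.  Blocks are idempotents with coefficients in this subfield, so they act
  on modules over \<open>'f\<close>.
\<close>

definition prime_subfield :: "'f::field set" where
  "prime_subfield = range of_int"

text \<open>
  The group algebra of a finite group \<open>G\<close> over a subfield \<open>K\<close> of \<open>'f\<close>.  The function \<open>a\<close> stands
  for the formal sum of the \<open>a g \<cdot> g\<close>, and it is required to vanish outside \<open>carrier G\<close>.
\<close>

definition group_algebra :: "'f::field set \<Rightarrow> ('g, 'm) monoid_scheme \<Rightarrow> ('g \<Rightarrow> 'f) ring" where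
  "group_algebra K G =
     \<lparr> carrier = {a. (\<forall>g. a g \<in> K) \<and> (\<forall>g. g \<notin> carrier G \<longrightarrow> a g = 0)},
       monoid.mult = (\<lambda>a b g. if g \<in> carrier G
                        then \<Sum>h\<in>carrier G. a h * b (inv\<^bsub>G\<^esub> h \<otimes>\<^bsub>G\<^esub> g) else 0),
       one = (\<lambda>g. if g = \<one>\<^bsub>G\<^esub> then 1 else 0),
       zero = 0,
       add = (+) \<rparr>"

definition ring_centre :: "('a, 'm) ring_scheme \<Rightarrow> ('a, 'm) ring_scheme" where
  "ring_centre R = R\<lparr> carrier := {z \<in> carrier R. \<forall>x \<in> carrier R. z \<otimes>\<^bsub>R\<^esub> x = x \<otimes>\<^bsub>R\<^esub> z} \<rparr>"

definition idempotent_in :: "('a, 'm) ring_scheme \<Rightarrow> 'a \<Rightarrow> bool" where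
  "idempotent_in R e \<longleftrightarrow> e \<in> carrier R \<and> e \<otimes>\<^bsub>R\<^esub> e = e"

definition primitive_idempotent :: "('a, 'm) ring_scheme \<Rightarrow> 'a \<Rightarrow> bool" where
  "primitive_idempotent R e \<longleftrightarrow>
     idempotent_in R e \<and> e \<noteq> \<zero>\<^bsub>R\<^esub> \<and>
     \<not> (\<exists>e1 e2. idempotent_in R e1 \<and> idempotent_in R e2 \<and> e1 \<noteq> \<zero>\<^bsub>R\<^esub> \<and> e2 \<noteq> \<zero>\<^bsub>R\<^esub> \<and>
               e1 \<otimes>\<^bsub>R\<^esub> e2 = \<zero>\<^bsub>R\<^esub> \<and> e2 \<otimes>\<^bsub>R\<^esub> e1 = \<zero>\<^bsub>R\<^esub> \<and> e = e1 \<oplus>\<^bsub>R\<^esub> e2)"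

definition blocks :: "('g, 'm) monoid_scheme \<Rightarrow> ('g \<Rightarrow> 'f::field) set" where
  "blocks G = {e. primitive_idempotent (ring_centre (group_algebra prime_subfield G)) e}"

text \<open>
  The formal sum \<open>a\<close> acts on the vector space of functions on a \<open>G\<close>-set, where the function
  \<open>v\<close> stands for the formal sum of the \<open>v x \<cdot> x\<close>.
\<close>

definition algebra_act ::
    "('g, 'm) monoid_scheme \<Rightarrow> ('g \<Rightarrow> 'x \<Rightarrow> 'x) \<Rightarrow> ('g \<Rightarrow> 'f::field) \<Rightarrow> ('x \<Rightarrow> 'f) \<Rightarrow> 'x \<Rightarrow> 'f" where
  "algebra_act G \<phi> a v = (\<lambda>x. \<Sum>g\<in>carrier G. a g * v (\<phi> (inv\<^bsub>G\<^esub> g) x))"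

definition lies_in_block :: "(('g \<Rightarrow> 'f::field) \<Rightarrow> 'u \<Rightarrow> 'u) \<Rightarrow> 'u set \<Rightarrow> ('g \<Rightarrow> 'f) \<Rightarrow> bool" where
  "lies_in_block act U e \<longleftrightarrow> act e ` U = U"

text \<open>
  Rows, columns and parts are numbered from \<open>0\<close>: the box \<open>(i, j)\<close> below is the one usually
  written \<open>(i + 1, j + 1)\<close>.
\<close>

definition is_partition :: "(nat \<Rightarrow> nat) \<Rightarrow> bool" where
  "is_partition \<mu> \<longleftrightarrow> antimono \<mu> \<and> finite {i. \<mu> i \<noteq> 0}"

definition part_size :: "(nat \<Rightarrow> nat) \<Rightarrow> nat" where
  "part_size \<mu> = (\<Sum>i | \<mu> i \<noteq> 0. \<mu> i)"

definition diagram :: "(nat \<Rightarrow> nat) \<Rightarrow> (nat \<times> nat) set" where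
  "diagram \<mu> = {(i, j). j < \<mu> i}"

definition rim :: "(nat \<Rightarrow> nat) \<Rightarrow> (nat \<times> nat) set" where
  "rim \<mu> = {(i, j) \<in> diagram \<mu>. (Suc i, Suc j) \<notin> diagram \<mu>}"

definition share_edge :: "nat \<times> nat \<Rightarrow> nat \<times> nat \<Rightarrow> bool" where
  "share_edge x y \<longleftrightarrow>
     (fst x = fst y \<and> (snd y = Suc (snd x) \<or> snd x = Suc (snd y))) \<or>
     (snd x = snd y \<and> (fst y = Suc (fst x) \<or> fst x = Suc (fst y)))"

definition edge_connected :: "(nat \<times> nat) set \<Rightarrow> bool" where
  "edge_connected H \<longleftrightarrow>
     (\<forall>x\<in>H. \<forall>y\<in>H. (\<lambda>u v. u \<in> H \<and> v \<in> H \<and> share_edge u v)\<^sup>*\<^sup>* x y)"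

definition is_hook :: "nat \<Rightarrow> (nat \<Rightarrow> nat) \<Rightarrow> (nat \<times> nat) set \<Rightarrow> bool" where
  "is_hook p \<mu> H \<longleftrightarrow>
     H \<subseteq> rim \<mu> \<and> card H = p \<and> edge_connected H \<and>
     (\<exists>\<nu>. is_partition \<nu> \<and> diagram \<nu> = diagram \<mu> - H)"

definition removes_hook :: "nat \<Rightarrow> (nat \<Rightarrow> nat) \<Rightarrow> (nat \<Rightarrow> nat) \<Rightarrow> bool" where
  "removes_hook p \<mu> \<nu> \<longleftrightarrow>
     is_partition \<nu> \<and> (\<exists>H. is_hook p \<mu> H \<and> diagram \<nu> = diagram \<mu> - H)"

definition is_core :: "nat \<Rightarrow> (nat \<Rightarrow> nat) \<Rightarrow> bool" where
  "is_core p \<gamma> \<longleftrightarrow> is_partition \<gamma> \<and> \<not> (\<exists>H. is_hook p \<gamma> H)"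

definition core_of :: "nat \<Rightarrow> (nat \<Rightarrow> nat) \<Rightarrow> (nat \<Rightarrow> nat)" where
  "core_of p \<mu> = (THE \<gamma>. (removes_hook p)\<^sup>*\<^sup>* \<mu> \<gamma> \<and> is_core p \<gamma>)"

text \<open>
  A tableau is given the value \<open>0\<close> outside the diagram.  Since permutations of \<open>{1..n}\<close> fix \<open>0\<close>,
  the symmetric group acts on tableaux by composition.
\<close>

definition tableaux :: "(nat \<Rightarrow> nat) \<Rightarrow> (nat \<times> nat \<Rightarrow> nat) set" where
  "tableaux \<mu> = {t. bij_betw t (diagram \<mu>) {1..part_size \<mu>} \<and> (\<forall>x. x \<notin> diagram \<mu> \<longrightarrow> t x = 0)}"

definition row_entries :: "(nat \<Rightarrow> nat) \<Rightarrow> (nat \<times> nat \<Rightarrow> nat) \<Rightarrow> nat \<Rightarrow> nat set" where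
  "row_entries \<mu> t i = t ` {x \<in> diagram \<mu>. fst x = i}"

definition col_entries :: "(nat \<Rightarrow> nat) \<Rightarrow> (nat \<times> nat \<Rightarrow> nat) \<Rightarrow> nat \<Rightarrow> nat set" where
  "col_entries \<mu> t j = t ` {x \<in> diagram \<mu>. snd x = j}"

definition tabloid :: "(nat \<Rightarrow> nat) \<Rightarrow> (nat \<times> nat \<Rightarrow> nat) \<Rightarrow> (nat \<times> nat \<Rightarrow> nat) set" where
  "tabloid \<mu> t = {s \<in> tableaux \<mu>. \<forall>i. row_entries \<mu> s i = row_entries \<mu> t i}"

definition tabloid_act ::
    "(nat \<Rightarrow> nat) \<Rightarrow> (nat \<times> nat \<Rightarrow> nat) set \<Rightarrow> (nat \<times> nat \<Rightarrow> nat) set" where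
  "tabloid_act g T = (\<lambda>t. g \<circ> t) ` T"

type_synonym 'f tabloid_vec = "(nat \<times> nat \<Rightarrow> nat) set \<Rightarrow> 'f"

abbreviation tabloid_module_act ::
    "nat \<Rightarrow> ((nat \<Rightarrow> nat) \<Rightarrow> 'f::field) \<Rightarrow> 'f tabloid_vec \<Rightarrow> 'f tabloid_vec" where
  "tabloid_module_act n \<equiv> algebra_act (sym_group n) tabloid_act"

definition basis_vec :: "'x \<Rightarrow> 'x \<Rightarrow> 'f::field" where
  "basis_vec x = (\<lambda>y. if y = x then 1 else 0)"

interpretation fun_space: vector_space "\<lambda>(c::'f::field) (v::'x \<Rightarrow> 'f) x. c * v x"
  by unfold_locales (simp_all add: fun_eq_iff algebra_simps)

definition permutation_module :: "(nat \<Rightarrow> nat) \<Rightarrow> 'f::field tabloid_vec set" where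
  "permutation_module \<mu> = fun_space.span ((\<lambda>t. basis_vec (tabloid \<mu> t)) ` tableaux \<mu>)"

definition column_stabiliser :: "(nat \<Rightarrow> nat) \<Rightarrow> (nat \<times> nat \<Rightarrow> nat) \<Rightarrow> (nat \<Rightarrow> nat) set" where
  "column_stabiliser \<mu> t =
     {g. g permutes {1..part_size \<mu>} \<and> (\<forall>j. g ` col_entries \<mu> t j = col_entries \<mu> t j)}"

definition signed_column_sum ::
    "(nat \<Rightarrow> nat) \<Rightarrow> (nat \<times> nat \<Rightarrow> nat) \<Rightarrow> (nat \<Rightarrow> nat) \<Rightarrow> 'f::field" where
  "signed_column_sum \<mu> t = (\<lambda>g. if g \<in> column_stabiliser \<mu> t then of_int (sign g) else 0)"

definition polytabloid :: "(nat \<Rightarrow> nat) \<Rightarrow> (nat \<times> nat \<Rightarrow> nat) \<Rightarrow> 'f::field tabloid_vec" where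
  "polytabloid \<mu> t =
     tabloid_module_act (part_size \<mu>) (signed_column_sum \<mu> t) (basis_vec (tabloid \<mu> t))"

text \<open>
  The linear span of the polytabloids is stable under the group, since \<open>g\<close> maps the polytabloid
  of \<open>t\<close> to that of \<open>g \<circ> t\<close> (lemma \<open>polytabloid_act\<close>); it is therefore the submodule they
  generate in the permutation module (lemma \<open>specht_module_subset\<close>).
\<close>

definition specht_module :: "(nat \<Rightarrow> nat) \<Rightarrow> 'f::field tabloid_vec set" where
  "specht_module \<mu> = fun_space.span (polytabloid \<mu> ` tableaux \<mu>)"

lemma tabloid_act_tabloid:
  assumes g: "g permutes {1..part_size \<mu>}" and t: "t \<in> tableaux \<mu>"
  shows "g \<circ> t \<in> tableaux \<mu>" "tabloid_act g (tabloid \<mu> t) = tabloid \<mu> (g \<circ> t)"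
proof -
  have g0: "g 0 = 0" "inv' g 0 = 0" using g permutes_inv[OF g] by (auto simp: permutes_def)
  have closed: "h \<circ> s \<in> tableaux \<mu>" if "h permutes {1..part_size \<mu>}" "s \<in> tableaux \<mu>" for h s
  proof -
    have "h 0 = 0" using that(1) by (auto simp: permutes_def)
    with that show ?thesis
      by (auto simp: tableaux_def intro: bij_betw_trans permutes_imp_bij)
  qed
  show "g \<circ> t \<in> tableaux \<mu>" by (rule closed[OF g t])
  have row: "row_entries \<mu> (h \<circ> s) i = h ` row_entries \<mu> s i" for h s i
    by (auto simp: row_entries_def)
  show "tabloid_act g (tabloid \<mu> t) = tabloid \<mu> (g \<circ> t)"
  proof (intro equalityI subsetI)
    fix s assume "s \<in> tabloid_act g (tabloid \<mu> t)"
    then show "s \<in> tabloid \<mu> (g \<circ> t)"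
      using closed[OF g] by (auto simp: tabloid_act_def tabloid_def row)
  next
    fix s assume s: "s \<in> tabloid \<mu> (g \<circ> t)"
    have ig: "inv' g \<circ> g = id" "g \<circ> inv' g = id" using permutes_inv_o[OF g] by auto
    have "inv' g \<circ> s \<in> tabloid \<mu> t"
      using s closed[OF permutes_inv[OF g]] ig
      by (auto simp: tabloid_def row image_comp)
    moreover have "s = g \<circ> (inv' g \<circ> s)" by (simp add: o_assoc ig)
    ultimately show "s \<in> tabloid_act g (tabloid \<mu> t)" unfolding tabloid_act_def by blast
  qed
qed

lemma inv_sym_group: "g \<in> carrier (sym_group n) \<Longrightarrow> inv\<^bsub>sym_group n\<^esub> g = inv' g"
  by (simp add: sym_group_carrier sym_group_inv_equality)

lemma tabloid_act_comp: "tabloid_act g (tabloid_act h T) = tabloid_act (g \<circ> h) T"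
  by (force simp: tabloid_act_def image_image o_assoc)

lemma tabloid_act_id: "tabloid_act id T = T" by (simp add: tabloid_act_def)

lemma tabloid_module_act_apply: "tabloid_module_act n a v T = (\<Sum>g | g permutes {1..n}. a g * v (tabloid_act (inv' g) T))"
proof -
  have "carrier (sym_group n) = {g. g permutes {1..n}}" by (auto simp: sym_group_def)
  then show ?thesis unfolding algebra_act_def by (auto simp: inv_sym_group sym_group_carrier intro!: sum.cong)
qed

lemma polytabloid_apply:
  "polytabloid \<mu> t T = (\<Sum>g\<in>column_stabiliser \<mu> t. of_int (sign g) * basis_vec (tabloid_act g (tabloid \<mu> t)) T)"
proof -
  have fin: "finite {g. g permutes {1..part_size \<mu>}}" by (simp add: finite_permutations)
  have *: "tabloid_act (inv' g) T = tabloid \<mu> t \<longleftrightarrow> T = tabloid_act g (tabloid \<mu> t)" if g: "g permutes {1..part_size \<mu>}" for g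
  proof -
    have ig: "inv' g \<circ> g = id" "g \<circ> inv' g = id" using permutes_inv_o[OF g] by auto
    show ?thesis by (metis ig tabloid_act_comp tabloid_act_id)
  qed
  show ?thesis unfolding polytabloid_def tabloid_module_act_apply signed_column_sum_def
    by (rule sum.mono_neutral_cong_right)
       (use fin in \<open>auto simp: basis_vec_def * column_stabiliser_def split: if_splits\<close>)
qed

lemma polytabloid_act:
  assumes g: "g permutes {1..part_size \<mu>}" and t: "t \<in> tableaux \<mu>"
  shows "tabloid_module_act (part_size \<mu>) (\<lambda>h. if h = g then 1 else 0) (polytabloid \<mu> t) = polytabloid \<mu> (g \<circ> t)"
proof
  fix T
  have ig: "inv' g \<circ> g = id" "g \<circ> inv' g = id" using permutes_inv_o[OF g] by auto
  have fin: "finite {g. g permutes {1..part_size \<mu>}}" by (simp add: finite_permutations)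
  have col: "col_entries \<mu> (h \<circ> s) i = h ` col_entries \<mu> s i" for h s i
    by (auto simp: col_entries_def)
  have eqT: "tabloid_act (inv' g) T = U \<longleftrightarrow> T = tabloid_act g U" for U by (metis ig tabloid_act_comp tabloid_act_id)
  have pg: "permutation g" using g by (auto simp: permutation_permutes)
  have "tabloid_module_act (part_size \<mu>) (\<lambda>h. if h = g then 1 else 0) (polytabloid \<mu> t) T = polytabloid \<mu> t (tabloid_act (inv' g) T)"
    using g fin unfolding tabloid_module_act_apply
    by (simp add: if_distrib[of "\<lambda>u. u * _"] sum.delta cong: if_cong)
  also have "\<dots> = (\<Sum>h\<in>column_stabiliser \<mu> t. of_int (sign h) * (if T = tabloid_act g (tabloid_act h (tabloid \<mu> t)) then 1 else 0))"
    by (simp add: polytabloid_apply basis_vec_def eqT)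
  also have "\<dots> = (\<Sum>h\<in>column_stabiliser \<mu> (g \<circ> t). of_int (sign h) * (if T = tabloid_act h (tabloid \<mu> (g \<circ> t)) then 1 else 0))"
  proof (rule sum.reindex_bij_witness[of _ "\<lambda>h. inv' g \<circ> h \<circ> g" "\<lambda>h. g \<circ> h \<circ> inv' g"])
    fix h assume h: "h \<in> column_stabiliser \<mu> t"
    then have hp: "permutation h" by (auto simp: column_stabiliser_def permutation_permutes)
    show "inv' g \<circ> (g \<circ> h \<circ> inv' g) \<circ> g = h" by (metis ig comp_assoc comp_id id_comp)
    show "g \<circ> h \<circ> inv' g \<in> column_stabiliser \<mu> (g \<circ> t)"
    proof -
      have "(g \<circ> h \<circ> inv' g) ` g ` col_entries \<mu> t j = g ` col_entries \<mu> t j" for j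
      proof -
        have "h ` col_entries \<mu> t j = col_entries \<mu> t j" using h by (auto simp: column_stabiliser_def)
        moreover have "(g \<circ> h \<circ> inv' g) ` g ` A = g ` h ` (inv' g \<circ> g) ` A" for A by (simp only: image_comp comp_assoc)
        ultimately show ?thesis by (simp only: ig image_id id_apply)
      qed
      then show ?thesis using h g permutes_inv[OF g]
        by (auto simp: column_stabiliser_def col intro!: permutes_compose)
    qed
    have "sign (g \<circ> h \<circ> inv' g) = sign h" 
      using pg hp by (simp add: sign_compose permutation_compose permutation_inverse sign_inverse sign_idempotent)
    moreover have "tabloid_act (g \<circ> h \<circ> inv' g) (tabloid \<mu> (g \<circ> t)) = tabloid_act g (tabloid_act h (tabloid \<mu> t))"
      by (metis tabloid_act_tabloid(2)[OF g t] tabloid_act_comp ig comp_assoc comp_id)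
    ultimately show "of_int (sign (g \<circ> h \<circ> inv' g)) * (if T = tabloid_act (g \<circ> h \<circ> inv' g) (tabloid \<mu> (g \<circ> t)) then 1 else 0) =
      of_int (sign h) * (if T = tabloid_act g (tabloid_act h (tabloid \<mu> t)) then 1 else 0)" by simp
  next
    fix h assume h: "h \<in> column_stabiliser \<mu> (g \<circ> t)"
    show "g \<circ> (inv' g \<circ> h \<circ> g) \<circ> inv' g = h" by (metis ig comp_assoc comp_id id_comp)
    show "inv' g \<circ> h \<circ> g \<in> column_stabiliser \<mu> t"
    proof -
      have "(inv' g \<circ> h \<circ> g) ` col_entries \<mu> t j = col_entries \<mu> t j" for j
      proof -
        have "h ` g ` col_entries \<mu> t j = g ` col_entries \<mu> t j" using h by (auto simp: column_stabiliser_def col)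
        moreover have "(inv' g \<circ> h \<circ> g) ` A = inv' g ` (h ` g ` A)" for A by (simp only: image_comp comp_assoc)
        moreover have "inv' g ` g ` A = A" for A by (simp only: image_comp ig image_id id_apply)
        ultimately show ?thesis by simp
      qed
      then show ?thesis using h g permutes_inv[OF g]
        by (auto simp: column_stabiliser_def intro!: permutes_compose)
    qed
  qed
  also have "\<dots> = polytabloid \<mu> (g \<circ> t) T" by (simp add: polytabloid_apply basis_vec_def)
  finally show "tabloid_module_act (part_size \<mu>) (\<lambda>h. if h = g then 1 else 0) (polytabloid \<mu> t) T = polytabloid \<mu> (g \<circ> t) T" .
qed

lemma specht_module_subset: "(specht_module \<mu> :: 'a::field tabloid_vec set) \<subseteq> permutation_module \<mu>"
  unfolding specht_module_def 
proof (rule fun_space.span_minimal)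
  show "(polytabloid \<mu> :: _ \<Rightarrow> 'a tabloid_vec) ` tableaux \<mu> \<subseteq> permutation_module \<mu>"
  proof safe
    fix t assume t: "t \<in> tableaux \<mu>"
    have "(polytabloid \<mu> t :: 'a tabloid_vec) = (\<Sum>g\<in>column_stabiliser \<mu> t. (\<lambda>T. of_int (sign g) * basis_vec (tabloid \<mu> (g \<circ> t)) T))"
      (is "_ = ?r")
    proof
      fix T
      have sa: "(\<Sum>g\<in>A. F g) T = (\<Sum>g\<in>A. F g T)" for A and F :: "(nat \<Rightarrow> nat) \<Rightarrow> 'a tabloid_vec"
        by (induction A rule: infinite_finite_induct) auto
      show "polytabloid \<mu> t T = ?r T" using t
        by (auto simp: sa polytabloid_apply column_stabiliser_def tabloid_act_tabloid intro!: sum.cong)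
    qed
    also have "\<dots> \<in> permutation_module \<mu>" unfolding permutation_module_def
      using t by (intro fun_space.span_sum fun_space.span_scale fun_space.span_base)
        (auto simp: column_stabiliser_def tabloid_act_tabloid)
    finally show "(polytabloid \<mu> t :: 'a tabloid_vec) \<in> permutation_module \<mu>" .
  qed
qed (simp add: permutation_module_def)

definition block_labels :: "nat \<Rightarrow> nat \<Rightarrow> ((nat \<Rightarrow> nat) \<times> nat) set" where
  "block_labels p n = {(\<gamma>, w). is_core p \<gamma> \<and> n = part_size \<gamma> + p * w}"

end

theory Submission
  imports
    Defs
    "HOL-Library.Poly_Mapping"
    "HOL-Computational_Algebra.Polynomial"
begin

text \<open>
  For a tableau \<open>t\<close> with column and row stabilisers \<open>C\<close> and \<open>R\<close>, von Neumann's argument shows that the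
  centre of the group algebra acts on the polytabloid of \<open>t\<close> by scalars, which gives a central
  character \<open>\<omega>\<^sub>\<mu>\<close> over every commutative ring.  If the columns of \<open>t\<close> are filled one after the
  other, the Garnir relations for single entries show that the polytabloid is a common eigenvector
  of the Jucys--Murphy elements \<open>L\<^sub>k = (1 k) + \<dots> + (k - 1 k)\<close>, the eigenvalues being the contents of
  the boxes.  Hence a symmetric polynomial in the \<open>L\<^sub>k\<close>, which is central, takes under \<open>\<omega>\<^sub>\<mu>\<close> its
  value at the contents.  Every class sum is an integral combination of monomial symmetric
  polynomials in the \<open>L\<^sub>k\<close> (compare the group elements moving the most points), so in
  characteristic \<open>p\<close> two central characters agree exactly if the contents agree modulo \<open>p\<close> as
  multisets; by the abacus this means that the \<open>p\<close>-cores agree.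

  A central idempotent killed by all \<open>\<omega>\<^sub>\<mu>\<close> vanishes: over the rationals the \<open>\<omega>\<^sub>\<mu>\<close> are distinct and as
  many as the conjugacy classes, so an integral lift \<open>z\<close> satisfies \<open>\<Prod>\<^sub>\<mu> (z - \<omega>\<^sub>\<mu>(z)) = 0\<close>, which reduces
  to a power of the idempotent.  Since the centre over the prime field is a finite ring, elements
  separating central characters have idempotent powers, and these are the blocks.
\<close>
section \<open>The group algebra of the finitary symmetric group\<close>

text \<open>The obstacle is that nothing may be divided by: \<open>p\<close> can divide the order of
  any group involved, and it can be 2. So characters are read off from \<open>kap * rho\<close>,
  whose coefficient at the identity is 1 over every ring, and not from traces; alternating sums are
  cancelled by choosing one partner of each pair; and class sums are reached from symmetric
  polynomials by an integral triangular elimination.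

  In characteristic \<open>p\<close> power sums do not determine a multiset. The contents are
  therefore recovered from the product of all \<open>X + L_k\<close> over a polynomial ring: its
  central character is the product of the \<open>X + c\<close> over the contents \<open>c\<close>,
  and over a domain the roots of a polynomial are unique with multiplicity.

  That an idempotent vanishes has to be seen over the rationals, because in characteristic
  \<open>p\<close> the central characters in general no longer span the dual of the centre. An
  integral lift of an idempotent need not be idempotent, which is why a product over all characters
  replaces a direct comparison.\<close>

text \<open>
  Composition is written \<open>+\<close>, because \<open>Poly_Mapping\<close> forms convolutions over additive monoids.
\<close>

typedef sperm = "{f :: nat \<Rightarrow> nat. permutation f}"
  morphisms ap Abs_sperm
  by (rule exI[of _ id]) simp

setup_lifting type_definition_sperm

instantiation sperm :: group_add
begin

lift_definition zero_sperm :: sperm is id by simp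
lift_definition plus_sperm :: "sperm \<Rightarrow> sperm \<Rightarrow> sperm" is "(\<circ>)"
  by (rule permutation_compose)
lift_definition uminus_sperm :: "sperm \<Rightarrow> sperm" is "inv'"
  by (rule permutation_inverse)
lift_definition minus_sperm :: "sperm \<Rightarrow> sperm \<Rightarrow> sperm" is "\<lambda>f g. f \<circ> inv' g"
  by (intro permutation_compose permutation_inverse)

instance
  by standard (transfer; simp add: comp_assoc permutation_inverse_works)+

end

lift_definition tr :: "nat \<Rightarrow> nat \<Rightarrow> sperm" is transpose
  by (rule permutation_swap_id)

lift_definition sgn_perm :: "sperm \<Rightarrow> int" is sign .

definition moved :: "sperm \<Rightarrow> nat set" where
  "moved g = {x. ap g x \<noteq> x}"

definition Sn :: "nat \<Rightarrow> sperm set" where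
  "Sn n = {g. ap g permutes {1..n}}"

lemma ap_zero [simp]: "ap 0 x = x" and ap_plus [simp]: "ap (g + h) x = ap g (ap h x)"
  by (transfer; simp)+

lemma ap_tr: "ap (tr a b) = transpose a b"
  by transfer simp

lemma sperm_eqI: "(\<And>x. ap g x = ap h x) \<Longrightarrow> g = h"
  by transfer auto

lemma ap_uminus: "ap (- g) = inv' (ap g)"
  by transfer simp

lemma ap_uminus_ap [simp]: "ap (- g) (ap g x) = x" "ap g (ap (- g) x) = x"
  by (simp_all flip: ap_plus)

lemma bij_ap: "bij (ap g)"
  using ap[of g] by (auto intro: permutation_bijective)

lemma ap_eq_iff [simp]: "ap g x = ap g y \<longleftrightarrow> x = y"
  using bij_ap[of g] by (auto simp: bij_def inj_def)

lemma tr_simps [simp]: "tr a a = 0" "tr a b + tr a b = 0" "- tr a b = tr a b"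
proof -
  show *: "tr a b + tr a b = 0" for a b by (rule sperm_eqI) (simp add: ap_tr)
  show "tr a a = 0" by (rule sperm_eqI) (simp add: ap_tr)
  show "- tr a b = tr a b" using *[of a b] by (metis minus_unique)
qed

lemma tr_left_cancel [simp]: "tr a b + (tr a b + g) = g"
  by (simp flip: add.assoc)

lemma tr_commute: "tr a b = tr b a"
  by (rule sperm_eqI) (simp add: ap_tr transpose_commute)

lemma conj_tr: "g + tr a b - g = tr (ap g a) (ap g b)"
proof (rule sperm_eqI)
  fix x
  obtain y where "x = ap g y" using ap_uminus_ap(2)[of g x] by metis
  then show "ap (g + tr a b - g) x = ap (tr (ap g a) (ap g b)) x"
    unfolding diff_conv_add_uminus ap_plus ap_tr transpose_def by simp
qed

lemma add_tr: "g + tr a b = tr (ap g a) (ap g b) + g"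
  by (metis conj_tr diff_add_cancel)

lemma sgn_perm_simps [simp]:
  "sgn_perm 0 = 1" "sgn_perm (g + h) = sgn_perm g * sgn_perm h" "sgn_perm (- g) = sgn_perm g"
  "sgn_perm g * sgn_perm g = 1"
  by (transfer; simp add: sign_compose sign_inverse)+

lemma sgn_perm_tr: "sgn_perm (tr a b) = (if a = b then 1 else - 1)"
  by transfer (simp add: sign_swap_id)

lemma Sn_closed [simp, intro]: "0 \<in> Sn n" "g \<in> Sn n \<Longrightarrow> h \<in> Sn n \<Longrightarrow> g + h \<in> Sn n"
  "g \<in> Sn n \<Longrightarrow> - g \<in> Sn n"
proof -
  have "ap 0 = id" "ap (g + h) = ap g \<circ> ap h" "ap (- g) = inv' (ap g)" for g h
    by (auto simp: ap_uminus)
  then show "0 \<in> Sn n" "g \<in> Sn n \<Longrightarrow> h \<in> Sn n \<Longrightarrow> g + h \<in> Sn n" "g \<in> Sn n \<Longrightarrow> - g \<in> Sn n"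
    by (auto simp: Sn_def permutes_compose permutes_inv)
qed

lemma Sn_minus [intro]: "g \<in> Sn n \<Longrightarrow> h \<in> Sn n \<Longrightarrow> g - h \<in> Sn n"
  using Sn_closed(2)[of g n "- h"] Sn_closed(3)[of h n] by simp

lemma tr_in_Sn [intro]: "a \<in> {1..n} \<Longrightarrow> b \<in> {1..n} \<Longrightarrow> tr a b \<in> Sn n"
  by (simp add: Sn_def ap_tr permutes_swap_id)

lemma Sn_iff_moved: "g \<in> Sn n \<longleftrightarrow> moved g \<subseteq> {1..n}"
proof
  assume "moved g \<subseteq> {1..n}"
  moreover have "\<forall>y. \<exists>!x. ap g x = y" using bij_ap[of g] by (metis bij_pointE)
  ultimately show "g \<in> Sn n" by (auto simp: Sn_def permutes_def moved_def)
qed (auto simp: Sn_def moved_def permutes_def)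

lemma Sn_image: "g \<in> Sn n \<Longrightarrow> ap g x \<in> {1..n} \<longleftrightarrow> x \<in> {1..n}"
  by (metis Sn_def mem_Collect_eq permutes_in_image)

lemma Sn_mono: "m \<le> n \<Longrightarrow> Sn m \<subseteq> Sn n"
  by (auto simp: Sn_iff_moved subset_iff)

lemma bij_betw_ap_Sn: "bij_betw ap (Sn n) {f. f permutes {1..n}}"
proof (rule bij_betwI')
  fix f assume "f \<in> {f. f permutes {1..n}}"
  then have "permutation f" "f permutes {1..n}" by (auto intro: permutes_imp_permutation)
  then show "\<exists>g\<in>Sn n. f = ap g" by (intro bexI[of _ "Abs_sperm f"]) (auto simp: Sn_def Abs_sperm_inverse)
qed (auto simp: Sn_def ap_inject)

lemma finite_Sn [simp]: "finite (Sn n)"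
  using bij_betw_finite[OF bij_betw_ap_Sn[of n]] by (simp add: finite_permutations)

lemma Sn_0 [simp]: "Sn 0 = {0}"
proof -
  have "g = 0" if "g \<in> Sn 0" for g
    using that by (intro sperm_eqI) (auto simp: Sn_iff_moved moved_def)
  then show ?thesis by auto
qed

lemma finite_moved: "finite (moved g)"
  using ap[of g] permutation_finite_support by (auto simp: moved_def)

section \<open>The group algebra as finitely supported functions\<close>

type_synonym 'r galg = "sperm \<Rightarrow>\<^sub>0 'r"

definition U :: "sperm \<Rightarrow> 'r::comm_ring_1 galg" where "U g = Poly_Mapping.single g 1"

text \<open>Scalars are placed at the identity permutation: \<open>galg\<close> is only a ring type,
  so scalar multiplication is written as multiplication by \<open>Sc a\<close>.\<close>

definition Sc :: "'r::comm_ring_1 \<Rightarrow> 'r galg" where "Sc a = Poly_Mapping.single 0 a"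

abbreviation lk :: "'r::zero galg \<Rightarrow> sperm \<Rightarrow> 'r" where "lk \<equiv> Poly_Mapping.lookup"

lemma U_0 [simp]: "U 0 = 1" and U_plus: "U (g + h) = U g * U h"
  by (simp_all add: U_def mult_single)

lemma lk_U: "lk (U g) h = (if g = h then 1 else 0)"
  by (simp add: U_def lookup_single when_def)

lemma galg_expand:
  fixes x :: "'r::comm_ring_1 galg"
  assumes "Poly_Mapping.keys x \<subseteq> A" "finite A"
  shows "x = (\<Sum>g\<in>A. Sc (lk x g) * U g)"
proof (rule poly_mapping_eqI)
  fix h
  have "lk (\<Sum>g\<in>A. Sc (lk x g) * U g) h = (\<Sum>g\<in>A. if g = h then lk x g else 0)"
    by (simp add: lookup_sum Sc_def U_def mult_single lookup_single when_def)
  also have "\<dots> = lk x h" using assms by (auto simp: sum.delta in_keys_iff)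
  finally show "lk x h = lk (\<Sum>g\<in>A. Sc (lk x g) * U g) h" by simp
qed

lemma Sc_commute: "Sc a * x = x * Sc (a :: 'r::comm_ring_1)"
proof -
  have "Sc a * x = (\<Sum>g\<in>Poly_Mapping.keys x. Sc a * (Sc (lk x g) * U g))"
    by (subst galg_expand[of x "Poly_Mapping.keys x"]) (simp_all add: sum_distrib_left)
  also have "\<dots> = (\<Sum>g\<in>Poly_Mapping.keys x. (Sc (lk x g) * U g) * Sc a)"
    by (rule sum.cong) (simp_all add: Sc_def U_def mult_single mult.commute)
  also have "\<dots> = x * Sc a"
    by (subst (3) galg_expand[of x "Poly_Mapping.keys x"]) (simp_all add: sum_distrib_right)
  finally show ?thesis .
qed

lemma Sc_simps: "Sc 0 = 0" "Sc 1 = 1" "Sc (a + b) = Sc a + Sc b" "Sc (a * b) = Sc a * Sc b"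
    "Sc (- a) = - Sc a" "Sc (a - b) = Sc a - Sc b"
  by (simp_all add: Sc_def single_add mult_single single_uminus single_diff)

lemma Sc_sum: "Sc (sum f A) = (\<Sum>x\<in>A. Sc (f x))"
  by (induction A rule: infinite_finite_induct) (auto simp: Sc_simps)

lemma lk_Sc_mult [simp]: "lk (Sc a * x) g = a * lk x g"
  unfolding Sc_def mult_map_scale_conv_mult[symmetric]
  by (simp add: Poly_Mapping.map.rep_eq when_def)

lemma lk_U_mult [simp]: "lk (U h * x) g = lk x (- h + g)"
proof -
  let ?K = "Poly_Mapping.keys x"
  have "lk (U h * x) g = (\<Sum>k\<in>?K. lk (U h * (Sc (lk x k) * U k)) g)"
    by (subst galg_expand[of x ?K]) (simp_all add: sum_distrib_left lookup_sum)
  also have "\<dots> = (\<Sum>k\<in>?K. if k = - h + g then lk x k else 0)"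
    by (rule sum.cong)
      (auto simp: U_def Sc_def mult_single lookup_single when_def add.assoc[symmetric])
  also have "\<dots> = lk x (- h + g)" by (auto simp: sum.delta in_keys_iff)
  finally show ?thesis .
qed

lemma lk_mult_U [simp]: "lk (x * U h) g = lk x (g - h)"
proof -
  let ?K = "Poly_Mapping.keys x"
  have "lk (x * U h) g = (\<Sum>k\<in>?K. lk ((Sc (lk x k) * U k) * U h) g)"
    by (subst galg_expand[of x ?K]) (simp_all add: sum_distrib_right lookup_sum)
  also have "\<dots> = (\<Sum>k\<in>?K. if k = g - h then lk x k else 0)"
    by (rule sum.cong)
      (auto simp: U_def Sc_def mult_single lookup_single when_def eq_diff_eq)
  also have "\<dots> = lk x (g - h)" by (auto simp: sum.delta in_keys_iff)
  finally show ?thesis .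
qed

lemma lk_mult:
  fixes x y :: "'r::comm_ring_1 galg"
  assumes "Poly_Mapping.keys x \<subseteq> A" "finite A"
  shows "lk (x * y) g = (\<Sum>h\<in>A. lk x h * lk y (- h + g))"
proof -
  have "x * y = (\<Sum>h\<in>A. Sc (lk x h) * U h) * y" using galg_expand[OF assms] by simp
  also have "\<dots> = (\<Sum>h\<in>A. Sc (lk x h) * (U h * y))"
    unfolding sum_distrib_right mult.assoc ..
  finally show ?thesis by (simp add: lookup_sum)
qed

text \<open>One type serves all \<open>n\<close>: the group algebra of the symmetric group on
  \<open>{1..n}\<close> is the subalgebra of these elements, so that inductions on \<open>n\<close>
  need no embeddings.\<close>

definition supp_in :: "nat \<Rightarrow> 'r::zero galg \<Rightarrow> bool" where
  "supp_in n x \<longleftrightarrow> Poly_Mapping.keys x \<subseteq> Sn n"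

lemma supp_in_iff: "supp_in n x \<longleftrightarrow> (\<forall>g. g \<notin> Sn n \<longrightarrow> lk x g = 0)"
  by (auto simp: supp_in_def in_keys_iff)

lemma supp_in_U: "g \<in> Sn n \<Longrightarrow> supp_in n (U g)" and supp_in_Sc: "supp_in n (Sc a)"
    and supp_in_1: "supp_in n (1 :: 'r::comm_ring_1 galg)" and supp_in_0: "supp_in n 0"
  by (auto simp: supp_in_iff lk_U Sc_def lookup_single when_def lookup_one)

lemma supp_in_add: "supp_in n x \<Longrightarrow> supp_in n y \<Longrightarrow> supp_in n (x + y)"
    and supp_in_diff: "supp_in n a \<Longrightarrow> supp_in n b \<Longrightarrow> supp_in n (a - b :: 'r::comm_ring_1 galg)"
  by (auto simp: supp_in_iff lookup_add lookup_minus)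

lemma supp_in_sum: "(\<And>i. i \<in> I \<Longrightarrow> supp_in n (f i)) \<Longrightarrow> supp_in n (sum f I)"
  by (auto simp: supp_in_iff lookup_sum)

lemma supp_in_mult:
  fixes x y :: "'r::comm_ring_1 galg"
  assumes "supp_in n x" "supp_in n y" shows "supp_in n (x * y)"
proof -
  have "lk x h * lk y (- h + g) = 0" if "h \<in> Sn n" "g \<notin> Sn n" for h g
  proof -
    have "- h + g \<notin> Sn n"
    proof
      assume "- h + g \<in> Sn n"
      then have "h + (- h + g) \<in> Sn n" using that by blast
      with that show False by (simp flip: add.assoc)
    qed
    then show ?thesis using assms by (simp add: supp_in_iff)
  qed
  then show ?thesis
    using assms by (auto simp: supp_in_iff lk_mult[OF assms(1)[unfolded supp_in_def] finite_Sn])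
qed

lemma supp_in_power:
  fixes x :: "'r::comm_ring_1 galg"
  shows "supp_in n x \<Longrightarrow> supp_in n (x ^ k)"
  by (induction k) (auto simp: supp_in_1 supp_in_mult)

lemma supp_in_mono: "supp_in m x \<Longrightarrow> m \<le> n \<Longrightarrow> supp_in n x"
  using Sn_mono[of m n] by (auto simp: supp_in_def)

section \<open>The centre\<close>

definition central :: "nat \<Rightarrow> 'r::comm_ring_1 galg \<Rightarrow> bool" where
  "central n z \<longleftrightarrow> supp_in n z \<and> (\<forall>g\<in>Sn n. U g * z = z * U g)"

lemma centralI: "supp_in n z \<Longrightarrow> (\<And>g. g \<in> Sn n \<Longrightarrow> U g * z = z * U g) \<Longrightarrow> central n z"
  by (auto simp: central_def)

text \<open>Centrality becomes a condition on coefficients. It therefore survives every map of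
  coefficients that sends 0 to 0, which is how central elements are later lifted, reduced and cut
  into pieces.\<close>

lemma central_iff_class_function:
  "central n z \<longleftrightarrow> supp_in n z \<and> (\<forall>g\<in>Sn n. \<forall>h. lk z (g + h - g) = lk z h)"
proof -
  have "U g * z = z * U g \<longleftrightarrow> (\<forall>h. lk z (g + h - g) = lk z h)" for g
  proof -
    have "U g * z = z * U g \<longleftrightarrow> (\<forall>h. lk (U g * z) h = lk (z * U g) h)"
      by (metis poly_mapping_eqI)
    also have "\<dots> \<longleftrightarrow> (\<forall>h. lk z (- g + h) = lk z (h - g))" by simp
    also have "\<dots> \<longleftrightarrow> (\<forall>h. lk z (- g + (g + h)) = lk z (g + h - g))"
      by (metis add.assoc add.right_inverse add_0)
    finally show ?thesis by (auto simp flip: add.assoc)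
  qed
  then show ?thesis by (auto simp: central_def)
qed

lemma central_commute:
  assumes "central n z" "supp_in n x" shows "z * x = x * z"
proof -
  have "z * (Sc a * U g) = Sc a * U g * z" if "g \<in> Sn n" for a g
  proof -
    have "z * (Sc a * U g) = Sc a * (z * U g)" by (simp only: mult.assoc[symmetric] Sc_commute[of a z])
    also have "z * U g = U g * z" using assms(1) that by (simp add: central_def)
    finally show ?thesis by (simp add: mult.assoc)
  qed
  then have "z * (\<Sum>g\<in>Sn n. Sc (lk x g) * U g) = (\<Sum>g\<in>Sn n. Sc (lk x g) * U g) * z"
    unfolding sum_distrib_left sum_distrib_right by (intro sum.cong) simp_all
  then show ?thesis using galg_expand[OF assms(2)[unfolded supp_in_def] finite_Sn] by simp
qed

lemma central_Sc: "central n (Sc a)"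
  by (intro centralI) (simp_all add: supp_in_Sc Sc_commute)

lemma central_0: "central n 0" and central_1: "central n 1"
  by (auto simp: central_def supp_in_0 supp_in_1)

lemma central_diff: "central n x \<Longrightarrow> central n y \<Longrightarrow> central n (x - y)"
  by (auto simp: central_def supp_in_diff left_diff_distrib right_diff_distrib)

lemma central_mult: "central n x \<Longrightarrow> central n y \<Longrightarrow> central n (x * y)"
  unfolding central_def by (metis mult.assoc supp_in_mult)

lemma central_power: "central n x \<Longrightarrow> central n (x ^ k)"
  by (induction k) (auto simp: central_1 central_mult)

lemma central_prod_list: "(\<And>x. x \<in> set xs \<Longrightarrow> central n x) \<Longrightarrow> central n (prod_list xs)"
  by (induction xs) (auto simp: central_1 central_mult)

text \<open>Conjugating one adjacent transposition by the next produces every transposition.\<close>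

lemma commute_adjacent_imp_commute:
  assumes adj: "\<And>k. 1 \<le> k \<Longrightarrow> k < n \<Longrightarrow> U (tr k (Suc k)) * z = z * U (tr k (Suc k))"
    and g: "g \<in> Sn n"
  shows "U g * z = z * U g"
proof -
  define C where "C = {g. U g * z = z * U g}"
  have C_add: "g + h \<in> C" if "g \<in> C" "h \<in> C" for g h
    using that unfolding C_def mem_Collect_eq U_plus by (metis mult.assoc)
  have less: "tr a b \<in> C" if "1 \<le> a" "a < b" "b \<le> n" for a b
    using that
  proof (induction b)
    case (Suc b)
    show ?case
    proof (cases "a = b")
      case True
      then show ?thesis using adj Suc.prems by (simp add: C_def)
    next
      case False
      then have ab: "tr a b \<in> C" "tr b (Suc b) \<in> C" using Suc adj by (auto simp: C_def)
      have "tr a (Suc b) = tr b (Suc b) + tr a b - tr b (Suc b)"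
        using False Suc.prems by (simp add: conj_tr ap_tr transpose_def)
      also have "\<dots> = tr b (Suc b) + tr a b + tr b (Suc b)" by (simp only: diff_conv_add_uminus tr_simps)
      finally show ?thesis using C_add ab by metis
    qed
  qed simp
  have tr_C: "tr a b \<in> C" if "a \<in> {1..n}" "b \<in> {1..n}" for a b
  proof -
    have "0 \<in> C" by (simp add: C_def)
    then show ?thesis using less[of a b] less[of b a] that tr_commute[of a b]
      by (cases a b rule: linorder_cases) auto
  qed
  have "\<forall>g. ap g = p \<longrightarrow> g \<in> C" if "p permutes {1..n}" for p
    using that finite_atLeastAtMost
  proof (induction rule: permutes_induct)
    case id
    show ?case
    proof safe
      fix g assume "ap g = id"
      then have "g = 0" by (intro sperm_eqI) simp
      then show "g \<in> C" by (simp add: C_def)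
    qed
  next
    case (swap a b p)
    show ?case
    proof safe
      fix g assume g: "ap g = transpose a b \<circ> p"
      obtain h where h: "p = ap h"
        using swap.hyps bij_betw_imp_surj_on[OF bij_betw_ap_Sn[of n]] by blast
      then have "g = tr a b + h" by (intro sperm_eqI) (simp add: g ap_tr)
      with h swap tr_C C_add show "g \<in> C" by auto
    qed
  qed
  then show ?thesis using g by (simp add: Sn_def C_def)
qed

section \<open>Jucys--Murphy elements\<close>

definition JM :: "nat \<Rightarrow> 'r::comm_ring_1 galg" where
  "JM k = (\<Sum>i\<in>{1..<k}. U (tr i k))"

lemma supp_in_JM: "k \<in> {1..n} \<Longrightarrow> supp_in n (JM k)"
  unfolding JM_def by (intro supp_in_sum supp_in_U tr_in_Sn) auto

text \<open>Conjugation by \<open>g\<close> fixes \<open>k\<close> and permutes the numbers below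
  \<open>k\<close>, so it only permutes the summands of \<open>JM k\<close>.\<close>

lemma JM_commute_U:
  assumes "g \<in> Sn n" "n < k"
  shows "U g * JM k = JM k * (U g :: 'r::comm_ring_1 galg)"
proof -
  have gk: "ap g k = k" using assms by (auto simp: Sn_def permutes_def)
  have bij: "bij_betw (ap g) {1..<k} {1..<k}"
  proof -
    have "{1..n} \<subseteq> {1..<k}" using assms by auto
    then have "ap g permutes {1..<k}" using assms permutes_subset by (auto simp: Sn_def)
    then show ?thesis by (rule permutes_imp_bij)
  qed
  have "U g * JM k = (\<Sum>i\<in>{1..<k}. U (tr (ap g i) k) * (U g :: 'r galg))"
    unfolding JM_def sum_distrib_left by (simp add: gk add_tr[of g] flip: U_plus)
  also have "\<dots> = JM k * U g"
    unfolding JM_def sum_distrib_right by (rule sum.reindex_bij_betw[OF bij])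
  finally show ?thesis .
qed

lemma adjacent_JM_other:
  assumes "1 \<le> k" "j \<noteq> k" "j \<noteq> Suc k"
  shows "U (tr k (Suc k)) * JM j = JM j * (U (tr k (Suc k)) :: 'r::comm_ring_1 galg)"
proof (cases "j < k")
  case False
  then show ?thesis using assms by (intro JM_commute_U[of _ "Suc k"] tr_in_Sn) auto
next
  case True
  have "ap (tr k (Suc k)) i = i" if "i \<le> j" for i using True that by (simp add: ap_tr)
  then show ?thesis unfolding JM_def sum_distrib_left sum_distrib_right
    by (intro sum.cong) (simp_all add: add_tr[of "tr k (Suc k)"] flip: U_plus)
qed

text \<open>The defining relation of the degenerate affine Hecke algebra: conjugation by the
  adjacent transposition turns every \<open>tr i k\<close> into \<open>tr i (Suc k)\<close>, and the
  one summand still missing is that transposition itself.\<close>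

lemma JM_Suc:
  assumes "1 \<le> k"
  shows "JM (Suc k) = U (tr k (Suc k)) * JM k * U (tr k (Suc k)) + (U (tr k (Suc k)) :: 'r::comm_ring_1 galg)"
proof -
  let ?s = "tr k (Suc k)"
  have "U ?s * JM k * U ?s = (\<Sum>i\<in>{1..<k}. U (tr i (Suc k)) :: 'r galg)"
  proof -
    have "U ?s * U (tr i k) * U ?s = (U (tr i (Suc k)) :: 'r galg)" if "i \<in> {1..<k}" for i
    proof -
      have e: "?s + tr i k = tr i (Suc k) + ?s"
        using that add_tr[of ?s i k] by (simp add: ap_tr)
      have "?s + tr i k + ?s = tr i (Suc k)" by (simp only: e add.assoc tr_simps add_0_right)
      then show ?thesis by (simp only: U_plus[symmetric])
    qed
    then show ?thesis unfolding JM_def sum_distrib_left sum_distrib_right by (rule sum.cong[OF refl])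
  qed
  moreover have "JM (Suc k) = (\<Sum>i\<in>{1..<k}. U (tr i (Suc k))) + (U ?s :: 'r galg)"
    using assms unfolding JM_def by (simp add: sum.atLeastLessThan_Suc)
  ultimately show ?thesis by simp
qed

context
  fixes k :: nat and s x y :: "'r::comm_ring_1 galg"
  assumes k: "1 \<le> k"
  defines "s \<equiv> U (tr k (Suc k))" and "x \<equiv> JM k" and "y \<equiv> JM (Suc k)"
begin

lemma s_square: "s * s = 1"
  by (simp add: s_def flip: U_plus)

lemma s_JM: "s * x = y * s - 1" "s * y = x * s + 1"
proof -
  have y: "y = s * x * s + s" using JM_Suc[OF k] by (simp add: s_def x_def y_def)
  have "y * s = s * x * (s * s) + s * s" by (simp add: y distrib_right mult.assoc)
  then show "s * x = y * s - 1" by (simp add: s_square)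
  have "s * y = (s * s) * x * s + s * s" by (simp add: y distrib_left mult.assoc)
  then show "s * y = x * s + 1" by (simp add: s_square)
qed

lemma JM_commute_adjacent: "x * y = y * x"
proof -
  have "tr i k \<in> Sn k" if "i \<in> {1..<k}" for i using that by (intro tr_in_Sn) auto
  then show ?thesis unfolding x_def y_def JM_def[of k] sum_distrib_left sum_distrib_right
    by (intro sum.cong refl JM_commute_U) auto
qed

text \<open>The corrections \<open>- 1\<close> and \<open>+ 1\<close> of \<open>s_JM\<close> cancel
  in the sum; in the product they turn into \<open>- y\<close> and \<open>+ y\<close>.\<close>

lemma s_symmetric: "s * (x + y) = (x + y) * s" "s * (x * y) = x * y * s"
proof -
  show "s * (x + y) = (x + y) * s" by (simp add: distrib_left distrib_right s_JM)
  have "s * (x * y) = (y * s - 1) * y" by (simp add: s_JM flip: mult.assoc)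
  also have "\<dots> = y * (x * s + 1) - y" by (simp add: left_diff_distrib s_JM mult.assoc)
  also have "\<dots> = x * y * s" by (simp add: distrib_left JM_commute_adjacent flip: mult.assoc)
  finally show "s * (x * y) = x * y * s" .
qed

lemma s_mult_power_xy: "s * (x * y) ^ a = (x * y) ^ a * s"
  by (induction a) (simp_all add: mult.assoc[symmetric] s_symmetric, simp add: mult.assoc s_symmetric)

text \<open>Newton's recursion in two variables: a power sum is \<open>x + y\<close> times the
  preceding one minus \<open>x * y\<close> times the one before that.\<close>

lemma s_power_sum: "s * (x ^ d + y ^ d) = (x ^ d + y ^ d) * s"
proof (induction d rule: less_induct)
  case (less d)
  consider "d = 0" | "d = 1" | e where "d = Suc (Suc e)"
    by (metis One_nat_def not0_implies_Suc)
  then show ?case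
  proof cases
    case 3
    have "(x + y) * (x ^ Suc e + y ^ Suc e) = x ^ d + x * y * y ^ e + (y * x * x ^ e + y ^ d)"
      by (simp add: 3 distrib_left distrib_right mult.assoc)
    then have p: "x ^ d + y ^ d = (x + y) * (x ^ Suc e + y ^ Suc e) - x * y * (x ^ e + y ^ e)"
      unfolding JM_commute_adjacent[symmetric] by (simp add: distrib_left)
    have 1: "s * ((x + y) * (x ^ Suc e + y ^ Suc e)) = (x + y) * (x ^ Suc e + y ^ Suc e) * s"
      using less.IH[of "Suc e"] 3 s_symmetric(1) by (simp only: mult.assoc[symmetric]) (simp only: mult.assoc 3 lessI)
    have 2: "s * (x * y * (x ^ e + y ^ e)) = x * y * (x ^ e + y ^ e) * s"
      using less.IH[of e] 3 s_symmetric(2) by (simp only: mult.assoc[symmetric]) (simp only: mult.assoc 3 lessI)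
    show ?thesis unfolding p left_diff_distrib right_diff_distrib using 1 2 by simp
  qed (use s_symmetric(1) in \<open>simp_all add: mult_2 mult_2_right\<close>)
qed

lemma xy_power: "x ^ a * y ^ a = (x * y) ^ a"
proof (induction a)
  case (Suc a)
  have "x ^ Suc a * y ^ Suc a = x ^ a * (x * y ^ a) * y"
    by (simp add: power_Suc2 mult.assoc del: power_Suc)
  also have "x * y ^ a = y ^ a * x" using JM_commute_adjacent by (metis power_commuting_commutes)
  finally show ?case using Suc by (simp only: mult.assoc[symmetric] power_Suc2)
qed simp

lemma s_monomial_equal: "s * (x ^ a * y ^ a) = x ^ a * y ^ a * s"
  unfolding xy_power by (rule s_mult_power_xy)

text \<open>The common factor \<open>(x * y) ^ min a b\<close> splits off and leaves a power sum in
  degree \<open>\<bar>a - b\<bar>\<close>.\<close>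

lemma s_monomial_pair: "s * (x ^ a * y ^ b + x ^ b * y ^ a) = (x ^ a * y ^ b + x ^ b * y ^ a) * s"
proof -
  have *: "s * (x ^ a * y ^ b + x ^ b * y ^ a) = (x ^ a * y ^ b + x ^ b * y ^ a) * s" if "a \<le> b" for a b
  proof -
    obtain d where b: "b = a + d" using \<open>a \<le> b\<close> le_Suc_ex by blast
    have "x ^ d * y ^ a = y ^ a * x ^ d"
      using JM_commute_adjacent by (metis power_commuting_commutes)
    then have "x ^ a * y ^ b + x ^ b * y ^ a = x ^ a * y ^ a * (x ^ d + y ^ d)"
      by (simp add: b power_add distrib_left mult.assoc)
    then have e: "x ^ a * y ^ b + x ^ b * y ^ a = x ^ a * y ^ a * (x ^ d + y ^ d)" .
    have "s * (P * Q) = P * Q * s" if "s * P = P * s" "s * Q = Q * s" for P Q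
      by (simp only: mult.assoc[symmetric] that(1)) (simp only: mult.assoc that(2))
    then show ?thesis unfolding e using s_monomial_equal s_power_sum by blast
  qed
  show ?thesis using *[of a b] *[of b a] by (cases "a \<le> b") (auto simp: add.commute)
qed

end

section \<open>Symmetric sums of Jucys--Murphy monomials\<close>

definition JM_monomial :: "(nat \<Rightarrow> nat) \<Rightarrow> nat \<Rightarrow> 'r::comm_ring_1 galg" where
  "JM_monomial \<alpha> n = prod_list (map (\<lambda>i. JM i ^ \<alpha> i) [1..<Suc n])"

lemma JM_monomial_0 [simp]: "JM_monomial \<alpha> 0 = 1"
  and JM_monomial_Suc: "JM_monomial \<alpha> (Suc n) = JM_monomial \<alpha> n * JM (Suc n) ^ \<alpha> (Suc n)"
  by (simp_all add: JM_monomial_def)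

lemma supp_in_JM_monomial: "supp_in n (JM_monomial \<alpha> n)"
proof (induction n)
  case (Suc n)
  show ?case unfolding JM_monomial_Suc
    by (intro supp_in_mult supp_in_power supp_in_JM supp_in_mono[OF Suc]) auto
qed (simp add: supp_in_1)

lemma upt_split_adjacent:
  assumes "1 \<le> k" "k < n"
  shows "[1..<Suc n] = [1..<k] @ k # Suc k # [Suc (Suc k)..<Suc n]"
  using assms by (metis Suc_lessI upt_conv_Cons le_add_diff_inverse less_imp_le_nat
      upt_add_eq_append Suc_le_eq Suc_less_eq)

lemma prod_list_commute:
  fixes s :: "'a::monoid_mult"
  assumes "\<And>x. x \<in> set xs \<Longrightarrow> s * x = x * s"
  shows "s * prod_list xs = prod_list xs * s"
  using assms by (induction xs) (simp_all, metis mult.assoc)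

text \<open>
  Pairing \<open>\<alpha>\<close> with its transpose over the whole orbit would only give twice the defect; splitting the exponents by
  the order of their entries at \<open>k\<close> and \<open>k + 1\<close> avoids dividing by two.
\<close>

lemma adjacent_commute_sum_monomials:
  fixes Q :: "(nat \<Rightarrow> nat) set"
  assumes k: "1 \<le> k" "k < n" and fin: "finite Q"
    and Q: "\<And>\<alpha>. \<alpha> \<in> Q \<Longrightarrow> \<alpha> \<circ> transpose k (Suc k) \<in> Q"
  shows "U (tr k (Suc k)) * (\<Sum>\<alpha>\<in>Q. JM_monomial \<alpha> n) =
    (\<Sum>\<alpha>\<in>Q. JM_monomial \<alpha> n) * (U (tr k (Suc k)) :: 'r::comm_ring_1 galg)"
proof -
  define s where "s = (U (tr k (Suc k)) :: 'r galg)"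
  define f where "f = (\<lambda>\<alpha> :: nat \<Rightarrow> nat. \<alpha> \<circ> transpose k (Suc k))"
  define A where "A = (\<lambda>\<alpha>. prod_list (map (\<lambda>i. JM i ^ \<alpha> i) [1..<k]) :: 'r galg)"
  define D where "D = (\<lambda>\<alpha>. prod_list (map (\<lambda>i. JM i ^ \<alpha> i) [Suc (Suc k)..<Suc n]) :: 'r galg)"
  define M where "M = (\<lambda>a b. JM k ^ a * JM (Suc k) ^ b :: 'r galg)"
  have split: "JM_monomial \<alpha> n = A \<alpha> * M (\<alpha> k) (\<alpha> (Suc k)) * D \<alpha>" for \<alpha>
  proof -
    have "[1..<Suc n] = [1..<k] @ k # Suc k # [Suc (Suc k)..<Suc n]"
      using k by (rule upt_split_adjacent)
    then show ?thesis by (simp add: JM_monomial_def A_def M_def D_def mult.assoc)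
  qed
  have sJM: "s * JM j ^ a = JM j ^ a * s" if "j \<noteq> k" "j \<noteq> Suc k" for j a
    using adjacent_JM_other[OF k(1) that] unfolding s_def by (metis power_commuting_commutes)
  have sA: "s * A \<alpha> = A \<alpha> * s" and sD: "s * D \<alpha> = D \<alpha> * s" for \<alpha>
    unfolding A_def D_def by (rule prod_list_commute, auto simp del: upt_Suc intro!: sJM)+
  have f: "f (f \<alpha>) = \<alpha>" "A (f \<alpha>) = A \<alpha>" "D (f \<alpha>) = D \<alpha>" "f \<alpha> k = \<alpha> (Suc k)" "f \<alpha> (Suc k) = \<alpha> k" for \<alpha>
    unfolding f_def A_def D_def by (auto simp: comp_assoc simp del: upt_Suc intro!: arg_cong[where f = prod_list])
  define T where "T = (\<lambda>\<alpha>. s * JM_monomial \<alpha> n - JM_monomial \<alpha> n * s)"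
  \<comment> \<open>The outer factors \<open>A\<close> and \<open>D\<close> contain neither
    \<open>JM k\<close> nor \<open>JM (Suc k)\<close>, so the whole commutator with \<open>s\<close>
    sits in the middle factor.\<close>
  have T: "T \<alpha> = A \<alpha> * (s * M (\<alpha> k) (\<alpha> (Suc k)) - M (\<alpha> k) (\<alpha> (Suc k)) * s) * D \<alpha>" for \<alpha>
  proof -
    have "s * (A \<alpha> * m * D \<alpha>) = A \<alpha> * (s * m) * D \<alpha>" for m
      by (simp only: mult.assoc[symmetric] sA)
    moreover have "A \<alpha> * m * D \<alpha> * s = A \<alpha> * (m * s) * D \<alpha>" for m
      by (simp only: mult.assoc sD)
    ultimately show ?thesis by (simp add: T_def split left_diff_distrib right_diff_distrib)
  qed
  have T0: "T \<alpha> = 0" if "\<alpha> k = \<alpha> (Suc k)" for \<alpha>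
    using s_monomial_equal[OF k(1), where ?'r = 'r] by (simp add: T that M_def s_def)
  have T_pair: "T \<alpha> + T (f \<alpha>) = 0" for \<alpha>
  proof -
    let ?a = "M (\<alpha> k) (\<alpha> (Suc k))" and ?b = "M (\<alpha> (Suc k)) (\<alpha> k)"
    have eq: "s * ?a - ?a * s = - (s * ?b - ?b * s)"
      using s_monomial_pair[OF k(1), where ?'r = 'r, of "\<alpha> k" "\<alpha> (Suc k)"]
      by (simp add: M_def s_def distrib_left distrib_right algebra_simps)
    have "A \<alpha> * (- z) * D \<alpha> + A \<alpha> * z * D \<alpha> = 0" for z by simp
    then show ?thesis unfolding T f eq by blast
  qed
  define Ql where "Ql = {\<alpha>\<in>Q. \<alpha> k < \<alpha> (Suc k)}"
  have "(\<Sum>\<alpha>\<in>Q. T \<alpha>) = (\<Sum>\<alpha>\<in>Ql \<union> f ` Ql. T \<alpha>)"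
  proof (rule sum.mono_neutral_right)
    show "finite Q" "Ql \<union> f ` Ql \<subseteq> Q" using fin Q by (auto simp: Ql_def f_def)
    have "\<alpha> k = \<alpha> (Suc k)" if "\<alpha> \<in> Q - (Ql \<union> f ` Ql)" for \<alpha>
    proof (rule ccontr)
      assume "\<alpha> k \<noteq> \<alpha> (Suc k)"
      then have "\<alpha> (Suc k) < \<alpha> k" using that by (auto simp: Ql_def)
      then have "f \<alpha> \<in> Ql" using that Q f(4,5) by (auto simp: Ql_def f_def)
      then have "\<alpha> \<in> f ` Ql" using f(1) by (metis image_eqI)
      then show False using that by auto
    qed
    then show "\<forall>\<alpha>\<in>Q - (Ql \<union> f ` Ql). T \<alpha> = 0" using T0 by blast
  qed
  also have "\<dots> = (\<Sum>\<alpha>\<in>Ql. T \<alpha>) + (\<Sum>\<alpha>\<in>f ` Ql. T \<alpha>)"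
    using fin f(4,5) by (intro sum.union_disjoint) (auto simp: Ql_def)
  also have "(\<Sum>\<alpha>\<in>f ` Ql. T \<alpha>) = (\<Sum>\<alpha>\<in>Ql. T (f \<alpha>))"
    by (rule sum.reindex_cong[OF _ refl refl]) (metis f(1) inj_onI)
  also have "(\<Sum>\<alpha>\<in>Ql. T \<alpha>) + \<dots> = 0" by (simp add: sum.distrib[symmetric] T_pair)
  finally show ?thesis
    by (simp add: T_def s_def sum_subtractf sum_distrib_left sum_distrib_right)
qed

lemma central_sum_monomials:
  fixes Q :: "(nat \<Rightarrow> nat) set"
  assumes "finite Q" "\<And>\<alpha> k. \<alpha> \<in> Q \<Longrightarrow> 1 \<le> k \<Longrightarrow> k < n \<Longrightarrow> \<alpha> \<circ> transpose k (Suc k) \<in> Q"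
  shows "central n (\<Sum>\<alpha>\<in>Q. JM_monomial \<alpha> n)"
proof (rule centralI)
  show "supp_in n (\<Sum>\<alpha>\<in>Q. JM_monomial \<alpha> n)"
    by (intro supp_in_sum supp_in_JM_monomial)
  show "U g * (\<Sum>\<alpha>\<in>Q. JM_monomial \<alpha> n) = (\<Sum>\<alpha>\<in>Q. JM_monomial \<alpha> n) * U g" if "g \<in> Sn n" for g
    using that by (rule commute_adjacent_imp_commute[rotated])
      (use assms in \<open>auto intro!: adjacent_commute_sum_monomials\<close>)
qed

text \<open>The generating function of the elementary symmetric polynomials in the Jucys--Murphy
  elements. With an indeterminate for \<open>a\<close> it carries the central characters of all of
  them at once.\<close>

definition JM_poly :: "nat \<Rightarrow> 'r::comm_ring_1 \<Rightarrow> 'r galg" where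
  "JM_poly n a = prod_list (map (\<lambda>i. Sc a + JM i) [1..<Suc n])"

lemma JM_poly_0 [simp]: "JM_poly 0 a = 1"
  and JM_poly_Suc: "JM_poly (Suc n) a = JM_poly n a * (Sc a + JM (Suc n))"
  by (simp_all add: JM_poly_def)

lemma central_JM_poly: "central n (JM_poly n a)"
proof (rule centralI)
  have "supp_in m (JM_poly m a)" for m
  proof (induction m)
    case (Suc m)
    have "supp_in (Suc m) (JM_poly m a)" using Suc by (rule supp_in_mono) simp
    then show ?case
      unfolding JM_poly_Suc by (intro supp_in_mult supp_in_add supp_in_Sc supp_in_JM) auto
  qed (simp add: supp_in_1)
  then show "supp_in n (JM_poly n a)" .
next
  fix g assume "g \<in> Sn n"
  then show "U g * JM_poly n a = JM_poly n a * U g"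
  proof (rule commute_adjacent_imp_commute[rotated])
    fix k assume k: "1 \<le> k" "k < n"
    define s where "s = (U (tr k (Suc k)) :: 'a galg)"
    let ?x = "JM k :: 'a galg" and ?y = "JM (Suc k) :: 'a galg"
    have "[1..<Suc n] = [1..<k] @ k # Suc k # [Suc (Suc k)..<Suc n]"
      using k by (rule upt_split_adjacent)
    then have split: "JM_poly n a = prod_list (map (\<lambda>i. Sc a + JM i) [1..<k]) *
        (((Sc a + ?x) * (Sc a + ?y)) * prod_list (map (\<lambda>i. Sc a + JM i) [Suc (Suc k)..<Suc n]))"
      by (simp add: JM_poly_def mult.assoc)
    have s1: "s * (Sc a + JM i) = (Sc a + JM i) * s" if "i \<noteq> k" "i \<noteq> Suc k" for i
      using adjacent_JM_other[OF k(1) that, where ?'r = 'a]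
      by (simp add: s_def distrib_left distrib_right Sc_commute)
    have 1: "s * prod_list (map (\<lambda>i. Sc a + JM i) [1..<k]) = prod_list (map (\<lambda>i. Sc a + JM i) [1..<k]) * s"
      by (rule prod_list_commute) (auto simp del: upt_Suc intro!: s1)
    have 3: "s * prod_list (map (\<lambda>i. Sc a + JM i) [Suc (Suc k)..<Suc n]) =
        prod_list (map (\<lambda>i. Sc a + JM i) [Suc (Suc k)..<Suc n]) * s"
      by (rule prod_list_commute) (auto simp del: upt_Suc intro!: s1)
    \<comment> \<open>The two middle factors are rewritten through \<open>?x + ?y\<close> and
      \<open>?x * ?y\<close>, both of which commute with \<open>s\<close>.\<close>
    have e: "(Sc a + ?x) * (Sc a + ?y) = Sc a * Sc a + Sc a * (?x + ?y) + ?x * ?y"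
      by (simp add: distrib_left distrib_right Sc_commute[of a ?x, symmetric] add.assoc)
    have cm: "s * (P * Q) = P * Q * s" if "s * P = P * s" "s * Q = Q * s" for P Q
      by (simp only: mult.assoc[symmetric] that(1)) (simp only: mult.assoc that(2))
    have ca: "s * (P + Q) = (P + Q) * s" if "s * P = P * s" "s * Q = Q * s" for P Q
      using that by (simp only: distrib_left distrib_right)
    have sc: "s * Sc a = Sc a * s" by (rule Sc_commute[symmetric])
    have 2: "s * ((Sc a + ?x) * (Sc a + ?y)) = (Sc a + ?x) * (Sc a + ?y) * s"
      unfolding e using s_symmetric[OF k(1), where ?'r = 'a, folded s_def]
      by (intro ca[OF ca[OF cm[OF sc sc] cm[OF sc]]])
    show "U (tr k (Suc k)) * JM_poly n a = JM_poly n a * U (tr k (Suc k))"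
      unfolding split s_def[symmetric] by (intro cm 1 2 3)
  qed
qed

section \<open>Young symmetrisers\<close>

lemma Sc_of_nat: "Sc (of_nat k) = of_nat k"
  by (simp add: Sc_def)

lemma initial_segment_card:
  fixes A :: "nat set"
  assumes "finite A" "\<And>a b. a \<in> A \<Longrightarrow> b \<le> a \<Longrightarrow> b \<in> A"
  shows "A = {..<card A}"
proof (cases "A = {}")
  case False
  have "A = {..Max A}" using False assms by (auto intro: Max_in)
  then have "card A = Suc (Max A)" by (metis card_atMost)
  with \<open>A = {..Max A}\<close> show ?thesis by (simp add: lessThan_Suc_atMost)
qed simp

text \<open>The maximum of a nonempty \<open>A\<close> is at least \<open>card A - 1\<close>.
  Removing it gives the induction, and equality of the sums forces it to be exactly that
  number.\<close>

lemma sum_initial_segment_le: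
  fixes A :: "nat set"
  assumes "finite A"
  shows "\<Sum>{..<card A} \<le> \<Sum>A" "\<Sum>A = \<Sum>{..<card A} \<Longrightarrow> A = {..<card A}"
  using assms
proof (induction "card A" arbitrary: A)
  case (Suc k)
  case 1
  define M where "M = Max A"
  have M: "M \<in> A" using Suc(3) 1 by (auto simp: M_def intro!: Max_in)
  have A: "finite (A - {M})" "card (A - {M}) = k" "insert M (A - {M}) = A"
    using 1 M Suc(3) by auto
  have "card A \<le> card {..M}" using 1 by (intro card_mono) (auto simp: M_def)
  then have "k \<le> M" using Suc(3) by simp
  moreover have "\<Sum>A = M + \<Sum>(A - {M})" using M 1 by (simp add: sum.remove)
  ultimately show ?case using Suc(1)[of "A - {M}"] A Suc(3)[symmetric] by simp
next
  case (Suc k)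
  case 2
  define M where "M = Max A"
  have M: "M \<in> A" using Suc(3) 2 by (auto simp: M_def intro!: Max_in)
  have A: "finite (A - {M})" "card (A - {M}) = k" "insert M (A - {M}) = A"
    using 2 M Suc(3) by auto
  have "card A \<le> card {..M}" using 2 by (intro card_mono) (auto simp: M_def)
  then have "k \<le> M" using Suc(3) by simp
  moreover have "\<Sum>A = M + \<Sum>(A - {M})" using M 2 by (simp add: sum.remove)
  moreover have "\<Sum>{..<k} \<le> \<Sum>(A - {M})" using Suc(1)[of "A - {M}"] A by simp
  ultimately have "M = k" "\<Sum>(A - {M}) = \<Sum>{..<k}"
    using 2 Suc(3)[symmetric] by simp_all
  then show ?case using Suc(2)[of "A - {M}"] A Suc(3)[symmetric]
    by (metis lessThan_Suc)
qed simp_all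

text \<open>
  A tableau is recorded by the row and the column of each entry; \<open>down\<close> says that the occupied
  boxes form a Young diagram.
\<close>

locale tab =
  fixes n :: nat and row col :: "nat \<Rightarrow> nat"
  assumes inj: "inj_on (\<lambda>x. (row x, col x)) {1..n}"
    and down: "\<And>x i j. x \<in> {1..n} \<Longrightarrow> i \<le> row x \<Longrightarrow> j \<le> col x \<Longrightarrow> \<exists>y\<in>{1..n}. row y = i \<and> col y = j"
begin

definition Rst :: "sperm set" where "Rst = {g \<in> Sn n. \<forall>x\<in>{1..n}. row (ap g x) = row x}"
definition Cst :: "sperm set" where "Cst = {g \<in> Sn n. \<forall>x\<in>{1..n}. col (ap g x) = col x}"

definition rho :: "'r::comm_ring_1 galg" where "rho = (\<Sum>g\<in>Rst. U g)"
definition kap :: "'r::comm_ring_1 galg" where "kap = (\<Sum>g\<in>Cst. Sc (of_int (sgn_perm g)) * U g)"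

text \<open>The scalar in \<open>kap * z * rho = Sc (omega z) * (kap * rho)\<close> (lemma
  \<open>sandwich\<close>), written out as a linear form with weights \<open>1\<close> and
  \<open>- 1\<close>. In this form it makes sense for all \<open>z\<close> over every ring and
  commutes with changes of coefficients.\<close>

definition omega :: "'r::comm_ring_1 galg \<Rightarrow> 'r" where
  "omega z = (\<Sum>c\<in>Cst. \<Sum>r\<in>Rst. of_int (sgn_perm c) * lk z (c + r))"

definition colset :: "nat \<Rightarrow> nat set" where "colset j = {x \<in> {1..n}. col x = j}"

lemma entry_eqI: "x \<in> {1..n} \<Longrightarrow> y \<in> {1..n} \<Longrightarrow> row x = row y \<Longrightarrow> col x = col y \<Longrightarrow> x = y"
  using inj_onD[OF inj, of x y] by simp

lemma inj_on_row: "inj_on row (colset j)"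
  by (rule inj_onI, rule entry_eqI) (auto simp: colset_def)

lemma finite_st [simp]: "finite Rst" "finite Cst" "finite (colset j)"
  by (auto simp: Rst_def Cst_def colset_def)

lemma st_Sn: "g \<in> Rst \<Longrightarrow> g \<in> Sn n" "g \<in> Cst \<Longrightarrow> g \<in> Sn n"
  by (auto simp: Rst_def Cst_def)

lemma st_0 [simp]: "0 \<in> Rst" "0 \<in> Cst" by (auto simp: Rst_def Cst_def)

lemma st_add: "g \<in> Rst \<Longrightarrow> h \<in> Rst \<Longrightarrow> g + h \<in> Rst" "g \<in> Cst \<Longrightarrow> h \<in> Cst \<Longrightarrow> g + h \<in> Cst"
  using Sn_image unfolding Rst_def Cst_def by auto

lemma st_uminus: "g \<in> Rst \<Longrightarrow> - g \<in> Rst" "g \<in> Cst \<Longrightarrow> - g \<in> Cst"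
proof -
  have N: "ap (- g) x \<in> {1..n}" if "g \<in> Sn n" "x \<in> {1..n}" for x
    using that Sn_image[of "- g" n x] by blast
  show "- g \<in> Rst" if "g \<in> Rst"
    using that N unfolding Rst_def by (auto simp: Ball_def) (metis ap_uminus_ap(2))
  show "- g \<in> Cst" if "g \<in> Cst"
    using that N unfolding Cst_def by (auto simp: Ball_def) (metis ap_uminus_ap(2))
qed

lemma tr_st:
  assumes "x \<in> {1..n}" "y \<in> {1..n}"
  shows "row x = row y \<Longrightarrow> tr x y \<in> Rst" "col x = col y \<Longrightarrow> tr x y \<in> Cst"
  using assms by (auto simp: Rst_def Cst_def ap_tr transpose_def intro!: tr_in_Sn)

lemma Rst_Cst_trivial: "g \<in> Rst \<Longrightarrow> g \<in> Cst \<Longrightarrow> g = 0"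
proof (rule sperm_eqI)
  fix x assume g: "g \<in> Rst" "g \<in> Cst"
  show "ap g x = ap 0 x"
  proof (cases "x \<in> {1..n}")
    case True
    then have "ap g x \<in> {1..n}" "row (ap g x) = row x" "col (ap g x) = col x"
      using g Sn_image[of g n x] by (auto simp: Rst_def Cst_def)
    then show ?thesis using inj_onD[OF inj, of "ap g x" x] True by simp
  next
    case False
    then show ?thesis using st_Sn(1)[OF g(1)] by (simp add: Sn_def permutes_not_in)
  qed
qed

lemma supp_in_kap: "supp_in n kap"
  unfolding kap_def by (intro supp_in_sum supp_in_mult supp_in_Sc supp_in_U st_Sn(2))

lemma lk_rho: "lk rho g = (if g \<in> Rst then 1 else 0)"
  by (simp add: rho_def lookup_sum lk_U)

lemma lk_kap: "lk kap g = (if g \<in> Cst then of_int (sgn_perm g) else 0)"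
proof -
  have "lk kap g = (\<Sum>h\<in>Cst. if h = g then of_int (sgn_perm h) else (0::'a))"
    unfolding kap_def lookup_sum by (intro sum.cong) (auto simp: lk_U simp del: lk_mult_U)
  then show ?thesis by simp
qed

lemma U_rho: "g \<in> Rst \<Longrightarrow> U g * rho = rho"
proof (rule poly_mapping_eqI)
  fix h assume g: "g \<in> Rst"
  have "- g + h \<in> Rst \<longleftrightarrow> h \<in> Rst"
    using st_add(1)[of "- g" h] st_add(1)[of g "- g + h"] st_uminus(1)[OF g] g
    by (auto simp flip: add.assoc)
  then show "lk (U g * rho) h = lk rho h" by (simp add: lk_rho)
qed

lemma U_kap: "g \<in> Cst \<Longrightarrow> U g * kap = Sc (of_int (sgn_perm g)) * kap"
proof (rule poly_mapping_eqI)
  fix h assume g: "g \<in> Cst"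
  have "- g + h \<in> Cst \<longleftrightarrow> h \<in> Cst"
    using st_add(2)[of "- g" h] st_add(2)[of g "- g + h"] st_uminus(2)[OF g] g
    by (auto simp flip: add.assoc)
  then show "lk (U g * kap) h = lk (Sc (of_int (sgn_perm g)) * kap) h" by (simp add: lk_kap)
qed

lemma kap_U: "g \<in> Cst \<Longrightarrow> kap * U g = Sc (of_int (sgn_perm g)) * kap"
proof (rule poly_mapping_eqI)
  fix h assume g: "g \<in> Cst"
  have m: "sgn_perm (h - g) = sgn_perm g * sgn_perm h"
    using sgn_perm_simps(2)[of h "- g"] by (simp add: mult.commute)
  have "h - g \<in> Cst \<longleftrightarrow> h \<in> Cst"
    using st_add(2)[of h "- g"] st_add(2)[of "h - g" g] st_uminus(2)[OF g] g by auto
  then show "lk (kap * U g) h = lk (Sc (of_int (sgn_perm g)) * kap) h" by (simp add: lk_kap m)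
qed

text \<open>The summands of \<open>kap\<close> at \<open>c\<close> and \<open>c + tr x y\<close> cancel; no division by two is involved.\<close>

lemma kap_kill:
  assumes xy: "x \<in> {1..n}" "y \<in> {1..n}" "x \<noteq> y" "col x = col y" and v: "U (tr x y) * v = v"
  shows "kap * v = 0"
proof -
  let ?t = "tr x y"
  \<comment> \<open>Comparing the images of \<open>x\<close> and \<open>y\<close> selects exactly
    one of \<open>c\<close> and \<open>c + ?t\<close>.\<close>
  define C' where "C' = {c \<in> Cst. ap c x < ap c y}"
  define F where "F = (\<lambda>c. Sc (of_int (sgn_perm c)) * U c * v)"
  have t: "?t \<in> Cst" using tr_st(2) xy by auto
  have ct: "c + ?t \<in> Cst" if "c \<in> Cst" for c using st_add(2)[OF that t] .
  have Ct: "Cst = C' \<union> (\<lambda>c. c + ?t) ` C'"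
  proof (intro equalityI subsetI)
    fix c assume c: "c \<in> Cst"
    show "c \<in> C' \<union> (\<lambda>c. c + ?t) ` C'"
    proof (cases "ap c x < ap c y")
      case False
      then have "ap c y < ap c x" using xy(3) by (metis ap_eq_iff linorder_neqE_nat)
      then have "c + ?t \<in> C'" using ct[OF c] by (auto simp: C'_def ap_tr)
      moreover have "c = (c + ?t) + ?t" by (simp add: add.assoc)
      ultimately show ?thesis by blast
    qed (use c in \<open>simp add: C'_def\<close>)
  qed (auto simp: C'_def ct)
  have "kap * v = (\<Sum>c\<in>Cst. F c)" by (simp add: kap_def sum_distrib_right F_def)
  also have "\<dots> = (\<Sum>c\<in>C'. F c) + (\<Sum>c\<in>(\<lambda>c. c + ?t) ` C'. F c)"
    unfolding Ct by (rule sum.union_disjoint) (auto simp: C'_def ap_tr)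
  also have "(\<Sum>c\<in>(\<lambda>c. c + ?t) ` C'. F c) = (\<Sum>c\<in>C'. F (c + ?t))"
    by (rule sum.reindex_cong[OF _ refl refl]) (simp add: inj_on_def)
  also have "(\<Sum>c\<in>C'. F c) + \<dots> = 0"
  proof -
    have "F (c + ?t) = - F c" for c
      using v xy by (simp add: F_def sgn_perm_tr U_plus Sc_simps mult.assoc)
    then show ?thesis by (simp add: sum_negf)
  qed
  finally show ?thesis .
qed

lemma row_colset: "row ` colset j = {..<card (colset j)}"
proof -
  have "row ` colset j = {..<card (row ` colset j)}"
  proof (rule initial_segment_card)
    fix a b assume "a \<in> row ` colset j" "b \<le> a"
    then obtain x where "x \<in> {1..n}" "col x = j" "b \<le> row x" by (auto simp: colset_def)
    then obtain y where "y \<in> {1..n}" "row y = b" "col y = j" using down[of x b j] by auto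
    then show "b \<in> row ` colset j" by (auto simp: colset_def)
  qed simp
  then show ?thesis by (simp add: card_image[OF inj_on_row])
qed

text \<open>
  The sum of the row numbers of all entries does not change under \<open>g\<close>, while within one column
  distinct row numbers have the least possible sum exactly when they are the rows of that column.
\<close>

lemma factor_or_collision:
  assumes g: "g \<in> Sn n"
    and no: "\<And>x y. x \<in> {1..n} \<Longrightarrow> y \<in> {1..n} \<Longrightarrow> col x = col y \<Longrightarrow>
      row (ap (- g) x) = row (ap (- g) y) \<Longrightarrow> x = y"
  shows "\<exists>c\<in>Cst. \<exists>r\<in>Rst. g = c + r"
proof -
  \<comment> \<open>\<open>r' x\<close> is the row of \<open>x\<close> in the tableau moved by
    \<open>g\<close>; the assumption \<open>no\<close> says that entries of one column of the old
    tableau lie in distinct rows of the new one.\<close>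
  define r' where "r' = (\<lambda>x. row (ap (- g) x))"
  have inj_r': "inj_on r' (colset j)" for j
    by (rule inj_onI, rule no) (auto simp: colset_def r'_def)
  have le: "sum row (colset j) \<le> sum r' (colset j)" for j
  proof -
    have "sum row (colset j) = \<Sum>{..<card (r' ` colset j)}"
      using sum.reindex[OF inj_on_row[of j], of id] by (simp add: row_colset card_image[OF inj_r'])
    also have "\<dots> \<le> \<Sum>(r' ` colset j)" by (rule sum_initial_segment_le) simp
    finally show ?thesis using sum.reindex[OF inj_r', of id] by simp
  qed
  have bij: "bij_betw (ap (- g)) {1..n} {1..n}"
    using g Sn_closed(3)[OF g] by (auto simp: Sn_def intro: permutes_imp_bij)
  have "sum r' {1..n} = sum row {1..n}"
    unfolding r'_def by (rule sum.reindex_bij_betw[OF bij])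
  then have tot: "(\<Sum>j\<in>col ` {1..n}. sum r' (colset j)) = (\<Sum>j\<in>col ` {1..n}. sum row (colset j))"
    using sum.image_gen[of "{1..n}" r' col] sum.image_gen[of "{1..n}" row col] by (simp add: colset_def)
  have img: "r' ` colset j = row ` colset j" if j: "j \<in> col ` {1..n}" for j
  proof -
    have "sum r' (colset j) = sum row (colset j)"
    proof (rule ccontr)
      assume "sum r' (colset j) \<noteq> sum row (colset j)"
      then have "sum row (colset j) < sum r' (colset j)" using le[of j] by simp
      then have "(\<Sum>j\<in>col ` {1..n}. sum row (colset j)) < (\<Sum>j\<in>col ` {1..n}. sum r' (colset j))"
        using j le by (intro sum_strict_mono_ex1) auto
      then show False using tot by simp
    qed
    then have "\<Sum>(r' ` colset j) = \<Sum>{..<card (r' ` colset j)}"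
      using sum.reindex[OF inj_on_row[of j], of id] sum.reindex[OF inj_r'[of j], of id]
      by (simp add: row_colset card_image[OF inj_r'])
    then have "r' ` colset j = {..<card (r' ` colset j)}" by (rule sum_initial_segment_le(2)[rotated]) simp
    then show ?thesis by (simp add: row_colset card_image[OF inj_r'])
  qed
  have ex: "\<exists>y\<in>{1..n}. row y = r' x \<and> col y = col x" if "x \<in> {1..n}" for x
  proof -
    have "r' x \<in> row ` colset (col x)" using img[of "col x"] that by (auto simp: colset_def)
    then show ?thesis by (auto simp: colset_def)
  qed
  \<comment> \<open>Within its column of the old tableau every entry is carried to the row it has in
    the moved one. Then \<open>f\<close> preserves columns, and \<open>f\<close> after
    \<open>g\<close> preserves rows.\<close>
  define f where "f = (\<lambda>x. if x \<in> {1..n} then SOME y. y \<in> {1..n} \<and> row y = r' x \<and> col y = col x else x)"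
  have f: "f x \<in> {1..n} \<and> row (f x) = r' x \<and> col (f x) = col x" if "x \<in> {1..n}" for x
  proof -
    have "\<exists>y. y \<in> {1..n} \<and> row y = r' x \<and> col y = col x" using ex[OF that] by blast
    from someI_ex[OF this] show ?thesis using that by (simp add: f_def)
  qed
  have "f permutes {1..n}"
  proof (rule inj_imp_permutes)
    show "inj_on f {1..n}"
    proof (rule inj_onI)
      fix x y assume xy: "x \<in> {1..n}" "y \<in> {1..n}" "f x = f y"
      then have "r' x = r' y" "col x = col y" using f[of x] f[of y] by auto
      then show "x = y" using no[of x y] xy by (auto simp: r'_def)
    qed
    show "f x \<in> {1..n}" if "x \<in> {1..n}" for x using f[OF that] by simp
    show "f x = x" if "x \<notin> {1..n}" for x using that by (simp only: f_def if_False)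
  qed simp
  then have "f \<in> ap ` Sn n" using bij_betw_imp_surj_on[OF bij_betw_ap_Sn[of n]] by simp
  then obtain h where h: "h \<in> Sn n" "ap h = f" by (auto simp: image_iff)
  have hC: "h \<in> Cst" using h(1) f by (simp add: Cst_def h(2))
  have "row (ap (h + g) x) = row x" if "x \<in> {1..n}" for x
  proof -
    have "ap g x \<in> {1..n}" using that g Sn_image by blast
    then show ?thesis using f[of "ap g x"] h(2) by (simp add: r'_def)
  qed
  then have "h + g \<in> Rst" using h(1) g by (simp add: Rst_def)
  moreover have "g = - h + (h + g)" by (simp flip: add.assoc)
  ultimately show ?thesis using st_uminus(2)[OF hC] by blast
qed

lemma omega_0 [simp]: "omega 0 = 0"
  and omega_add: "omega (x + y) = omega x + omega y"
  and omega_diff: "omega (x - y) = omega x - omega y"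
  and omega_Sc_mult: "omega (Sc a * x) = a * omega x"
  by (simp_all add: omega_def lookup_add lookup_minus algebra_simps sum.distrib sum_subtractf
      sum_distrib_left)

lemma omega_sum: "omega (sum f A) = (\<Sum>i\<in>A. omega (f i))"
  by (induction A rule: infinite_finite_induct) (auto simp: omega_add)

lemma add_st_unique: "c \<in> Cst \<Longrightarrow> c' \<in> Cst \<Longrightarrow> r \<in> Rst \<Longrightarrow> r' \<in> Rst \<Longrightarrow> c + r = c' + r' \<Longrightarrow> c = c' \<and> r = r'"
proof -
  assume *: "c \<in> Cst" "c' \<in> Cst" "r \<in> Rst" "r' \<in> Rst" "c + r = c' + r'"
  from *(5) have "- c' + (c + r) + - r = - c' + (c' + r') + - r" by simp
  then have "- c' + c = r' + - r"
    by (simp only: add.assoc right_minus add_0_right minus_add_cancel)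
  moreover have "- c' + c \<in> Cst" "r' + - r \<in> Rst"
    using st_add(2)[OF st_uminus(2)[OF *(2)] *(1)] st_add(1)[OF *(4) st_uminus(1)[OF *(3)]] by auto
  ultimately have "- c' + c = 0" using Rst_Cst_trivial by metis
  then have "c' + (- c' + c) = c'" by simp
  then have "c = c'" by (simp only: add_minus_cancel)
  then show "c = c' \<and> r = r'" using *(5) by simp
qed

lemma omega_U:
  assumes "c \<in> Cst" "r \<in> Rst" shows "omega (U (c + r) :: 'r::comm_ring_1 galg) = of_int (sgn_perm c)"
proof -
  have "(omega (U (c + r)) :: 'r) =
      (\<Sum>c'\<in>Cst. \<Sum>r'\<in>Rst. if c' = c then if r' = r then of_int (sgn_perm c) else 0 else 0)"
    unfolding omega_def lk_U
  proof (intro sum.cong refl)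
    fix c' r' assume "c' \<in> Cst" "r' \<in> Rst"
    then have "c + r = c' + r' \<longleftrightarrow> c' = c \<and> r' = r" using add_st_unique[of c c' r r'] assms by auto
    then show "of_int (sgn_perm c') * (if c + r = c' + r' then 1 else 0) =
        (if c' = c then if r' = r then of_int (sgn_perm c) else 0 else (0 :: 'r))" by simp
  qed
  also have "\<dots> = (\<Sum>c'\<in>Cst. if c' = c then of_int (sgn_perm c) else 0)"
    using assms by (intro sum.cong) auto
  finally show ?thesis using assms by simp
qed

text \<open>Von Neumann's dichotomy. If \<open>g = c + r\<close>, then \<open>c\<close> is absorbed
  by \<open>kap\<close> up to its sign and \<open>r\<close> by \<open>rho\<close>. Otherwise two
  entries of one column share a row after moving by \<open>g\<close>; their transposition fixes
  \<open>U g * rho\<close>, hence \<open>kap\<close> kills it, and no summand of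
  \<open>omega\<close> meets \<open>g\<close>.\<close>

lemma sandwich_U:
  assumes g: "g \<in> Sn n"
  shows "kap * U g * rho = Sc (omega (U g)) * (kap * rho :: 'r::comm_ring_1 galg)"
proof (cases "\<exists>c\<in>Cst. \<exists>r\<in>Rst. g = c + r")
  case True
  then obtain c r where cr: "c \<in> Cst" "r \<in> Rst" "g = c + r" by blast
  have "kap * U g * rho = kap * U c * (U r * rho :: 'r galg)" by (simp add: cr U_plus mult.assoc)
  then show ?thesis by (simp add: cr kap_U U_rho omega_U mult.assoc)
next
  case False
  then obtain x y where xy: "x \<in> {1..n}" "y \<in> {1..n}" "x \<noteq> y" "col x = col y"
      "row (ap (- g) x) = row (ap (- g) y)"
    using factor_or_collision[OF g] by blast
  have "tr x y + g = g + tr (ap (- g) x) (ap (- g) y)" by (simp add: add_tr[of g])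
  moreover have "tr (ap (- g) x) (ap (- g) y) \<in> Rst"
    using xy Sn_image[OF Sn_closed(3)[OF g]] by (intro tr_st) auto
  ultimately have "U (tr x y) * (U g * rho) = (U g * rho :: 'r galg)"
    by (metis U_plus U_rho mult.assoc)
  then have "kap * (U g * rho) = (0 :: 'r galg)" by (rule kap_kill[OF xy(1-4)])
  moreover have "omega (U g :: 'r galg) = 0"
    unfolding omega_def lk_U using False by (intro sum.neutral ballI) auto
  ultimately show ?thesis by (simp add: mult.assoc Sc_simps)
qed

lemma sandwich:
  assumes "supp_in n x"
  shows "kap * x * rho = Sc (omega x) * (kap * rho)"
proof -
  have x: "x = (\<Sum>g\<in>Sn n. Sc (lk x g) * U g)"
    using galg_expand[OF assms[unfolded supp_in_def] finite_Sn] .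
  have *: "kap * (Sc a * U g) * rho = Sc (a * omega (U g)) * (kap * rho)" if "g \<in> Sn n" for g a
  proof -
    have e: "kap * (Sc a * U g) * rho = Sc a * (kap * U g * rho)"
      by (simp only: mult.assoc[symmetric] Sc_commute[of a kap])
    show ?thesis unfolding e unfolding sandwich_U[OF that] Sc_simps(4) by (simp only: mult.assoc)
  qed
  have "kap * x * rho = (\<Sum>g\<in>Sn n. kap * (Sc (lk x g) * U g) * rho)"
    by (subst x) (simp add: sum_distrib_left sum_distrib_right)
  also have "\<dots> = Sc (\<Sum>g\<in>Sn n. lk x g * omega (U g)) * (kap * rho)"
    by (simp add: * Sc_sum sum_distrib_right)
  also have "(\<Sum>g\<in>Sn n. lk x g * omega (U g)) = omega x"
    by (subst (2) x) (simp add: omega_sum omega_Sc_mult)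
  finally show ?thesis .
qed

lemma lk_kap_rho: "lk (kap * rho) g = (\<Sum>c\<in>Cst. of_int (sgn_perm c) * (if - c + g \<in> Rst then 1 else 0))"
proof -
  have "Poly_Mapping.keys (kap :: 'a galg) \<subseteq> Cst" by (auto simp: in_keys_iff lk_kap split: if_splits)
  from lk_mult[OF this finite_st(2)] show ?thesis by (simp add: lk_kap lk_rho)
qed

text \<open>Only \<open>c = 0\<close> contributes because the two stabilisers meet trivially. This
  keeps \<open>kap * rho\<close> from degenerating in any characteristic and lets eigenvalues be
  read off at the identity without division.\<close>

lemma lk_kap_rho_0: "lk (kap * rho) 0 = 1"
proof -
  have "- c \<in> Rst \<longleftrightarrow> c = 0" if "c \<in> Cst" for c
    using that Rst_Cst_trivial[of c] st_uminus(1)[of "- c"] by auto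
  then have "lk (kap * rho) 0 = (\<Sum>c\<in>Cst. if c = 0 then 1 else (0::'a))"
    unfolding lk_kap_rho by (intro sum.cong) auto
  then show ?thesis by simp
qed

text \<open>A central \<open>z\<close> can be moved between \<open>kap\<close> and
  \<open>rho\<close>, where the sandwich turns it into a scalar.\<close>

lemma central_kap_rho:
  assumes "central n z" shows "z * (kap * rho) = Sc (omega z) * (kap * rho)"
proof -
  have "z * (kap * rho) = kap * z * rho"
    using central_commute[OF assms supp_in_kap] by (simp flip: mult.assoc)
  then show ?thesis using sandwich assms by (auto simp: central_def)
qed

lemma omega_eqI:
  assumes "central n z" "z * (kap * rho) = Sc a * (kap * rho)" shows "omega z = a"
proof -
  have "lk (Sc (omega z) * (kap * rho)) 0 = lk (Sc a * (kap * rho)) 0"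
    using central_kap_rho[OF assms(1)] assms(2) by simp
  then show ?thesis by (simp add: lk_kap_rho_0)
qed

lemma omega_mult:
  assumes "central n x" "central n y" shows "omega (x * y) = omega x * omega y"
proof (rule omega_eqI[OF central_mult[OF assms]])
  have "x * y * (kap * rho) = x * (Sc (omega y) * (kap * rho))"
    by (simp only: mult.assoc central_kap_rho[OF assms(2)])
  also have "\<dots> = Sc (omega y) * (x * (kap * rho))"
    by (simp only: mult.assoc[symmetric] Sc_commute[of _ x])
  also have "\<dots> = Sc (omega y) * (Sc (omega x) * (kap * rho))"
    by (simp only: central_kap_rho[OF assms(1)])
  also have "\<dots> = Sc (omega x * omega y) * (kap * rho)"
    by (simp only: mult.commute[of "omega x"] Sc_simps(4) mult.assoc)
  finally show "x * y * (kap * rho) = Sc (omega x * omega y) * (kap * rho)" .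
qed

lemma omega_1 [simp]: "omega 1 = 1"
  by (rule omega_eqI) (simp_all add: central_1 Sc_simps)

lemma omega_Sc [simp]: "omega (Sc a) = a"
  using omega_Sc_mult[of a 1] by simp

lemma omega_power: "central n x \<Longrightarrow> omega (x ^ k) = omega x ^ k"
  by (induction k) (auto simp: omega_mult central_power)

lemma omega_prod_list:
  "(\<And>x. x \<in> set xs \<Longrightarrow> central n x) \<Longrightarrow> omega (prod_list xs) = prod_list (map omega xs)"
  by (induction xs) (auto simp: omega_mult central_prod_list)

subsection \<open>The Garnir relation for one entry against a full column\<close>

text \<open>Expand \<open>kap\<close> and consider the pairs \<open>(c, k)\<close>. If
  \<open>k\<close> stands in the row of \<open>x\<close> in the tableau moved by \<open>c\<close>,
  then \<open>tr k x\<close> is absorbed by \<open>rho\<close>; these pairs, one for each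
  \<open>c\<close>, add up to the right-hand side. The others cancel under a sign-reversing
  involution.\<close>

lemma garnir:
  assumes x: "x \<in> {1..n}" and j: "j < col x"
  shows "(\<Sum>k\<in>colset j. U (tr k x)) * (kap * rho) = (kap * rho :: 'r::comm_ring_1 galg)"
proof -
  \<comment> \<open>The entry in row \<open>i\<close> of column \<open>j\<close>. For the rows that
    occur it exists by \<open>down\<close>, since column \<open>j\<close> lies to the left of that
    of \<open>x\<close>.\<close>
  define el where "el = (\<lambda>i. SOME z. z \<in> {1..n} \<and> row z = i \<and> col z = j)"
  \<comment> \<open>The entry of column \<open>j\<close> that stands beside \<open>x\<close> in the
    tableau moved by \<open>c\<close>.\<close>
  define K where "K = (\<lambda>c. ap c (el (row (ap (- c) x))))"
  define sg where "sg = (\<lambda>c. Sc (of_int (sgn_perm c)) :: 'r galg)"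
  define F where "F = (\<lambda>(c, k). sg c * (U (tr k x + c) * rho) :: 'r galg)"
  have y: "ap (- c) x \<in> {1..n}" "col (ap (- c) x) = col x" if "c \<in> Cst" for c
    using st_uminus(2)[OF that] x Sn_image[of "- c" n x] by (auto simp: Cst_def)
  have el: "el (row (ap (- c) x)) \<in> {1..n}" "row (el (row (ap (- c) x))) = row (ap (- c) x)"
      "col (el (row (ap (- c) x))) = j" if "c \<in> Cst" for c
  proof -
    have "\<exists>z. z \<in> {1..n} \<and> row z = row (ap (- c) x) \<and> col z = j"
      using down[OF y(1)[OF that] order_refl, of j] y(2)[OF that] j by auto
    from someI_ex[OF this]
    show "el (row (ap (- c) x)) \<in> {1..n}" "row (el (row (ap (- c) x))) = row (ap (- c) x)"
      "col (el (row (ap (- c) x))) = j" by (simp_all add: el_def)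
  qed
  have K: "K c \<in> colset j" if "c \<in> Cst" for c
    using el[OF that] that Sn_image[of c n] unfolding K_def colset_def by (auto simp: Cst_def)
  have Kx: "U (tr (K c) x + c) * rho = (U c * rho :: 'r galg)" if c: "c \<in> Cst" for c
  proof -
    have "tr (K c) x + c = c + tr (el (row (ap (- c) x))) (ap (- c) x)"
      by (simp add: add_tr[of c] K_def)
    moreover have "tr (el (row (ap (- c) x))) (ap (- c) x) \<in> Rst"
      using el[OF c] y[OF c] by (intro tr_st) auto
    ultimately show ?thesis by (simp add: U_plus mult.assoc U_rho)
  qed
  \<comment> \<open>The partner of \<open>(c, k)\<close> under \<open>i\<close> has second component
    \<open>K c\<close> and its own \<open>K\<close> equal to \<open>k\<close>; thus
    \<open>k < K c\<close> holds for exactly one of the two, unless \<open>k = K c\<close>.\<close>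
  define P where "P = {(c, k). c \<in> Cst \<and> k \<in> colset j \<and> k < K c}"
  define i where "i = (\<lambda>(c, k). (tr (K c) k + c, K c))"
  have iK: "tr (K c) k + c \<in> Cst" "K (tr (K c) k + c) = k" if "c \<in> Cst" "k \<in> colset j" for c k
  proof -
    have "tr (K c) k \<in> Cst" using K[OF that(1)] that(2) by (intro tr_st) (auto simp: colset_def)
    then show "tr (K c) k + c \<in> Cst" using st_add that by auto
    have "x \<noteq> K c" "x \<noteq> k" using K[OF that(1)] that(2) j by (auto simp: colset_def)
    then have "ap (- (tr (K c) k + c)) x = ap (- c) x"
      by (simp add: minus_add ap_tr)
    then show "K (tr (K c) k + c) = k" by (simp add: K_def ap_tr)
  qed
  have i: "i (i p) = p" if "p \<in> P" for p
  proof -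
    obtain c k where p: "p = (c, k)" by fastforce
    then have "c \<in> Cst" "k \<in> colset j" using that by (auto simp: P_def)
    then show ?thesis by (simp add: p i_def iK tr_commute[of k])
  qed
  have Fi: "F (i p) = - F p" if "p \<in> P" for p
  proof -
    obtain c k where p: "p = (c, k)" by fastforce
    then have c: "c \<in> Cst" "k \<in> colset j" "k < K c" using that by (auto simp: P_def)
    have ne: "x \<noteq> K c" "x \<noteq> k" using K[OF c(1)] c(2) j by (auto simp: colset_def)
    \<comment> \<open>Conjugation by \<open>tr (K c) x\<close> turns \<open>tr (K c) k\<close> into
      \<open>tr k x\<close>; the factor left behind is absorbed through \<open>Kx\<close>.\<close>
    have "tr (K c) x + (tr (K c) k + c) = tr k x + (tr (K c) x + c)"
      using add_tr[of "tr (K c) x" "K c" k] ne c(3)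
      by (simp add: ap_tr tr_commute[of x k] flip: add.assoc)
    then have "U (tr (K c) x + (tr (K c) k + c)) * rho = (U (tr k x + c) * rho :: 'r galg)"
      using Kx[OF c(1)] by (simp add: U_plus mult.assoc)
    then show ?thesis using c(3) by (simp add: p i_def F_def sg_def sgn_perm_tr Sc_simps)
  qed
  have all: "Cst \<times> colset j = (\<lambda>c. (c, K c)) ` Cst \<union> (P \<union> i ` P)"
  proof (intro equalityI subsetI)
    fix p assume "p \<in> Cst \<times> colset j"
    then obtain c k where p: "p = (c, k)" "c \<in> Cst" "k \<in> colset j" by auto
    consider "k = K c" | "k < K c" | "K c < k" by linarith
    then show "p \<in> (\<lambda>c. (c, K c)) ` Cst \<union> (P \<union> i ` P)"
    proof cases
      case 3
      have "i p \<in> P" using 3 p iK[OF p(2,3)] K by (auto simp: i_def P_def)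
      moreover have "i (i p) = p" using p iK by (simp add: i_def tr_commute[of k])
      ultimately show ?thesis by (metis UnI2 image_eqI)
    qed (use p in \<open>auto simp: P_def\<close>)
  qed (use K iK in \<open>auto simp: P_def i_def\<close>)
  have fin: "finite P" by (rule finite_subset[of _ "Cst \<times> colset j"]) (auto simp: P_def)
  have "(\<Sum>k\<in>colset j. U (tr k x)) * (kap * rho) = (\<Sum>k\<in>colset j. \<Sum>c\<in>Cst. F (c, k))"
  proof -
    have H: "U g * (Sc a * U c * rho) = Sc a * (U (g + c) * rho :: 'r galg)" for g c a
    proof -
      have "U g * (Sc a * U c * rho) = (U g * Sc a) * (U c * rho :: 'r galg)" by (simp only: mult.assoc)
      also have "U g * Sc a = Sc a * U g" by (rule Sc_commute[symmetric])
      finally show ?thesis by (simp only: U_plus mult.assoc)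
    qed
    show ?thesis
      unfolding kap_def sum_distrib_right sum_distrib_left F_def sg_def prod.case
      by (subst sum.swap) (intro sum.cong refl H)
  qed
  also have "\<dots> = (\<Sum>p\<in>Cst \<times> colset j. F p)"
    by (subst sum.swap) (simp add: sum.cartesian_product)
  also have "\<dots> = (\<Sum>p\<in>(\<lambda>c. (c, K c)) ` Cst. F p) + (\<Sum>p\<in>P \<union> i ` P. F p)"
    unfolding all using fin iK by (intro sum.union_disjoint) (auto simp: P_def i_def)
  also have "(\<Sum>p\<in>P \<union> i ` P. F p) = (\<Sum>p\<in>P. F p) + (\<Sum>p\<in>i ` P. F p)"
    using fin iK by (intro sum.union_disjoint) (auto simp: P_def i_def)
  also have "(\<Sum>p\<in>i ` P. F p) = (\<Sum>p\<in>P. F (i p))"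
    by (rule sum.reindex_cong[OF _ refl refl]) (metis i inj_onI)
  also have "(\<Sum>p\<in>P. F p) + (\<Sum>p\<in>P. F (i p)) = 0" using Fi by (simp add: sum_negf)
  also have "(\<Sum>p\<in>(\<lambda>c. (c, K c)) ` Cst. F p) = (\<Sum>c\<in>Cst. F (c, K c))"
    by (rule sum.reindex_cong[OF _ refl refl]) (simp add: inj_on_def)
  also have "\<dots> = kap * rho"
    using Kx by (simp add: F_def kap_def sum_distrib_right sg_def mult.assoc)
  finally show ?thesis by simp
qed

end

section \<open>Jucys--Murphy eigenvalues and contents\<close>

locale column_tab = tab +
  assumes order: "\<And>x y. x \<in> {1..n} \<Longrightarrow> y \<in> {1..n} \<Longrightarrow>
    x < y \<longleftrightarrow> col x < col y \<or> (col x = col y \<and> row x < row y)"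
begin

definition content :: "nat \<Rightarrow> int" where "content x = int (col x) - int (row x)"

text \<open>In column order the numbers below \<open>x\<close> fill the columns to the left of
  \<open>x\<close> completely, together with the boxes above \<open>x\<close>. Each full column
  contributes 1 by \<open>garnir\<close>, and each entry above \<open>x\<close> contributes -1 as a
  column transposition.\<close>

lemma JM_kap_rho:
  assumes x: "x \<in> {1..n}"
  shows "JM x * (kap * rho) = Sc (of_int (content x)) * (kap * rho :: 'r::comm_ring_1 galg)"
proof -
  define Y where "Y = {k \<in> colset (col x). row k < row x}"
  let ?E = "kap * rho :: 'r galg"
  have split: "{1..<x} = (\<Union>j\<in>{..<col x}. colset j) \<union> Y"
  proof -
    have "{1..<x} = {y \<in> {1..n}. y < x}" using x by auto
    also have "\<dots> = {y \<in> {1..n}. col y < col x \<or> (col y = col x \<and> row y < row x)}"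
      using order x by blast
    finally show ?thesis by (auto simp: Y_def colset_def)
  qed
  have fin: "finite Y" by (simp add: Y_def)
  have "JM x = (\<Sum>k\<in>(\<Union>j\<in>{..<col x}. colset j). U (tr k x)) + (\<Sum>k\<in>Y. U (tr k x) :: 'r galg)"
    unfolding JM_def split using fin by (intro sum.union_disjoint) (auto simp: Y_def colset_def)
  also have "(\<Sum>k\<in>(\<Union>j\<in>{..<col x}. colset j). U (tr k x)) = (\<Sum>j<col x. \<Sum>k\<in>colset j. U (tr k x) :: 'r galg)"
    by (rule sum.UNION_disjoint) (auto simp: colset_def)
  finally have "JM x * ?E = (\<Sum>j<col x. (\<Sum>k\<in>colset j. U (tr k x)) * ?E) + (\<Sum>k\<in>Y. U (tr k x) * ?E)"
    by (simp only: distrib_right sum_distrib_right)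
  also have "(\<Sum>j<col x. (\<Sum>k\<in>colset j. U (tr k x)) * ?E) = of_nat (col x) * ?E"
  proof -
    have "(\<Sum>j<col x. (\<Sum>k\<in>colset j. U (tr k x)) * ?E) = (\<Sum>j<col x. ?E)"
      by (intro sum.cong refl garnir[OF x]) simp
    then show ?thesis by simp
  qed
  also have "(\<Sum>k\<in>Y. U (tr k x) * ?E) = - of_nat (row x) * ?E"
  proof -
    have "U (tr k x) * ?E = - ?E" if "k \<in> Y" for k
    proof -
      have "k \<in> {1..n}" "col k = col x" "k \<noteq> x" using that by (auto simp: Y_def colset_def)
      then have "U (tr k x) * kap = - (kap :: 'r galg)"
        using U_kap[OF tr_st(2)[of k x]] x by (simp add: sgn_perm_tr Sc_simps)
      then show ?thesis by (simp flip: mult.assoc)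
    qed
    moreover have "card Y = row x"
    proof -
      have "inj_on row Y" by (rule inj_on_subset[OF inj_on_row[of "col x"]]) (auto simp: Y_def)
      moreover have "row ` Y = {..<row x}"
      proof (intro equalityI subsetI)
        fix i assume i: "i \<in> {..<row x}"
        then obtain y where "y \<in> {1..n}" "row y = i" "col y = col x"
          using down[OF x, of i "col x"] by auto
        then show "i \<in> row ` Y" using i by (auto simp: Y_def colset_def)
      qed (auto simp: Y_def)
      ultimately show ?thesis by (metis card_image card_lessThan)
    qed
    ultimately show ?thesis by simp
  qed
  also have "of_nat (col x) * ?E + - of_nat (row x) * ?E = Sc (of_int (content x)) * ?E"
    by (simp add: content_def Sc_of_nat Sc_simps(6) left_diff_distrib)
  finally show ?thesis .
qed

lemma JM_power_kap_rho:
  assumes x: "x \<in> {1..n}"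
  shows "JM x ^ k * (kap * rho) = Sc (of_int (content x) ^ k) * (kap * rho :: 'r::comm_ring_1 galg)"
proof (induction k)
  case (Suc k)
  have "JM x ^ Suc k * (kap * rho) = JM x * (Sc (of_int (content x) ^ k) * (kap * rho :: 'r galg))"
    by (simp only: power_Suc mult.assoc Suc)
  also have "\<dots> = Sc (of_int (content x) ^ k) * (JM x * (kap * rho))"
    by (simp only: mult.assoc[symmetric] Sc_commute[of _ "JM x"])
  also have "\<dots> = Sc (of_int (content x) ^ k) * (Sc (of_int (content x)) * (kap * rho))"
    by (simp only: JM_kap_rho[OF x])
  finally show ?case by (simp only: Sc_simps(4) mult.assoc power_Suc2)
qed (simp add: Sc_simps)

lemma JM_monomial_kap_rho:
  assumes "m \<le> n"
  shows "JM_monomial \<alpha> m * (kap * rho) =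
    Sc (\<Prod>i\<in>{1..m}. of_int (content i) ^ \<alpha> i) * (kap * rho :: 'r::comm_ring_1 galg)"
  using assms
proof (induction m)
  case (Suc m)
  let ?a = "of_int (content (Suc m)) ^ \<alpha> (Suc m) :: 'r"
  have "JM_monomial \<alpha> (Suc m) * (kap * rho) = JM_monomial \<alpha> m * (Sc ?a * (kap * rho))"
    using Suc.prems by (simp only: JM_monomial_Suc mult.assoc) (simp add: JM_power_kap_rho)
  also have "\<dots> = Sc ?a * (JM_monomial \<alpha> m * (kap * rho))"
    by (simp only: mult.assoc[symmetric] Sc_commute[of _ "JM_monomial \<alpha> m"])
  also have "JM_monomial \<alpha> m * (kap * rho) =
    Sc (\<Prod>i\<in>{1..m}. of_int (content i) ^ \<alpha> i) * (kap * rho :: 'r galg)" using Suc by simp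
  finally show ?case by (simp add: Sc_simps mult.assoc[symmetric] mult.commute)
qed (simp add: Sc_simps)

lemma omega_sum_monomials:
  assumes "central n (\<Sum>\<alpha>\<in>Q. JM_monomial \<alpha> n :: 'r::comm_ring_1 galg)"
  shows "omega (\<Sum>\<alpha>\<in>Q. JM_monomial \<alpha> n :: 'r galg) = (\<Sum>\<alpha>\<in>Q. \<Prod>i\<in>{1..n}. of_int (content i) ^ \<alpha> i)"
  by (rule omega_eqI[OF assms]) (simp add: sum_distrib_right JM_monomial_kap_rho Sc_sum)

lemma omega_JM_poly: "omega (JM_poly n a) = (\<Prod>i\<in>{1..n}. a + of_int (content i))"
proof (rule omega_eqI[OF central_JM_poly])
  have "m \<le> n \<Longrightarrow> JM_poly m a * (kap * rho) = Sc (\<Prod>i\<in>{1..m}. a + of_int (content i)) * (kap * rho)" for m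
  proof (induction m)
    case (Suc m)
    let ?a = "a + of_int (content (Suc m))"
    have "(Sc a + JM (Suc m)) * (kap * rho) = Sc ?a * (kap * rho)"
      using Suc.prems JM_kap_rho[of "Suc m", where ?'r = 'a] by (simp add: distrib_right Sc_simps)
    then have "JM_poly (Suc m) a * (kap * rho) = JM_poly m a * (Sc ?a * (kap * rho))"
      by (simp only: JM_poly_Suc mult.assoc)
    also have "\<dots> = Sc ?a * (JM_poly m a * (kap * rho))"
      by (simp only: mult.assoc[symmetric] Sc_commute[of _ "JM_poly m a"])
    also have "JM_poly m a * (kap * rho) = Sc (\<Prod>i\<in>{1..m}. a + of_int (content i)) * (kap * rho)"
      using Suc by simp
    finally show ?case by (simp add: Sc_simps(4) mult.assoc[symmetric] mult.commute)
  qed (simp add: Sc_simps)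
  then show "JM_poly n a * (kap * rho) = Sc (\<Prod>i\<in>{1..n}. a + of_int (content i)) * (kap * rho)" by simp
qed

end

section \<open>Leading terms of monomial symmetric functions of Jucys--Murphy elements\<close>

text \<open>For distinct letters other than \<open>m\<close> this is the cycle sending
  \<open>m\<close> to the first letter, each letter to the next one and the last letter back to
  \<open>m\<close>. The factors stand in the order in which they arise from powers of
  \<open>JM m\<close>.\<close>

fun cyc :: "nat list \<Rightarrow> nat \<Rightarrow> sperm" where
  "cyc [] m = 0"
| "cyc (j # js) m = cyc js m + tr j m"

lemma JM_power_expand:
  "(JM m :: 'r::comm_ring_1 galg) ^ a = (\<Sum>js | set js \<subseteq> {1..<m} \<and> length js = a. U (cyc js m))"
proof (induction a)
  case 0
  have "{js. set js \<subseteq> {1..<m} \<and> length js = 0} = {[]}" by auto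
  then show ?case by simp
next
  case (Suc a)
  let ?S = "\<lambda>a. {js. set js \<subseteq> {1..<m} \<and> length js = a}"
  have "(JM m :: 'r galg) ^ Suc a = (\<Sum>js\<in>?S a. U (cyc js m)) * JM m" by (simp only: power_Suc2 Suc)
  also have "\<dots> = (\<Sum>(js, j)\<in>?S a \<times> {1..<m}. U (cyc (j # js) m))"
    unfolding JM_def sum_product sum.cartesian_product by (simp add: U_plus)
  also have "\<dots> = (\<Sum>js\<in>?S (Suc a). U (cyc js m))"
    unfolding lists_length_Suc_eq
    by (subst sum.reindex) (auto simp: inj_on_def case_prod_unfold)
  finally show ?case .
qed

lemma moved_add: "moved (g + h) \<subseteq> moved g \<union> moved h"
  by (auto simp: moved_def)

lemma moved_iff: "x \<in> moved g \<longleftrightarrow> ap g x \<noteq> x"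
  by (simp add: moved_def)

lemma cyc_fixes: "x \<notin> set js \<Longrightarrow> x \<noteq> m \<Longrightarrow> ap (cyc js m) x = x"
  by (induction js) (auto simp: ap_tr)

lemma moved_cyc: "moved (cyc js m) \<subseteq> insert m (set js)"
  using cyc_fixes[of _ js m] by (auto simp: moved_def)

lemma cyc_nth:
  "distinct js \<Longrightarrow> m \<notin> set js \<Longrightarrow> i < Suc (length js) \<Longrightarrow>
    ap (cyc js m) ((m # js) ! i) = (m # js) ! (Suc i mod Suc (length js))"
proof -
  have 1: "distinct js \<Longrightarrow> m \<notin> set js \<Longrightarrow> i < length js \<Longrightarrow> ap (cyc js m) ((m # js) ! i) = js ! i" for i
  proof (induction js arbitrary: i)
    case (Cons j js)
    show ?case
    proof (cases i)
      case 0
      then show ?thesis using Cons.prems by (simp add: ap_tr cyc_fixes)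
    next
      case (Suc k)
      show ?thesis
      proof (cases k)
        case 0
        then show ?thesis using Suc Cons.prems Cons.IH[of 0] by (simp add: ap_tr)
      next
        case (Suc l)
        have "js ! l \<noteq> j" "js ! l \<noteq> m" using Cons.prems \<open>i = Suc k\<close> Suc by (auto simp: in_set_conv_nth)
        then show ?thesis using Suc \<open>i = Suc k\<close> Cons.prems Cons.IH[of k] by (simp add: ap_tr)
      qed
    qed
  qed simp
  have 2: "distinct js \<Longrightarrow> m \<notin> set js \<Longrightarrow> ap (cyc js m) ((m # js) ! length js) = m"
  proof (induction js)
    case (Cons j js)
    show ?case
    proof (cases "js = []")
      case False
      then have "js ! (length js - 1) \<in> set js" by simp
      then have "js ! (length js - 1) \<noteq> j" "js ! (length js - 1) \<noteq> m" using Cons.prems by auto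
      then show ?thesis using Cons False by (auto simp: ap_tr nth_Cons' )
    qed (use Cons.prems in \<open>simp add: ap_tr\<close>)
  qed simp
  assume "distinct js" "m \<notin> set js" "i < Suc (length js)"
  then show ?thesis using 1[of i] 2 by (cases "i = length js") auto
qed

lemma cyc_moves:
  assumes "distinct js" "m \<notin> set js" "js \<noteq> []" "x \<in> insert m (set js)"
  shows "ap (cyc js m) x \<in> insert m (set js)" "ap (cyc js m) x \<noteq> x"
proof -
  obtain i where i: "i < Suc (length js)" "x = (m # js) ! i"
    using assms(4) by (metis in_set_conv_nth length_Cons list.set(2))
  let ?k = "Suc i mod Suc (length js)"
  have e: "ap (cyc js m) x = (m # js) ! ?k" using cyc_nth assms i by simp
  have k: "?k < length (m # js)" by simp
  show "ap (cyc js m) x \<in> insert m (set js)" using nth_mem[OF k] e by simp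
  have "?k \<noteq> i" using i assms(3) by (auto simp: mod_Suc split: if_splits)
  then show "ap (cyc js m) x \<noteq> x"
    using e i k assms nth_eq_iff_index_eq[of "m # js" ?k i] by auto
qed

text \<open>Expresses that \<open>h\<close> and the cycle through \<open>Suc n\<close> spelled by
  \<open>js\<close> are disjoint, so that \<open>h + cyc js (Suc n)\<close> splits off the cycle of
  the largest point. The empty word means that \<open>Suc n\<close> is fixed.\<close>

definition good :: "nat \<Rightarrow> sperm \<Rightarrow> nat list \<Rightarrow> bool" where
  "good n h js \<longleftrightarrow> h \<in> Sn n \<and> distinct js \<and> set js \<subseteq> {1..n} \<and> set js \<inter> moved h = {}"

lemma moved_good:
  assumes "good n h js"
  shows "moved (h + cyc js (Suc n)) = moved h \<union> (if js = [] then {} else insert (Suc n) (set js))"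
proof (cases "js = []")
  case False
  let ?m = "Suc n"
  have m: "?m \<notin> set js" and mh: "?m \<notin> moved h" using assms by (auto simp: good_def Sn_iff_moved)
  have d: "distinct js" using assms by (simp add: good_def)
  have "x \<in> moved (h + cyc js ?m) \<longleftrightarrow> x \<in> moved h \<union> insert ?m (set js)" for x
  proof (cases "x \<in> insert ?m (set js)")
    case True
    have y: "ap (cyc js ?m) x \<in> insert ?m (set js)" "ap (cyc js ?m) x \<noteq> x"
      using cyc_moves[OF d m False True] by auto
    then have "ap h (ap (cyc js ?m) x) = ap (cyc js ?m) x"
      using mh assms by (auto simp: good_def moved_iff)
    then show ?thesis using y(2) True by (simp add: moved_iff)
  next
    case x: False
    then show ?thesis by (simp add: moved_iff cyc_fixes)
  qed
  then show ?thesis using False by auto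
qed simp

lemma good_card:
  assumes "good n h js" "js \<noteq> []"
  shows "card (moved (h + cyc js (Suc n))) = card (moved h) + Suc (length js)"
proof -
  have m: "Suc n \<notin> set js" "Suc n \<notin> moved h" "distinct js" "moved h \<inter> set js = {}"
    using assms by (auto simp: good_def Sn_iff_moved)
  then have "card (moved h \<union> insert (Suc n) (set js)) = card (moved h) + card (insert (Suc n) (set js))"
    by (intro card_Un_disjoint) (auto simp: finite_moved)
  then show ?thesis using m assms(2) by (simp add: moved_good[OF assms(1)] distinct_card)
qed

text \<open>The image of \<open>Suc n\<close> is the first letter of the word; cancelling its
  transposition on the right leaves a shorter word of the same kind.\<close>

lemma good_unique:
  assumes "good n h js" "good n h' js'" "h + cyc js (Suc n) = h' + cyc js' (Suc n)"
  shows "js = js' \<and> h = h'"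
  using assms
proof (induction js arbitrary: js')
  case (Cons j js)
  have m: "ap (h + cyc (j # js) (Suc n)) (Suc n) = j"
    using Cons.prems(1) by (auto simp: good_def moved_iff ap_tr cyc_fixes)
  obtain js'' where js': "js' = j # js''"
  proof (cases js')
    case Nil
    then have "ap (h' + cyc js' (Suc n)) (Suc n) = Suc n"
      using Cons.prems(2) by (auto simp: good_def Sn_iff_moved moved_def)
    then have "j = Suc n" using m[unfolded Cons.prems(3)] by simp
    then show ?thesis using Cons.prems(1) by (auto simp: good_def)
  next
    case (Cons j' js'')
    have "ap (h' + cyc js' (Suc n)) (Suc n) = j'"
      using \<open>good n h' js'\<close> Cons by (auto simp: good_def moved_iff ap_tr cyc_fixes)
    then show ?thesis using that[of js''] Cons m[unfolded Cons.prems(3)] by simp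
  qed
  have "h + cyc js (Suc n) = h' + cyc js'' (Suc n)"
    using Cons.prems(3) js' by (simp flip: add.assoc)
  moreover have "good n h js" "good n h' js''" using Cons.prems js' by (auto simp: good_def)
  ultimately show ?case using Cons.IH[of js''] js' by simp
next
  case Nil
  have "js' = []"
  proof (cases js')
    case (Cons j' js'')
    have "ap (h' + cyc js' (Suc n)) (Suc n) = j'"
      using Nil(2) Cons by (auto simp: good_def moved_iff ap_tr cyc_fixes)
    moreover have "ap (h + cyc [] (Suc n)) (Suc n) = Suc n"
      using Nil(1) by (auto simp: good_def Sn_iff_moved moved_def)
    ultimately have "j' = Suc n" using Nil(3) by simp
    then show ?thesis using Nil(2) Cons by (auto simp: good_def)
  qed simp
  then show ?case using Nil by simp
qed

text \<open>If \<open>Suc n\<close> is moved to \<open>x\<close>, multiplying by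
  \<open>tr x (Suc n)\<close> on the right removes \<open>x\<close> from the cycle of
  \<open>Suc n\<close>. Fewer points are moved, and \<open>x\<close> is put back as the first letter
  of the word.\<close>

lemma good_exists:
  assumes "g \<in> Sn (Suc n)"
  shows "\<exists>h js. good n h js \<and> g = h + cyc js (Suc n)"
  using assms
proof (induction "card (moved g)" arbitrary: g rule: less_induct)
  case less
  let ?m = "Suc n"
  show ?case
  proof (cases "ap g ?m = ?m")
    case True
    have "moved g \<subseteq> {1..n}"
    proof
      fix x assume x: "x \<in> moved g"
      then have "x \<in> {1..?m}" using less.prems by (auto simp: Sn_iff_moved)
      moreover have "x \<noteq> ?m" using x True by (auto simp: moved_iff)
      ultimately show "x \<in> {1..n}" by auto
    qed
    then show ?thesis by (intro exI[of _ g] exI[of _ "[]"]) (simp add: good_def Sn_iff_moved)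
  next
    case False
    define x where "x = ap g ?m"
    define g' where "g' = g + tr x ?m"
    have x: "x \<noteq> ?m" using False by (simp add: x_def)
    have xN: "x \<in> {1..n}" using Sn_image[OF less.prems, of ?m] x by (auto simp: x_def)
    have gx: "ap g x \<noteq> x" using x unfolding x_def by simp
    have g'x: "ap g' x = x" by (simp add: g'_def ap_tr x_def)
    have "moved g' \<subseteq> moved g - {x}"
    proof
      fix y assume y: "y \<in> moved g'"
      have "y \<noteq> x" using y g'x by (auto simp: moved_iff)
      moreover have "y \<in> moved g"
      proof (cases "y = ?m")
        case True
        then show ?thesis using False by (simp add: moved_iff)
      next
        case False
        then show ?thesis using y \<open>y \<noteq> x\<close> by (simp add: moved_iff g'_def ap_tr)
      qed
      ultimately show "y \<in> moved g - {x}" by blast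
    qed
    then have "card (moved g') < card (moved g)"
      using gx finite_moved[of g] by (intro psubset_card_mono) (auto simp: moved_iff)
    moreover have "g' \<in> Sn ?m" using less.prems xN by (auto simp: g'_def intro!: tr_in_Sn)
    ultimately obtain h js where h: "good n h js" "g' = h + cyc js ?m" using less.hyps by blast
    have "x \<notin> moved h \<union> (if js = [] then {} else insert ?m (set js))"
      using moved_good[OF h(1)] g'x h(2) by (auto simp: moved_iff)
    then have "x \<notin> moved h" "x \<notin> set js" by (auto split: if_splits)
    then have "good n h (x # js)" using h xN by (auto simp: good_def)
    moreover have "g = h + cyc (x # js) ?m"
      by (simp flip: add.assoc h(2)) (simp add: g'_def add.assoc)
    ultimately show ?thesis by blast
  qed
qed

text \<open>For \<open>i\<close> in \<open>{1..n}\<close>, the exponent \<open>\<alpha> i\<close> is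
  one less than the length of the cycle of \<open>g\<close> with largest point \<open>i\<close>, and
  it is 0 if \<open>i\<close> is not the largest point of its cycle.\<close>

fun top_term :: "nat \<Rightarrow> (nat \<Rightarrow> nat) \<Rightarrow> sperm \<Rightarrow> bool" where
  "top_term 0 \<alpha> g \<longleftrightarrow> g = 0"
| "top_term (Suc n) \<alpha> g \<longleftrightarrow>
    (\<exists>h js. top_term n \<alpha> h \<and> good n h js \<and> length js = \<alpha> (Suc n) \<and> g = h + cyc js (Suc n))"

text \<open>An upper bound for the number of points moved by a permutation in the expansion of the
  monomial: a product of \<open>a > 0\<close> transpositions through \<open>i\<close> involves at
  most \<open>a + 1\<close> points.\<close>

definition top_size :: "nat \<Rightarrow> (nat \<Rightarrow> nat) \<Rightarrow> nat" where
  "top_size n \<alpha> = (\<Sum>i\<in>{1..n}. if \<alpha> i = 0 then 0 else Suc (\<alpha> i))"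

lemma top_size_Suc: "top_size (Suc n) \<alpha> = top_size n \<alpha> + (if \<alpha> (Suc n) = 0 then 0 else Suc (\<alpha> (Suc n)))"
  by (simp add: top_size_def)

lemma top_term_cong: "(\<And>i. i \<in> {1..n} \<Longrightarrow> \<alpha> i = \<beta> i) \<Longrightarrow> top_term n \<alpha> g = top_term n \<beta> g"
  by (induction n arbitrary: g) auto

lemma top_term_card: "top_term n \<alpha> g \<Longrightarrow> g \<in> Sn n \<and> card (moved g) = top_size n \<alpha>"
proof (induction n arbitrary: g)
  case 0
  then show ?case by (simp add: top_size_def moved_def)
next
  case (Suc n)
  then obtain h js where h: "top_term n \<alpha> h" "good n h js" "length js = \<alpha> (Suc n)" "g = h + cyc js (Suc n)"
    by auto
  have "moved g \<subseteq> {1..Suc n}"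
    using moved_good[OF h(2)] h(2,4) by (fastforce simp: good_def Sn_iff_moved split: if_splits)
  moreover have "card (moved g) = top_size (Suc n) \<alpha>"
    using good_card[OF h(2)] Suc.IH[OF h(1)] h(3)[symmetric] h(4) by (cases "js = []") (auto simp: top_size_Suc)
  ultimately show ?case by (simp add: Sn_iff_moved)
qed

lemma top_term_unique: "top_term n \<alpha> g \<Longrightarrow> top_term n \<beta> g \<Longrightarrow> i \<in> {1..n} \<Longrightarrow> \<alpha> i = \<beta> i"
proof (induction n arbitrary: g)
  case (Suc n)
  obtain h js where h: "top_term n \<alpha> h" "good n h js" "length js = \<alpha> (Suc n)" "g = h + cyc js (Suc n)"
    using Suc.prems(1) by auto
  obtain h' js' where h': "top_term n \<beta> h'" "good n h' js'" "length js' = \<beta> (Suc n)" "g = h' + cyc js' (Suc n)"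
    using Suc.prems(2) by auto
  have "js = js'" "h = h'" using good_unique[OF h(2) h'(2)] h(4) h'(4) by auto
  then show ?case using Suc.IH[of h] Suc.prems(3) h h' by (cases "i = Suc n") auto
qed simp

lemma top_term_exists: "g \<in> Sn n \<Longrightarrow> \<exists>\<alpha>. top_term n \<alpha> g"
proof (induction n arbitrary: g)
  case (Suc n)
  obtain h js where h: "good n h js" "g = h + cyc js (Suc n)" using good_exists[OF Suc.prems] by blast
  obtain \<alpha> where "top_term n \<alpha> h" using Suc.IH[of h] h(1) unfolding good_def by blast
  then have "top_term n (\<alpha>(Suc n := length js)) h"
    by (subst top_term_cong[of n _ \<alpha>]) auto
  then have "top_term (Suc n) (\<alpha>(Suc n := length js)) g"
    unfolding top_term.simps using h by (intro exI[of _ h] exI[of _ js] conjI) auto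
  then show ?case by blast
qed simp

text \<open>
  A permutation moving \<open>top_size n \<alpha>\<close> or more points is a product of transpositions from the
  monomial only if these use no point twice.
\<close>

lemma lk_JM_monomial:
  assumes "top_size n \<alpha> \<le> card (moved g)"
  shows "lk (JM_monomial \<alpha> n :: 'r::comm_ring_1 galg) g = (if top_term n \<alpha> g then 1 else 0)"
  using assms
proof (induction n arbitrary: g)
  case 0
  then show ?case by (simp add: lookup_one when_def)
next
  case (Suc n)
  let ?m = "Suc n" and ?a = "\<alpha> (Suc n)"
  let ?S = "{js. set js \<subseteq> {1..<?m} \<and> length js = ?a}"
  let ?h = "\<lambda>js. g - cyc js ?m"
  have gh: "g = ?h js + cyc js ?m" for js by simp
  have fin: "finite ?S" using finite_lists_length_eq[of "{1..<?m}" ?a] by simp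
  have key: "lk (JM_monomial \<alpha> n :: 'r galg) (?h js) = (if top_term n \<alpha> (?h js) \<and> good n (?h js) js then 1 else 0)"
    if js: "js \<in> ?S" for js
  proof -
    have len: "length js = ?a" and setjs: "set js \<subseteq> {1..n}" using js by auto
    show ?thesis
    proof (cases "js = []")
      case True
      then have "top_size n \<alpha> \<le> card (moved g)" using Suc.prems len by (simp add: top_size_Suc)
      from Suc.IH[OF this] show ?thesis using True top_term_card[of n \<alpha> g] by (auto simp: good_def)
    next
      case False
      have sub: "moved g \<subseteq> moved (?h js) \<union> insert ?m (set js)"
        using moved_add[of "?h js" "cyc js ?m"] moved_cyc[of js ?m] unfolding gh[symmetric] by blast
      have c1: "card (moved g) \<le> card (moved (?h js) \<union> insert ?m (set js))"
        using sub by (intro card_mono) (auto simp: finite_moved)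
      have c2: "card (insert ?m (set js)) \<le> Suc (card (set js))" by (rule card_insert_le_m1) auto
      have c3: "card (set js) \<le> ?a" using card_length[of js] len by simp
      \<comment> \<open>The word accounts for at most \<open>?a + 1\<close> moved points, so the
        cofactor \<open>?h js\<close> still moves enough of them for the induction
        hypothesis.\<close>
      have big: "top_size n \<alpha> + Suc ?a \<le> card (moved g)"
        using Suc.prems False len by (auto simp: top_size_Suc split: if_splits)
      have "top_size n \<alpha> \<le> card (moved (?h js))"
        using big c1 c2 c3 card_Un_le[of "moved (?h js)" "insert ?m (set js)"] by linarith
      from Suc.IH[OF this] have IH: "lk (JM_monomial \<alpha> n :: 'r galg) (?h js) = (if top_term n \<alpha> (?h js) then 1 else 0)" .
      \<comment> \<open>Now every one of these bounds is attained, so the word repeats no letter and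
        avoids the points moved by the cofactor.\<close>
      have "good n (?h js) js" if t: "top_term n \<alpha> (?h js)"
      proof -
        have h: "?h js \<in> Sn n" "card (moved (?h js)) = top_size n \<alpha>" using top_term_card[OF t] by auto
        have c4: "card (moved (?h js)) + card (insert ?m (set js)) \<ge> card (moved (?h js)) + Suc ?a"
          using big c1 card_Un_le[of "moved (?h js)" "insert ?m (set js)"] h(2) by linarith
        have "card (set js) = length js" using c2 c3 c4 len by linarith
        then have d: "distinct js" by (simp add: card_distinct)
        have "moved (?h js) \<inter> insert ?m (set js) = {}"
        proof (rule ccontr)
          assume "moved (?h js) \<inter> insert ?m (set js) \<noteq> {}"
          then have "card (moved (?h js) \<inter> insert ?m (set js)) > 0"
            by (simp add: card_gt_0_iff finite_moved)
          then have "card (moved (?h js) \<union> insert ?m (set js)) < card (moved (?h js)) + card (insert ?m (set js))"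
            using card_Un_Int[of "moved (?h js)" "insert ?m (set js)"] by (simp add: finite_moved)
          then show False using big c1 c2 c3 h(2) by linarith
        qed
        then show ?thesis using h(1) d setjs by (auto simp: good_def)
      qed
      then show ?thesis using IH by auto
    qed
  qed
  let ?G = "{js \<in> ?S. top_term n \<alpha> (?h js) \<and> good n (?h js) js}"
  have "lk (JM_monomial \<alpha> ?m :: 'r galg) g = (\<Sum>js\<in>?S. lk (JM_monomial \<alpha> n :: 'r galg) (?h js))"
    unfolding JM_monomial_Suc JM_power_expand by (simp add: sum_distrib_left lookup_sum)
  also have "\<dots> = (\<Sum>js\<in>?S. if top_term n \<alpha> (?h js) \<and> good n (?h js) js then 1 else 0)"
    by (rule sum.cong[OF refl key])
  also have "\<dots> = of_nat (card ?G)" using fin by (simp add: sum.If_cases Int_def)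
  also have "card ?G = (if top_term ?m \<alpha> g then 1 else 0)"
  proof (cases "top_term ?m \<alpha> g")
    case True
    then obtain h js where h: "top_term n \<alpha> h" "good n h js" "length js = ?a" "g = h + cyc js ?m" by auto
    have "?G = {js}"
    proof (intro equalityI subsetI)
      fix js' assume js': "js' \<in> ?G"
      then have "js' = js" using good_unique[of n "?h js'" js' h js] h by simp
      then show "js' \<in> {js}" by simp
    next
      fix js' assume "js' \<in> {js}"
      then show "js' \<in> ?G" using h by (auto simp: good_def)
    qed
    then show ?thesis using True by simp
  next
    case False
    then have "?G = {}" using gh by fastforce
    then show ?thesis using False by (simp only: card.empty if_False)
  qed
  finally show ?case by (simp del: top_term.simps)
qed

subsection \<open>Cycle words and conjugacy\<close>

definition cycle_words :: "nat list list \<Rightarrow> sperm \<Rightarrow> bool" where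
  "cycle_words ws g \<longleftrightarrow> distinct (concat ws) \<and>
    (\<forall>w\<in>set ws. \<forall>i<length w. ap g (w ! i) = w ! (Suc i mod length w)) \<and>
    (\<forall>x. x \<notin> set (concat ws) \<longrightarrow> ap g x = x)"

text \<open>Makes conjugacy visible in the exponents: each nonzero \<open>\<alpha> i\<close> comes
  from one cycle of length \<open>\<alpha> i + 1\<close>, so rearranging the exponents leaves the
  cycle type alone.\<close>

lemma top_term_cycle_words:
  "top_term n \<alpha> g \<Longrightarrow> \<exists>ws. cycle_words ws g \<and> set (concat ws) = moved g \<and>
    mset (map length ws) = image_mset Suc (filter_mset (\<lambda>a. a \<noteq> 0) (image_mset \<alpha> (mset_set {1..n})))"
proof (induction n arbitrary: g)
  case 0
  then show ?case by (intro exI[of _ "[]"]) (simp add: cycle_words_def moved_def)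
next
  case (Suc n)
  let ?m = "Suc n"
  obtain h js where h: "top_term n \<alpha> h" "good n h js" "length js = \<alpha> ?m" "g = h + cyc js ?m"
    using Suc.prems by auto
  obtain ws where ws: "cycle_words ws h" "set (concat ws) = moved h"
    "mset (map length ws) = image_mset Suc (filter_mset (\<lambda>a. a \<noteq> 0) (image_mset \<alpha> (mset_set {1..n})))"
    using Suc.IH[OF h(1)] by blast
  have m: "mset_set {Suc 0..?m} = add_mset ?m (mset_set {Suc 0..n})"
    by (simp add: atLeastAtMostSuc_conv)
  show ?case
  proof (cases "js = []")
    case True
    then show ?thesis using ws h by (intro exI[of _ ws]) (simp add: m)
  next
    case False
    have mj: "?m \<notin> set js" "?m \<notin> moved h" "distinct js" "set js \<inter> moved h = {}"
      using h(2) by (auto simp: good_def Sn_iff_moved)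
    have "cycle_words ((?m # js) # ws) g"
      unfolding cycle_words_def
    proof (intro conjI ballI allI impI)
      show "distinct (concat ((?m # js) # ws))"
        using ws(1,2) mj by (auto simp: cycle_words_def)
    next
      fix w i assume w: "w \<in> set ((?m # js) # ws)" "i < length w"
      show "ap g (w ! i) = w ! (Suc i mod length w)"
      proof (cases "w = ?m # js")
        case True
        have "ap (cyc js ?m) (w ! i) = w ! (Suc i mod length w)"
          using cyc_nth[OF mj(3,1), of i] True w by simp
        moreover have "w ! (Suc i mod length w) \<in> set w" by (intro nth_mem mod_less_divisor) (use w in auto)
        then have "w ! (Suc i mod length w) \<notin> moved h" using True mj by auto
        ultimately show ?thesis by (simp add: h(4) moved_iff)
      next
        case False
        then have "w \<in> set ws" using w by auto
        moreover have "w ! i \<in> set (concat ws)" using \<open>w \<in> set ws\<close> nth_mem[OF w(2)] by auto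
        then have "w ! i \<in> moved h" by (simp only: ws(2))
        then have "w ! i \<notin> set js" "w ! i \<noteq> ?m" using mj by auto
        then have "ap g (w ! i) = ap h (w ! i)" by (simp add: h(4) cyc_fixes)
        ultimately show ?thesis using ws(1) w(2) by (auto simp: cycle_words_def)
      qed
    next
      fix x assume "x \<notin> set (concat ((?m # js) # ws))"
      then have "x \<notin> set js" "x \<noteq> ?m" "x \<notin> moved h" using ws(2) by auto
      then show "ap g x = x" by (simp add: h(4) cyc_fixes moved_iff)
    qed
    moreover have "set (concat ((?m # js) # ws)) = moved g"
      using moved_good[OF h(2)] False ws(2) h(4) by auto
    moreover have "\<alpha> ?m \<noteq> 0" using False h(3) by (metis length_0_conv)
    then have "mset (map length ((?m # js) # ws)) =
      image_mset Suc (filter_mset (\<lambda>a. a \<noteq> 0) (image_mset \<alpha> (mset_set {1..?m})))"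
      using ws(3) h(3) by (simp add: m)
    ultimately show ?thesis by blast
  qed
qed

lemma permutes_extend:
  assumes "finite N" "A \<subseteq> N" "inj_on f A" "f ` A \<subseteq> N"
  shows "\<exists>p. p permutes N \<and> (\<forall>x\<in>A. p x = f x)"
proof -
  have "card (N - A) = card (N - f ` A)"
    using assms by (simp add: card_Diff_subset finite_subset card_image)
  then obtain e where e: "bij_betw e (N - A) (N - f ` A)"
    using assms(1) by (metis finite_Diff finite_same_card_bij)
  define p where "p = (\<lambda>x. if x \<in> A then f x else if x \<in> N then e x else x)"
  have "bij_betw p (A \<union> (N - A)) (f ` A \<union> (N - f ` A))"
  proof (rule bij_betw_combine)
    show "bij_betw p A (f ` A)"
      using inj_on_imp_bij_betw[OF assms(3)] by (rule bij_betw_cong[THEN iffD1, rotated]) (simp add: p_def)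
    show "bij_betw p (N - A) (N - f ` A)"
      using e by (rule bij_betw_cong[THEN iffD1, rotated]) (simp add: p_def)
  qed auto
  moreover have "A \<union> (N - A) = N" "f ` A \<union> (N - f ` A) = N" using assms by auto
  ultimately have "p permutes N" using assms(2) by (intro bij_imp_permutes) (auto simp: p_def)
  then show ?thesis by (intro exI[of _ p]) (simp add: p_def)
qed

lemma distinct_lists_permutes:
  assumes "finite N" "distinct xs" "distinct ys" "length xs = length ys" "set xs \<subseteq> N" "set ys \<subseteq> N"
  shows "\<exists>p. p permutes N \<and> map p xs = ys"
proof -
  define f where "f = (\<lambda>x. ys ! (THE i. i < length xs \<and> xs ! i = x))"
  have f: "f (xs ! i) = ys ! i" if "i < length xs" for i
  proof -
    have "(THE j. j < length xs \<and> xs ! j = xs ! i) = i"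
      using that assms(2) by (intro the_equality) (auto simp: nth_eq_iff_index_eq)
    then show ?thesis by (simp add: f_def)
  qed
  have "inj_on f (set xs)"
  proof (rule inj_onI)
    fix x y assume "x \<in> set xs" "y \<in> set xs" "f x = f y"
    then obtain i j where "i < length xs" "j < length xs" "x = xs ! i" "y = xs ! j" "ys ! i = ys ! j"
      by (metis f in_set_conv_nth)
    then show "x = y" using assms by (simp add: nth_eq_iff_index_eq)
  qed
  moreover have "f ` set xs \<subseteq> N"
  proof
    fix z assume "z \<in> f ` set xs"
    then obtain i where "i < length xs" "z = f (xs ! i)" by (auto simp: in_set_conv_nth)
    then show "z \<in> N" using f assms(4,6) by auto
  qed
  ultimately obtain p where p: "p permutes N" "\<forall>x\<in>set xs. p x = f x"
    using permutes_extend[OF assms(1,5)] by blast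
  have "map p xs = ys" using p(2) f assms(4) by (intro nth_equalityI) auto
  then show ?thesis using p(1) by blast
qed

text \<open>Any permutation that renames the cycles of \<open>g\<close> letter by letter into cycles
  of \<open>h\<close> of the same lengths conjugates \<open>g\<close> into \<open>h\<close>.\<close>

lemma cycle_words_conjugate:
  assumes ws: "cycle_words ws g" "set (concat ws) \<subseteq> {1..n}"
    and vs: "cycle_words vs h" "set (concat vs) \<subseteq> {1..n}"
    and len: "mset (map length ws) = mset (map length vs)"
  shows "\<exists>c\<in>Sn n. h = c + g - c"
proof -
  obtain p where p: "p permutes {..<length (map length vs)}" "permute_list p (map length vs) = map length ws"
    using mset_eq_permutation[OF len] by blast
  \<comment> \<open>The words of \<open>vs\<close>, reordered so that their lengths agree with those
    of \<open>ws\<close> position by position.\<close>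
  define us where "us = permute_list p vs"
  have p': "p permutes {..<length vs}" using p(1) by simp
  have us: "map length us = map length ws" "mset us = mset vs"
    using p permute_list_map[OF p', of length] p' by (simp_all add: us_def mset_permute_list)
  have "mset (concat us) = mset (concat vs)"
    using us(2) by (metis mset_concat mset_map sum_mset_sum_list)
  then have cu: "distinct (concat us)" "set (concat us) = set (concat vs)"
    using vs(1) mset_eq_imp_distinct_iff[of "concat us" "concat vs"] mset_eq_setD[of "concat us" "concat vs"]
    by (simp_all only: cycle_words_def)
  have su: "set us = set vs" using us(2) by (rule mset_eq_setD)
  have "length (concat ws) = length (concat us)" by (simp add: length_concat us(1))
  then obtain q where q: "q permutes {1..n}" "map q (concat ws) = concat us"
    using distinct_lists_permutes[of "{1..n}" "concat ws" "concat us"] ws vs cu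
    by (auto simp: cycle_words_def)
  then have "q \<in> ap ` Sn n" using bij_betw_imp_surj_on[OF bij_betw_ap_Sn[of n]] by simp
  then obtain c where c: "c \<in> Sn n" "q = ap c" by blast
  have lens: "length us = length ws" using us(1) by (metis length_map)
  have "concat (map (map q) ws) = concat us" using q(2) by (simp add: map_concat)
  then have "map (map q) ws = us"
  proof (rule concat_injective)
    show "length (map (map q) ws) = length us" using lens by simp
    show "\<forall>(x, y)\<in>set (zip (map (map q) ws) us). length x = length y"
      using us(1) lens by (auto simp: set_zip) (metis nth_map)
  qed
  then have mapw: "map q (ws ! k) \<in> set vs" if "k < length ws" for k
    using that su lens by (metis length_map nth_map nth_mem)
  have "ap h (ap c x) = ap c (ap g x)" for x
  proof (cases "x \<in> set (concat ws)")
    case True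
    then obtain w where w: "w \<in> set ws" "x \<in> set w" by auto
    then obtain k where k: "k < length ws" "x \<in> set (ws ! k)" using in_set_conv_nth[of w ws] by blast
    then obtain i where i: "i < length (ws ! k)" "x = ws ! k ! i" by (auto simp: in_set_conv_nth)
    let ?w = "ws ! k" and ?j = "Suc i mod length (ws ! k)"
    have j: "?j < length ?w" using i(1) by (intro mod_less_divisor) auto
    have "ap g x = ?w ! ?j" using ws(1) k(1) i by (auto simp: cycle_words_def)
    moreover have "ap h (map q ?w ! i) = map q ?w ! (Suc i mod length (map q ?w))"
      using vs(1) mapw[OF k(1)] i(1) unfolding cycle_words_def by (metis length_map)
    ultimately show ?thesis using i j c(2) by simp
  next
    case False
    have "ap c x \<notin> set (concat vs)"
    proof
      assume "ap c x \<in> set (concat vs)"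
      then have "q x \<in> q ` set (concat ws)" using cu(2) q(2) c(2) by (metis list.set_map)
      then show False using False c(2) by (auto simp del: set_concat)
    qed
    then show ?thesis using False ws(1) vs(1) unfolding cycle_words_def by metis
  qed
  then have "h + c = c + g" by (intro sperm_eqI) simp
  then have "h = c + g - c" by (metis add_diff_cancel)
  then show ?thesis using c(1) by blast
qed

lemma top_term_conjugate:
  assumes "top_term n \<alpha> g" "top_term n \<beta> h"
    and "image_mset \<alpha> (mset_set {1..n}) = image_mset \<beta> (mset_set {1..n})"
  shows "\<exists>c\<in>Sn n. h = c + g - c"
proof -
  have "moved g \<subseteq> {1..n}" "moved h \<subseteq> {1..n}"
    using top_term_card assms by (auto simp: Sn_iff_moved)
  then show ?thesis
    using top_term_cycle_words[OF assms(1)] top_term_cycle_words[OF assms(2)] assms(3)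
      cycle_words_conjugate[of _ g n _ h] by metis
qed

text \<open>\<open>Q\<close> is the orbit of the exponents of \<open>g0\<close>, so the sum is a
  monomial symmetric polynomial and central. Where at least as many points are moved as by
  \<open>g0\<close>, a coefficient counts the exponents in \<open>Q\<close> for which
  \<open>g\<close> is a top term: exactly one at \<open>g0\<close>, hence one on its class by
  centrality, and none elsewhere because exponents in one orbit give conjugate permutations.\<close>

lemma class_leading_term:
  assumes g0: "g0 \<in> Sn n"
  shows "\<exists>Q. finite Q \<and> (\<forall>\<alpha>\<in>Q. \<forall>\<sigma>. \<sigma> permutes {1..n} \<longrightarrow> \<alpha> \<circ> \<sigma> \<in> Q) \<and>
    (\<forall>g. card (moved g0) \<le> card (moved g) \<longrightarrow>
      lk (\<Sum>\<alpha>\<in>Q. JM_monomial \<alpha> n :: 'r::comm_ring_1 galg) g = (if \<exists>c\<in>Sn n. g = c + g0 - c then 1 else 0))"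
proof -
  obtain \<alpha>' where \<alpha>': "top_term n \<alpha>' g0" using top_term_exists[OF g0] by blast
  \<comment> \<open>Cutting off outside \<open>{1..n}\<close> makes exponents that agree on
    \<open>{1..n}\<close> equal as functions, so the set \<open>Q\<close> counts each of them
    once.\<close>
  define \<alpha> where "\<alpha> = (\<lambda>i. if i \<in> {1..n} then \<alpha>' i else 0)"
  have \<alpha>: "top_term n \<alpha> g0" using \<alpha>' by (subst top_term_cong[of n _ \<alpha>']) (auto simp: \<alpha>_def)
  define Q where "Q = (\<lambda>\<sigma>. \<alpha> \<circ> \<sigma>) ` {\<sigma>. \<sigma> permutes {1..n}}"
  define M where "M = (\<Sum>\<beta>\<in>Q. JM_monomial \<beta> n :: 'r galg)"
  have fin: "finite Q" by (simp add: Q_def finite_permutations)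
  have clos: "\<beta> \<circ> \<sigma> \<in> Q" if "\<beta> \<in> Q" "\<sigma> permutes {1..n}" for \<beta> \<sigma>
    using that permutes_compose by (force simp: Q_def comp_assoc)
  have cent: "central n M"
    unfolding M_def using fin
  proof (rule central_sum_monomials)
    fix \<beta> k assume *: "\<beta> \<in> Q" "1 \<le> k" "k < n"
    show "\<beta> \<circ> transpose k (Suc k) \<in> Q"
      by (rule clos[OF *(1)], rule permutes_swap_id) (use * in auto)
  qed
  have img: "image_mset \<beta> (mset_set {1..n}) = image_mset \<alpha> (mset_set {1..n})" if b: "\<beta> \<in> Q" for \<beta>
  proof -
    obtain \<sigma> where "\<sigma> permutes {1..n}" "\<beta> = \<alpha> \<circ> \<sigma>" using b unfolding Q_def by blast
    then show ?thesis using permutes_implies_image_mset_eq[of \<sigma> "{1..n}" \<beta> \<alpha>] by simp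
  qed
  have size: "top_size n \<beta> = card (moved g0)" if b: "\<beta> \<in> Q" for \<beta>
  proof -
    obtain \<sigma> where "\<sigma> permutes {1..n}" "\<beta> = \<alpha> \<circ> \<sigma>" using b unfolding Q_def by blast
    then have "top_size n \<beta> = top_size n \<alpha>"
      unfolding top_size_def by (subst sum.permute[of \<sigma>]) (auto simp: comp_def)
    then show ?thesis using top_term_card[OF \<alpha>] by simp
  qed
  have lkM: "lk M g = (\<Sum>\<beta>\<in>Q. if top_term n \<beta> g then 1 else 0)" if "card (moved g0) \<le> card (moved g)" for g
    unfolding M_def lookup_sum using that size by (intro sum.cong refl lk_JM_monomial) simp
  have M0: "lk M g0 = 1"
  proof -
    have "top_term n \<beta> g0 \<longleftrightarrow> \<beta> = \<alpha>" if b: "\<beta> \<in> Q" for \<beta>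
    proof
      assume t: "top_term n \<beta> g0"
      obtain \<sigma> where \<sigma>: "\<sigma> permutes {1..n}" "\<beta> = \<alpha> \<circ> \<sigma>" using b unfolding Q_def by blast
      have "\<beta> i = \<alpha> i" if "i \<notin> {1..n}" for i
        using permutes_not_in[OF \<sigma>(1) that] \<sigma>(2) by simp
      then show "\<beta> = \<alpha>" using top_term_unique[OF t \<alpha>] by blast
    qed (use \<alpha> in simp)
    then have "lk M g0 = (\<Sum>\<beta>\<in>Q. if \<beta> = \<alpha> then 1 else 0)" unfolding lkM[OF order_refl] by (intro sum.cong) auto
    moreover have "\<alpha> \<in> Q" unfolding Q_def by (intro image_eqI[of _ _ id]) auto
    ultimately show ?thesis using fin by simp
  qed
  have "lk M g = (if \<exists>c\<in>Sn n. g = c + g0 - c then 1 else 0)" if g: "card (moved g0) \<le> card (moved g)" for g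
  proof (cases "\<exists>c\<in>Sn n. g = c + g0 - c")
    case True
    then show ?thesis using cent M0 by (auto simp: central_iff_class_function)
  next
    case False
    have "\<not> top_term n \<beta> g" if "\<beta> \<in> Q" for \<beta>
      using top_term_conjugate[OF \<alpha>] img[OF that] False by metis
    then show ?thesis unfolding lkM[OF g] using False by simp
  qed
  then show ?thesis using fin clos unfolding M_def by blast
qed

section \<open>Contents, beta sets and cores\<close>

definition box_content :: "nat \<times> nat \<Rightarrow> int" where
  "box_content x = int (snd x) - int (fst x)"

text \<open>Bead positions on an abacus with a bead for every row, empty rows included; no number of
  parts has to be fixed. The shift by 1 makes the beads of the empty partition exactly the negative
  integers.\<close>

definition beta :: "(nat \<Rightarrow> nat) \<Rightarrow> nat \<Rightarrow> int" where
  "beta \<mu> i = int (\<mu> i) - int i - 1"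

definition diag_count :: "(nat \<Rightarrow> nat) \<Rightarrow> int \<Rightarrow> nat" where
  "diag_count \<mu> c = card {x \<in> diagram \<mu>. box_content x = c}"

definition residue_count :: "nat \<Rightarrow> (nat \<Rightarrow> nat) \<Rightarrow> int \<Rightarrow> nat" where
  "residue_count p \<mu> r = card {x \<in> diagram \<mu>. int p dvd box_content x - r}"

lemma partition_antimono: "is_partition \<mu> \<Longrightarrow> i \<le> j \<Longrightarrow> \<mu> j \<le> \<mu> i"
  by (simp add: is_partition_def antimonoD)

lemma diagram_Sigma: "diagram \<mu> = Sigma {i. \<mu> i \<noteq> 0} (\<lambda>i. {..<\<mu> i})"
  by (auto simp: diagram_def)

lemma finite_diagram: "is_partition \<mu> \<Longrightarrow> finite (diagram \<mu>)"
  unfolding diagram_Sigma is_partition_def by (intro finite_SigmaI) auto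

lemma card_diagram: "is_partition \<mu> \<Longrightarrow> card (diagram \<mu>) = part_size \<mu>"
  unfolding diagram_Sigma is_partition_def part_size_def by (subst card_SigmaI) auto

lemma diagram_inject: "diagram \<mu> = diagram \<nu> \<Longrightarrow> \<mu> = \<nu>"
proof
  fix i assume "diagram \<mu> = diagram \<nu>"
  then have "j < \<mu> i \<longleftrightarrow> j < \<nu> i" for j by (auto simp: diagram_def)
  then show "\<mu> i = \<nu> i" by (metis linorder_neqE_nat less_irrefl)
qed

lemma diagram_down:
  "is_partition \<mu> \<Longrightarrow> (i, j) \<in> diagram \<mu> \<Longrightarrow> i' \<le> i \<Longrightarrow> j' \<le> j \<Longrightarrow> (i', j') \<in> diagram \<mu>"
  using partition_antimono[of \<mu> i' i] by (auto simp: diagram_def)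

lemma beta_less: "is_partition \<mu> \<Longrightarrow> i < j \<Longrightarrow> beta \<mu> j < beta \<mu> i"
  using partition_antimono[of \<mu> i j] by (simp add: beta_def)

lemma beta_inj: "is_partition \<mu> \<Longrightarrow> inj (beta \<mu>)"
  by (rule injI) (metis beta_less less_irrefl linorder_neqE_nat)

lemma beta_upper_initial:
  assumes "is_partition \<mu>"
  shows "{i. c \<le> beta \<mu> i} = {..<card {i. c \<le> beta \<mu> i}}" "finite {i. c \<le> beta \<mu> i}"
proof -
  have "{i. c \<le> beta \<mu> i} \<subseteq> {..nat (int (\<mu> 0) - c)}"
  proof
    fix i assume "i \<in> {i. c \<le> beta \<mu> i}"
    moreover have "\<mu> i \<le> \<mu> 0" using partition_antimono[OF assms, of 0 i] by simp
    ultimately show "i \<in> {..nat (int (\<mu> 0) - c)}" by (simp add: beta_def)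
  qed
  then show fin: "finite {i. c \<le> beta \<mu> i}" by (rule finite_subset) simp
  show "{i. c \<le> beta \<mu> i} = {..<card {i. c \<le> beta \<mu> i}}"
  proof (rule initial_segment_card[OF fin])
    fix a b assume "a \<in> {i. c \<le> beta \<mu> i}" "b \<le> a"
    then show "b \<in> {i. c \<le> beta \<mu> i}" using beta_less[OF assms, of b a] by (cases "b = a") auto
  qed
qed

text \<open>Row \<open>i\<close> has a box of content \<open>c\<close> exactly if
  \<open>c \<le> beta \<mu> i\<close> and the column \<open>c + i\<close> is not negative. The
  second condition excludes the first \<open>nat (- c)\<close> rows, which all satisfy the
  first.\<close>

lemma diag_count_upper:
  assumes "is_partition \<mu>"
  shows "card {i. c \<le> beta \<mu> i} = diag_count \<mu> c + nat (- c)"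
proof -
  let ?D = "{i. c \<le> beta \<mu> i}"
  have sub: "{..<nat (- c)} \<subseteq> ?D" by (auto simp: beta_def)
  have "{x \<in> diagram \<mu>. box_content x = c} = (\<lambda>i. (i, nat (c + int i))) ` (?D - {..<nat (- c)})"
  proof (intro equalityI subsetI)
    fix x assume x: "x \<in> {x \<in> diagram \<mu>. box_content x = c}"
    obtain i j where ij: "x = (i, j)" by fastforce
    then have "j < \<mu> i" "c = int j - int i" using x by (auto simp: diagram_def box_content_def)
    then have "i \<in> ?D - {..<nat (- c)}" "x = (i, nat (c + int i))" by (auto simp: beta_def ij)
    then show "x \<in> (\<lambda>i. (i, nat (c + int i))) ` (?D - {..<nat (- c)})" by blast
  qed (auto simp: diagram_def box_content_def beta_def)
  moreover have "inj_on (\<lambda>i. (i, nat (c + int i))) (?D - {..<nat (- c)})" by (auto simp: inj_on_def)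
  ultimately have "diag_count \<mu> c = card (?D - {..<nat (- c)})"
    by (simp add: diag_count_def card_image)
  also have "\<dots> = card ?D - nat (- c)" using sub by (simp add: card_Diff_subset)
  finally show ?thesis using card_mono[OF beta_upper_initial(2)[OF assms, of c] sub] by simp
qed

text \<open>Passing from \<open>c\<close> to \<open>c + 1\<close> loses the bead at
  \<open>c\<close>, if there is one; the correction for \<open>c < 0\<close> accounts for the beads
  of the empty partition.\<close>

lemma diag_count_diff:
  assumes "is_partition \<mu>"
  shows "int (diag_count \<mu> c) - int (diag_count \<mu> (c + 1)) =
    (if c \<in> range (beta \<mu>) then 1 else 0) - (if c < 0 then 1 else 0)"
proof -
  have "card {i. c \<le> beta \<mu> i} = card {i. c + 1 \<le> beta \<mu> i} + (if c \<in> range (beta \<mu>) then 1 else 0)"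
  proof (cases "c \<in> range (beta \<mu>)")
    case True
    then obtain i where i: "beta \<mu> i = c" by auto
    have "c \<le> beta \<mu> j \<longleftrightarrow> j = i \<or> c + 1 \<le> beta \<mu> j" for j
      using i injD[OF beta_inj[OF assms], of j i] by (cases "beta \<mu> j = c") auto
    then have "{i. c \<le> beta \<mu> i} = insert i {i. c + 1 \<le> beta \<mu> i}" by auto
    moreover have "i \<notin> {i. c + 1 \<le> beta \<mu> i}" using i by simp
    ultimately show ?thesis using beta_upper_initial(2)[OF assms, of "c + 1"] True by simp
  next
    case False
    then have "c \<noteq> beta \<mu> i" for i by blast
    then have "c \<le> beta \<mu> i \<longleftrightarrow> c + 1 \<le> beta \<mu> i" for i using order_le_less[of c "beta \<mu> i"] by auto
    then have "{i. c \<le> beta \<mu> i} = {i. c + 1 \<le> beta \<mu> i}" by auto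
    then show ?thesis using False by simp
  qed
  then show ?thesis using diag_count_upper[OF assms, of c] diag_count_upper[OF assms, of "c + 1"]
    by (auto split: if_splits)
qed

text \<open>The boxes of one diagonal occupy consecutive rows starting at the edge of the quadrant,
  so their number decides which of them are present.\<close>

lemma diag_count_inject:
  assumes "is_partition \<mu>" "is_partition \<nu>" "\<And>c. diag_count \<mu> c = diag_count \<nu> c"
  shows "\<mu> = \<nu>"
proof (rule diagram_inject)
  have *: "(i, j) \<in> diagram \<kappa> \<longleftrightarrow> i < diag_count \<kappa> (int j - int i) + nat (int i - int j)"
    if "is_partition \<kappa>" for \<kappa> i j
  proof -
    have "(i, j) \<in> diagram \<kappa> \<longleftrightarrow> i \<in> {k. int j - int i \<le> beta \<kappa> k}"
      by (auto simp: diagram_def beta_def)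
    also have "\<dots> \<longleftrightarrow> i < card {k. int j - int i \<le> beta \<kappa> k}"
      by (subst beta_upper_initial(1)[OF that]) simp
    finally show ?thesis using diag_count_upper[OF that, of "int j - int i"] by simp
  qed
  show "diagram \<mu> = diagram \<nu>"
    using *[OF assms(1)] *[OF assms(2)] assms(3) by auto
qed

lemma range_beta_inject:
  assumes "is_partition \<mu>" "is_partition \<nu>" "range (beta \<mu>) = range (beta \<nu>)"
  shows "\<mu> = \<nu>"
proof (rule diag_count_inject[OF assms(1,2)])
  fix c
  have "card {i. c \<le> beta \<kappa> i} = card (range (beta \<kappa>) \<inter> {c..})" if "is_partition \<kappa>" for \<kappa>
  proof -
    have "beta \<kappa> ` {i. c \<le> beta \<kappa> i} = range (beta \<kappa>) \<inter> {c..}" by auto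
    then show ?thesis using card_image[OF inj_on_subset[OF beta_inj[OF that]]] by (metis subset_UNIV)
  qed
  then show "diag_count \<mu> c = diag_count \<nu> c"
    using diag_count_upper[OF assms(1), of c] diag_count_upper[OF assms(2), of c] assms by simp
qed

lemma residue_count_sum:
  assumes "is_partition \<mu>" "finite J" "\<And>c. diag_count \<mu> c \<noteq> 0 \<Longrightarrow> c \<in> J"
  shows "residue_count p \<mu> r = (\<Sum>c | c \<in> J \<and> int p dvd c - r. diag_count \<mu> c)"
proof -
  have "box_content x \<in> J" if x: "x \<in> diagram \<mu>" for x
  proof (rule assms(3))
    have "x \<in> {y \<in> diagram \<mu>. box_content y = box_content x}" using x by simp
    then show "diag_count \<mu> (box_content x) \<noteq> 0"
      unfolding diag_count_def using finite_diagram[OF assms(1)] by (subst card_0_eq) (simp, blast)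
  qed
  then have "{x \<in> diagram \<mu>. int p dvd box_content x - r} =
      (\<Union>c\<in>{c \<in> J. int p dvd c - r}. {x \<in> diagram \<mu>. box_content x = c})" by auto
  moreover have "card \<dots> = (\<Sum>c\<in>{c \<in> J. int p dvd c - r}. card {x \<in> diagram \<mu>. box_content x = c})"
    using finite_diagram[OF assms(1)] assms(2) by (intro card_UN_disjoint) auto
  ultimately show ?thesis by (simp add: residue_count_def diag_count_def)
qed

lemma diag_count_bounded:
  assumes "is_partition \<mu>"
  shows "\<exists>M. \<forall>c. M \<le> \<bar>c\<bar> \<longrightarrow> diag_count \<mu> c = 0"
proof -
  let ?C = "box_content ` diagram \<mu>"
  have fin: "finite ?C" using finite_diagram[OF assms] by simp
  define M where "M = Max (insert 0 (abs ` ?C)) + 1"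
  have "diag_count \<mu> c = 0" if "M \<le> \<bar>c\<bar>" for c
  proof -
    have "c \<notin> ?C"
    proof
      assume "c \<in> ?C"
      then have "\<bar>c\<bar> \<le> Max (insert 0 (abs ` ?C))" using fin by (intro Max_ge) auto
      then show False using that by (simp add: M_def)
    qed
    then have e: "{x \<in> diagram \<mu>. box_content x = c} = {}" by blast
    show ?thesis unfolding diag_count_def e by simp
  qed
  then show ?thesis by blast
qed

lemma lower_sets_eq:
  fixes I :: "int set"
  assumes "finite I" "A \<subseteq> I" "B \<subseteq> I" "card A = card B"
    and A: "\<And>x y. x \<in> A \<Longrightarrow> y \<in> I \<Longrightarrow> y \<le> x \<Longrightarrow> y \<in> A"
    and B: "\<And>x y. x \<in> B \<Longrightarrow> y \<in> I \<Longrightarrow> y \<le> x \<Longrightarrow> y \<in> B"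
  shows "A = B"
proof -
  have "A \<subseteq> B \<or> B \<subseteq> A" using assms(2,3) A B by (meson linorder_linear subset_iff)
  then show ?thesis using assms by (metis card_subset_eq finite_subset)
qed

text \<open>
  On each runner of the abacus the beads of a core form a lower set, and the number of beads on it
  is read off from the differences of consecutive residue counts.
\<close>

lemma cores_eq:
  assumes \<mu>: "is_partition \<mu>" and \<nu>: "is_partition \<nu>" and p: "p > 0"
    and cm: "\<And>b. b \<in> range (beta \<mu>) \<Longrightarrow> b - int p \<in> range (beta \<mu>)"
    and cn: "\<And>b. b \<in> range (beta \<nu>) \<Longrightarrow> b - int p \<in> range (beta \<nu>)"
    and res: "\<And>r. int (residue_count p \<mu> r) - int (residue_count p \<nu> r) = k"
  shows "\<mu> = \<nu>"
proof (rule range_beta_inject[OF \<mu> \<nu>])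
  obtain M1 M2 where M12: "\<And>c. M1 \<le> \<bar>c\<bar> \<Longrightarrow> diag_count \<mu> c = 0" "\<And>c. M2 \<le> \<bar>c\<bar> \<Longrightarrow> diag_count \<nu> c = 0"
    using diag_count_bounded[OF \<mu>] diag_count_bounded[OF \<nu>] by blast
  define M where "M = max 1 (max M1 M2)"
  have M: "diag_count \<mu> c = 0" "diag_count \<nu> c = 0" if "M \<le> \<bar>c\<bar>" for c
    using M12[of c] that by (auto simp: M_def)
  \<comment> \<open>The positions of runner \<open>r\<close> inside a window that contains all
    contents of both partitions.\<close>
  define I where "I = (\<lambda>r. {c. c \<in> {- M..M} \<and> int p dvd c - r})"
  have diff: "int (residue_count p \<kappa> r) - int (residue_count p \<kappa> (r + 1)) =
      int (card (range (beta \<kappa>) \<inter> I r)) - (\<Sum>c\<in>I r. if c < 0 then 1 else 0)"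
    if \<kappa>: "is_partition \<kappa>" and z: "\<And>c. M \<le> \<bar>c\<bar> \<Longrightarrow> diag_count \<kappa> c = 0" for \<kappa> r
  proof -
    \<comment> \<open>The window moved up by one still contains all contents, so that the residue
      count for \<open>r + 1\<close> can be summed over \<open>I r\<close> as well.\<close>
    have supp: "c \<in> {- M..M}" "c \<in> {- M + 1..M + 1}" if "diag_count \<kappa> c \<noteq> 0" for c
    proof -
      have "\<not> M \<le> \<bar>c\<bar>" using z[of c] that by blast
      then show "c \<in> {- M..M}" "c \<in> {- M + 1..M + 1}" by (simp_all add: not_le abs_less_iff)
    qed
    have "residue_count p \<kappa> (r + 1) = (\<Sum>c | c \<in> {- M + 1..M + 1} \<and> int p dvd c - (r + 1). diag_count \<kappa> c)"
      by (rule residue_count_sum[OF \<kappa>]) (use supp in auto)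
    also have "\<dots> = (\<Sum>c\<in>I r. diag_count \<kappa> (c + 1))"
      by (rule sum.reindex_bij_witness[of _ "\<lambda>c. c + 1" "\<lambda>c. c - 1"]) (auto simp: I_def algebra_simps)
    finally have 1: "residue_count p \<kappa> (r + 1) = (\<Sum>c\<in>I r. diag_count \<kappa> (c + 1))" .
    have 2: "residue_count p \<kappa> r = (\<Sum>c\<in>I r. diag_count \<kappa> c)"
      unfolding I_def by (rule residue_count_sum[OF \<kappa>]) (use supp in auto)
    have fin: "finite (I r)" by (rule finite_subset[of _ "{- M..M}"]) (auto simp: I_def)
    have "int (residue_count p \<kappa> r) - int (residue_count p \<kappa> (r + 1)) =
        (\<Sum>c\<in>I r. int (diag_count \<kappa> c) - int (diag_count \<kappa> (c + 1)))"
      by (simp add: 1 2 sum_subtractf)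
    also have "\<dots> = (\<Sum>c\<in>I r. if c \<in> range (beta \<kappa>) then 1 else 0) - (\<Sum>c\<in>I r. if c < 0 then 1 else 0)"
      unfolding diag_count_diff[OF \<kappa>] by (rule sum_subtractf)
    also have "(\<Sum>c\<in>I r. if c \<in> range (beta \<kappa>) then 1 else 0) = int (card (range (beta \<kappa>) \<inter> I r))"
      using fin by (simp add: sum.If_cases Int_commute)
    finally show ?thesis .
  qed
  have runner: "range (beta \<mu>) \<inter> I r = range (beta \<nu>) \<inter> I r" for r
  proof (rule lower_sets_eq)
    show "finite (I r)" by (rule finite_subset[of _ "{- M..M}"]) (auto simp: I_def)
    \<comment> \<open>The constant \<open>k\<close> drops out of the difference of consecutive
      residue counts, so both runners carry equally many beads.\<close>
    show "card (range (beta \<mu>) \<inter> I r) = card (range (beta \<nu>) \<inter> I r)"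
      using diff[OF \<mu> M(1), of r] diff[OF \<nu> M(2), of r] res[of r] res[of "r + 1"] by simp
    have low: "y \<in> B \<inter> I r"
      if B: "\<And>b. b \<in> B \<Longrightarrow> b - int p \<in> B" and x: "x \<in> B \<inter> I r" and y: "y \<in> I r" "y \<le> x" for B x y
    proof -
      have "int p dvd (x - r) - (y - r)" using x y by (intro dvd_diff[of "int p" "x - r" "y - r"]) (simp_all add: I_def)
      then obtain q where q: "x - y = int p * q" by (auto simp: dvd_def)
      have "q \<ge> 0" using q y(2) p by (metis diff_ge_0_iff_ge of_nat_0_less_iff zero_le_mult_iff not_less)
      then obtain m where m: "q = int m" using nonneg_int_cases by blast
      have "x - int p * int k \<in> B" for k
      proof (induction k)
        case (Suc k)
        then show ?case using B[of "x - int p * int k"] by (simp add: algebra_simps)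
      qed (use x in simp)
      from this[of m] show ?thesis using q m y by (simp add: algebra_simps)
    qed
    show "y \<in> range (beta \<mu>) \<inter> I r" if "x \<in> range (beta \<mu>) \<inter> I r" "y \<in> I r" "y \<le> x" for x y
      using low[OF cm that] by simp
    show "y \<in> range (beta \<nu>) \<inter> I r" if "x \<in> range (beta \<nu>) \<inter> I r" "y \<in> I r" "y \<le> x" for x y
      using low[OF cn that] by simp
  qed auto
  show "range (beta \<mu>) = range (beta \<nu>)"
  proof (rule Set.set_eqI)
    fix c
    show "c \<in> range (beta \<mu>) \<longleftrightarrow> c \<in> range (beta \<nu>)"
    proof (cases "c \<in> {- M..M}")
      case True
      then have "c \<in> I c" by (simp add: I_def)
      then show ?thesis using runner[of c] by blast
    next
      case False
      \<comment> \<open>The diagonals \<open>c\<close> and \<open>c + 1\<close> are empty for both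
        partitions, so by \<open>diag_count_diff\<close> a bead at \<open>c\<close> is present
        exactly if \<open>c < 0\<close>.\<close>
      then have "M \<le> \<bar>c\<bar>" "M \<le> \<bar>c + 1\<bar>" by auto
      then show ?thesis using diag_count_diff[OF \<mu>, of c] diag_count_diff[OF \<nu>, of c] M
        by (auto split: if_splits)
    qed
  qed
qed

subsection \<open>Removing hooks\<close>

text \<open>Of two boxes on one diagonal, the lower one forces the diagonal neighbour of the upper
  one into the diagram, so the upper one is not in the rim.\<close>

lemma box_content_inj_on_rim:
  assumes "is_partition \<mu>" shows "inj_on box_content (rim \<mu>)"
proof -
  have *: "False" if "x \<in> rim \<mu>" "y \<in> rim \<mu>" "box_content x = box_content y" "fst x < fst y" for x y
  proof -
    obtain i j i' j' where xy: "x = (i, j)" "y = (i', j')" by fastforce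
    then have "Suc i \<le> i'" "Suc j \<le> j'" using that by (auto simp: box_content_def)
    then have "(Suc i, Suc j) \<in> diagram \<mu>"
      using diagram_down[OF assms, of i' j'] that(2) xy by (auto simp: rim_def)
    then show False using that(1) xy by (auto simp: rim_def)
  qed
  show ?thesis
  proof (rule inj_onI)
    fix x y assume xy: "x \<in> rim \<mu>" "y \<in> rim \<mu>" "box_content x = box_content y"
    then have "fst x = fst y" using *[of x y] *[of y x] by (metis linorder_neqE_nat)
    then show "x = y" using xy(3) by (auto simp: box_content_def prod_eq_iff)
  qed
qed

text \<open>A discrete intermediate value argument: along a step over an edge the content changes by
  one.\<close>

lemma edge_connected_content:
  assumes "edge_connected H" "x \<in> H" "y \<in> H" "box_content x \<le> c" "c \<le> box_content y"
  shows "c \<in> box_content ` H"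
proof -
  have "(\<lambda>u v. u \<in> H \<and> v \<in> H \<and> share_edge u v)\<^sup>*\<^sup>* x y" using assms by (auto simp: edge_connected_def)
  then show ?thesis using assms(5)
  proof (induction rule: rtranclp_induct)
    case base
    then have "c = box_content x" using assms(4) by simp
    then show ?case using assms(2) by blast
  next
    case (step y z)
    have "box_content z \<le> box_content y + 1" using step(2) by (auto simp: share_edge_def box_content_def)
    show ?case
    proof (cases "c \<le> box_content y")
      case False
      then have "c = box_content z" using step.prems \<open>box_content z \<le> box_content y + 1\<close> by simp
      then show ?thesis using step(2) by blast
    qed (rule step.IH)
  qed
qed

lemma one_in_each_residue:
  assumes "p > 0" shows "card {c \<in> {a..<a + int p}. int p dvd c - r} = 1"
proof -
  have "{c \<in> {a..<a + int p}. int p dvd c - r} = {a + (r - a) mod int p}"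
  proof (intro equalityI subsetI)
    fix c assume c: "c \<in> {c \<in> {a..<a + int p}. int p dvd c - r}"
    then have "int p dvd (c - a) - (r - a)" by simp
    then have "(c - a) mod int p = (r - a) mod int p" by (simp only: mod_eq_dvd_iff)
    moreover have "(c - a) mod int p = c - a" using c by (intro mod_pos_pos_trivial) auto
    ultimately have "c = a + (r - a) mod int p" by linarith
    then show "c \<in> {a + (r - a) mod int p}" by simp
  next
    fix c assume "c \<in> {a + (r - a) mod int p}"
    then have c: "c = a + (r - a) mod int p" by simp
    have "int p dvd (r - a) mod int p - (r - a)" by (metis dvd_minus_mod dvd_diff_commute)
    then show "c \<in> {c \<in> {a..<a + int p}. int p dvd c - r}"
      using assms by (simp add: c algebra_simps)
  qed
  then show ?thesis by simp
qed

text \<open>Contents are distinct on the rim and have no gaps on a connected set, so a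
  \<open>p\<close>-hook has \<open>p\<close> consecutive contents, one in each residue
  class.\<close>

lemma removes_hook_counts:
  assumes \<mu>: "is_partition \<mu>" and p: "p > 0" and rem: "removes_hook p \<mu> \<nu>"
  shows "is_partition \<nu> \<and> part_size \<mu> = part_size \<nu> + p \<and>
    (\<forall>r. residue_count p \<mu> r = residue_count p \<nu> r + 1)"
proof -
  obtain H where H: "is_partition \<nu>" "is_hook p \<mu> H" "diagram \<nu> = diagram \<mu> - H"
    using rem by (auto simp: removes_hook_def)
  have Hr: "H \<subseteq> rim \<mu>" "card H = p" "edge_connected H" using H(2) by (auto simp: is_hook_def)
  have Hd: "H \<subseteq> diagram \<mu>" using Hr(1) by (auto simp: rim_def)
  have fin: "finite H" "finite (diagram \<mu>)" using Hd finite_diagram[OF \<mu>] finite_subset by auto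
  have "part_size \<mu> = part_size \<nu> + p"
    using card_Diff_subset[OF fin(1) Hd] card_mono[OF fin(2) Hd] Hr(2)
    by (simp add: card_diagram[OF \<mu>] flip: card_diagram[OF H(1)] H(3))
  moreover have "residue_count p \<mu> r = residue_count p \<nu> r + 1" for r
  proof -
    have inj: "inj_on box_content H" using box_content_inj_on_rim[OF \<mu>] Hr(1) by (rule inj_on_subset)
    have ne: "H \<noteq> {}" using Hr(2) p by auto
    define a where "a = Min (box_content ` H)"
    define b where "b = Max (box_content ` H)"
    have ab: "a \<in> box_content ` H" "b \<in> box_content ` H"
      using fin ne by (auto simp: a_def b_def intro!: Min_in Max_in)
    have img: "box_content ` H = {a..b}"
    proof (intro equalityI subsetI)
      fix c assume "c \<in> {a..b}"
      then show "c \<in> box_content ` H" using ab edge_connected_content[OF Hr(3)] by auto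
    qed (use fin in \<open>auto simp: a_def b_def\<close>)
    then have "card {a..b} = p" using card_image[OF inj] Hr(2) by simp
    then have img': "box_content ` H = {a..<a + int p}" using img p by auto
    have "card {x \<in> H. int p dvd box_content x - r} = card (box_content ` {x \<in> H. int p dvd box_content x - r})"
      by (rule card_image[symmetric], rule inj_on_subset[OF inj]) auto
    also have "box_content ` {x \<in> H. int p dvd box_content x - r} = {c \<in> {a..<a + int p}. int p dvd c - r}"
      unfolding img'[symmetric] by auto
    finally have 1: "card {x \<in> H. int p dvd box_content x - r} = 1" using one_in_each_residue[OF p] by simp
    have "{x \<in> diagram \<mu>. int p dvd box_content x - r} =
      {x \<in> diagram \<nu>. int p dvd box_content x - r} \<union> {x \<in> H. int p dvd box_content x - r}"
      using H(3) Hd by auto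
    also have "card \<dots> = residue_count p \<nu> r + card {x \<in> H. int p dvd box_content x - r}"
      unfolding residue_count_def using fin H(3) by (intro card_Un_disjoint) auto
    finally show ?thesis using 1 by (simp add: residue_count_def)
  qed
  ultimately show ?thesis using H(1) by blast
qed

lemma removes_hooks_counts:
  assumes "(removes_hook p)\<^sup>*\<^sup>* \<mu> \<nu>" "is_partition \<mu>" "p > 0"
  shows "is_partition \<nu> \<and> (\<exists>w. part_size \<mu> = part_size \<nu> + p * w \<and>
    (\<forall>r. residue_count p \<mu> r = residue_count p \<nu> r + w))"
  using assms(1)
proof (induction rule: rtranclp_induct)
  case base
  then show ?case using assms(2) by (auto intro!: exI[of _ 0])
next
  case (step y z)
  then obtain w where w: "is_partition y" "part_size \<mu> = part_size y + p * w"
    "\<forall>r. residue_count p \<mu> r = residue_count p y r + w" by auto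
  then show ?case using removes_hook_counts[OF w(1) assms(3) step(2)]
    by (intro conjI exI[of _ "Suc w"]) auto
qed

lemma row_connected:
  assumes "\<And>y. x \<le> y \<Longrightarrow> y \<le> z \<Longrightarrow> (j, y) \<in> H" "x \<le> z"
  shows "(\<lambda>u v. u \<in> H \<and> v \<in> H \<and> share_edge u v)\<^sup>*\<^sup>* (j, x) (j, z)"
  using assms(2,1)
proof (induction rule: dec_induct)
  case (step y)
  then have "(\<lambda>u v. u \<in> H \<and> v \<in> H \<and> share_edge u v)\<^sup>*\<^sup>* (j, x) (j, y)" by auto
  moreover have "(j, y) \<in> H \<and> (j, Suc y) \<in> H \<and> share_edge (j, y) (j, Suc y)"
    using step by (auto simp: share_edge_def)
  ultimately show ?case by (rule rtranclp.rtrancl_into_rtrancl)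
qed simp

text \<open>Moving a bead from \<open>b\<close> to the free position \<open>b - p\<close> removes a rim hook of \<open>p\<close> boxes.\<close>

lemma hook_exists:
  assumes \<mu>: "is_partition \<mu>" and p: "p > 0" and free: "beta \<mu> i - int p \<notin> range (beta \<mu>)"
  shows "\<exists>H. is_hook p \<mu> H"
proof -
  define b where "b = beta \<mu> i - int p"
  \<comment> \<open>The last row whose bead lies strictly above the target \<open>b\<close>.\<close>
  define k where "k = card {j. b + 1 \<le> beta \<mu> j} - 1"
  have up: "b + 1 \<le> beta \<mu> j \<longleftrightarrow> j \<le> k" for j
  proof -
    have "i \<in> {j. b + 1 \<le> beta \<mu> j}" using p by (simp add: b_def)
    then have "card {j. b + 1 \<le> beta \<mu> j} > 0"
      using beta_upper_initial(2)[OF \<mu>] by (auto simp: card_gt_0_iff)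
    moreover have "j \<in> {j. b + 1 \<le> beta \<mu> j} \<longleftrightarrow> j < card {j. b + 1 \<le> beta \<mu> j}"
      by (subst beta_upper_initial(1)[OF \<mu>]) simp
    ultimately show ?thesis unfolding k_def mem_Collect_eq by linarith
  qed
  have ik: "i \<le> k" using up[of i] p by (simp add: b_def)
  have bk: "b < beta \<mu> k" using up[of k] by simp
  have "beta \<mu> (Suc k) \<noteq> b" using free unfolding b_def by (metis rangeI)
  then have bSk: "beta \<mu> (Suc k) < b" using up[of "Suc k"] by simp
  \<comment> \<open>The row length that puts the bead of row \<open>k\<close> at position
    \<open>b\<close>.\<close>
  define q where "q = nat (b + int k + 1)"
  have q: "\<mu> (Suc k) \<le> q" "q < \<mu> k" "int q = int (\<mu> i) + int k - int i - int p"
    using bk bSk by (auto simp: q_def b_def beta_def)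
  \<comment> \<open>After the move the beads are sorted again: rows \<open>i\<close> to
    \<open>k - 1\<close> take over the bead of the next row, which costs one box because the row
    number drops by one, and row \<open>k\<close> receives \<open>b\<close>.\<close>
  define \<nu> where "\<nu> = (\<lambda>j. if j < i then \<mu> j else if j < k then \<mu> (Suc j) - 1 else if j = k then q else \<mu> j)"
  note anti = partition_antimono[OF \<mu>]
  have pos: "0 < \<mu> j" if "j \<le> k" for j using anti[OF that] q(2) by simp
  have le: "\<nu> j \<le> \<mu> j" for j
    using anti[of j "Suc j"] q by (auto simp: \<nu>_def)
  have \<nu>: "is_partition \<nu>"
  proof -
    have "\<nu> (Suc j) \<le> \<nu> j" for j
    proof -
      consider "Suc j < i" | "Suc j = i" | "i \<le> j" "Suc j < k" | "i \<le> j" "Suc j = k" | "j = k" | "k < j"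
        using ik by linarith
      then show ?thesis
        using anti[of j "Suc j"] anti[of "Suc j" "Suc (Suc j)"] anti[of k "Suc k"] q ik le[of "Suc j"]
        by cases (auto simp: \<nu>_def)
    qed
    then have "antimono \<nu>" using lift_Suc_antimono_le[of \<nu>] by (simp add: antimono_def)
    moreover have "{i. \<nu> i \<noteq> 0} \<subseteq> {i. \<mu> i \<noteq> 0}"
    proof
      fix x assume "x \<in> {i. \<nu> i \<noteq> 0}"
      then show "x \<in> {i. \<mu> i \<noteq> 0}" using le[of x] by simp
    qed
    then have "finite {i. \<nu> i \<noteq> 0}" using \<mu> finite_subset by (auto simp: is_partition_def)
    ultimately show ?thesis by (simp add: is_partition_def)
  qed
  define H where "H = Sigma {i..k} (\<lambda>j. {\<nu> j..<\<mu> j})"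
  have dH: "diagram \<nu> = diagram \<mu> - H"
  proof (rule Set.set_eqI)
    fix z :: "nat \<times> nat"
    obtain j x where z: "z = (j, x)" by fastforce
    have "\<nu> j = \<mu> j" if "j < i \<or> k < j" using that ik by (auto simp: \<nu>_def)
    then show "z \<in> diagram \<nu> \<longleftrightarrow> z \<in> diagram \<mu> - H"
      using le[of j] by (cases "i \<le> j \<and> j \<le> k") (auto simp: z H_def diagram_def)
  qed
  have "H \<subseteq> rim \<mu>"
  proof
    fix x assume "x \<in> H"
    then obtain j y where x: "x = (j, y)" "i \<le> j" "j \<le> k" "\<nu> j \<le> y" "y < \<mu> j" by (auto simp: H_def)
    have "\<mu> (Suc j) \<le> Suc y"
      using x q(1) by (cases "j = k") (auto simp: \<nu>_def)
    then show "x \<in> rim \<mu>" using x by (auto simp: rim_def diagram_def)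
  qed
  moreover have "card H = p"
  proof -
    \<comment> \<open>The lengths of the removed row pieces telescope.\<close>
    have t: "m \<le> k \<Longrightarrow> (\<Sum>j\<in>{i..<m}. int (\<mu> j) - int (\<nu> j)) = int (\<mu> i) - int (\<mu> m) + int m - int i" if "i \<le> m" for m
      using that
    proof (induction rule: dec_induct)
      case (step m)
      have "int (\<nu> m) = int (\<mu> (Suc m)) - 1" using step pos[of "Suc m"] by (auto simp: \<nu>_def)
      then show ?case using step by (simp add: sum.atLeastLessThan_Suc)
    qed simp
    have "int (card H) = (\<Sum>j\<in>{i..k}. int (\<mu> j) - int (\<nu> j))"
      unfolding H_def using le by (subst card_SigmaI) (auto simp: of_nat_diff)
    also have "{i..k} = insert k {i..<k}" using ik by auto
    also have "(\<Sum>j\<in>insert k {i..<k}. int (\<mu> j) - int (\<nu> j)) = int p"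
      using t[OF ik order_refl] q ik by (simp add: \<nu>_def)
    finally show ?thesis by simp
  qed
  moreover have "edge_connected H"
  proof -
    let ?R = "\<lambda>u v. u \<in> H \<and> v \<in> H \<and> share_edge u v"
    have sym: "?R\<^sup>*\<^sup>* u v \<Longrightarrow> ?R\<^sup>*\<^sup>* v u" for u v
      by (rule sympD[OF symp_rtranclp]) (auto simp: symp_def share_edge_def)
    have inH: "(j, y) \<in> H" if "i \<le> j" "j \<le> k" "\<nu> j \<le> y" "y \<le> \<mu> j - 1" for j y
      using that pos[of j] by (auto simp: H_def)
    have \<nu>less: "\<nu> j \<le> \<mu> j - 1" if "i \<le> j" "j \<le> k" for j
      using that anti[of j "Suc j"] q(2) by (auto simp: \<nu>_def)
    have row: "?R\<^sup>*\<^sup>* (j, y) (j, \<mu> j - 1)" if "(j, y) \<in> H" for j y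
      using that by (intro row_connected inH) (auto simp: H_def)
    \<comment> \<open>Consecutive rows of the strip overlap in the column
      \<open>\<mu> (Suc j) - 1\<close>; there the path steps down.\<close>
    have start: "?R\<^sup>*\<^sup>* (i, \<mu> i - 1) (j, \<mu> j - 1)" if "i \<le> j" "j \<le> k" for j
      using that
    proof (induction rule: dec_induct)
      case (step j)
      have a: "(j, \<mu> (Suc j) - 1) \<in> H" "(Suc j, \<mu> (Suc j) - 1) \<in> H"
        using step \<nu>less[of j] \<nu>less[of "Suc j"] anti[of j "Suc j"] by (auto intro!: inH simp: \<nu>_def)
      have "?R\<^sup>*\<^sup>* (i, \<mu> i - 1) (j, \<mu> (Suc j) - 1)"
        using step sym[OF row[OF a(1)]] by (auto intro: rtranclp_trans)
      moreover have "?R (j, \<mu> (Suc j) - 1) (Suc j, \<mu> (Suc j) - 1)"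
        using a by (auto simp: share_edge_def)
      ultimately show ?case by (rule rtranclp.rtrancl_into_rtrancl)
    qed simp
    have all: "?R\<^sup>*\<^sup>* (i, \<mu> i - 1) x" if "x \<in> H" for x
    proof -
      obtain j y where x: "x = (j, y)" by fastforce
      then have "i \<le> j" "j \<le> k" using that by (auto simp: H_def)
      then show ?thesis using start[of j] sym[OF row[of j y]] that x by (auto intro: rtranclp_trans)
    qed
    show ?thesis unfolding edge_connected_def
      using all sym by (blast intro: rtranclp_trans)
  qed
  ultimately show ?thesis using \<nu> dH by (auto simp: is_hook_def)
qed

section \<open>Existence and uniqueness of the core\<close>

lemma core_beta:
  assumes "is_core p \<gamma>" "p > 0" "b \<in> range (beta \<gamma>)"
  shows "b - int p \<in> range (beta \<gamma>)"
proof (rule ccontr)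
  assume "b - int p \<notin> range (beta \<gamma>)"
  then show False using assms hook_exists[of \<gamma> p] by (auto simp: is_core_def)
qed

lemma cores_eqI:
  assumes "is_core p \<gamma>" "is_core p \<gamma>'" "p > 0"
    "\<And>r. int (residue_count p \<gamma> r) - int (residue_count p \<gamma>' r) = k"
  shows "\<gamma> = \<gamma>'"
  using assms core_beta by (intro cores_eq[of \<gamma> \<gamma>' p k]) (auto simp: is_core_def)

lemma core_exists:
  assumes "is_partition \<mu>" "p > 0"
  shows "\<exists>\<gamma>. (removes_hook p)\<^sup>*\<^sup>* \<mu> \<gamma> \<and> is_core p \<gamma>"
  using assms(1)
proof (induction "part_size \<mu>" arbitrary: \<mu> rule: less_induct)
  case less
  show ?case
  proof (cases "is_core p \<mu>")
    case False
    then obtain H where H: "is_hook p \<mu> H" using less.prems by (auto simp: is_core_def)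
    then obtain \<nu> where "is_partition \<nu>" "diagram \<nu> = diagram \<mu> - H" by (auto simp: is_hook_def)
    then have r: "removes_hook p \<mu> \<nu>" using H by (auto simp: removes_hook_def)
    then have "part_size \<nu> < part_size \<mu>" "is_partition \<nu>"
      using removes_hook_counts[OF less.prems assms(2) r] assms(2) by auto
    then obtain \<gamma> where "(removes_hook p)\<^sup>*\<^sup>* \<nu> \<gamma>" "is_core p \<gamma>" using less.hyps by blast
    then show ?thesis using r by (meson converse_rtranclp_into_rtranclp)
  qed blast
qed

text \<open>Each removal lowers all residue counts by one. Two cores reached from
  \<open>\<mu>\<close> thus have residue counts differing by a constant, and
  \<open>cores_eqI\<close> identifies them.\<close>

lemma core_of_eqI:
  assumes "is_partition \<mu>" "p > 0" "(removes_hook p)\<^sup>*\<^sup>* \<mu> \<gamma>" "is_core p \<gamma>"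
  shows "core_of p \<mu> = \<gamma>"
  unfolding core_of_def
proof (rule the_equality)
  fix \<gamma>' assume \<gamma>': "(removes_hook p)\<^sup>*\<^sup>* \<mu> \<gamma>' \<and> is_core p \<gamma>'"
  obtain w where w: "\<And>r. residue_count p \<mu> r = residue_count p \<gamma> r + w"
    using removes_hooks_counts[OF assms(3,1,2)] by blast
  obtain w' where w': "\<And>r. residue_count p \<mu> r = residue_count p \<gamma>' r + w'"
    using removes_hooks_counts[OF conjunct1[OF \<gamma>'] assms(1,2)] by blast
  have "int (residue_count p \<gamma>' r) - int (residue_count p \<gamma> r) = int w - int w'" for r
    using w[of r] w'[of r] by linarith
  then show "\<gamma>' = \<gamma>" by (rule cores_eqI[OF conjunct2[OF \<gamma>'] assms(4,2)])
qed (use assms in simp)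

lemma core_of_props:
  assumes "is_partition \<mu>" "p > 0"
  shows "is_core p (core_of p \<mu>) \<and> (\<exists>w. part_size \<mu> = part_size (core_of p \<mu>) + p * w \<and>
    (\<forall>r. residue_count p \<mu> r = residue_count p (core_of p \<mu>) r + w))"
proof -
  obtain \<gamma> where \<gamma>: "(removes_hook p)\<^sup>*\<^sup>* \<mu> \<gamma>" "is_core p \<gamma>" using core_exists[OF assms] by blast
  then show ?thesis using core_of_eqI[OF assms \<gamma>] removes_hooks_counts[OF \<gamma>(1) assms] by auto
qed

text \<open>Equal size makes equal cores have equal weights, hence equal residue counts. Conversely,
  equal residue counts leave only a constant difference, that of the weights, between those of the
  cores.\<close>

lemma core_of_eq_iff:
  assumes "is_partition \<mu>" "is_partition \<nu>" "p > 0" "part_size \<mu> = part_size \<nu>"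
  shows "core_of p \<mu> = core_of p \<nu> \<longleftrightarrow> (\<forall>r. residue_count p \<mu> r = residue_count p \<nu> r)"
proof -
  obtain w where w: "is_core p (core_of p \<mu>)" "part_size \<mu> = part_size (core_of p \<mu>) + p * w"
    "\<And>r. residue_count p \<mu> r = residue_count p (core_of p \<mu>) r + w"
    using core_of_props[OF assms(1,3)] by blast
  obtain v where v: "is_core p (core_of p \<nu>)" "part_size \<nu> = part_size (core_of p \<nu>) + p * v"
    "\<And>r. residue_count p \<nu> r = residue_count p (core_of p \<nu>) r + v"
    using core_of_props[OF assms(2,3)] by blast
  show ?thesis
  proof
    assume e: "core_of p \<mu> = core_of p \<nu>"
    have "p * w = p * v" using w(2) v(2) assms(4) unfolding e by linarith
    then have "w = v" using assms(3) by simp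
    then show "\<forall>r. residue_count p \<mu> r = residue_count p \<nu> r" using w(3) v(3) e by simp
  next
    assume e: "\<forall>r. residue_count p \<mu> r = residue_count p \<nu> r"
    have "int (residue_count p (core_of p \<mu>) r) - int (residue_count p (core_of p \<nu>) r) = int v - int w" for r
      using w(3)[of r] v(3)[of r] e[rule_format, of r] by linarith
    then show "core_of p \<mu> = core_of p \<nu>" by (rule cores_eqI[OF w(1) v(1) assms(3)])
  qed
qed

text \<open>The first row of the core is prolonged by \<open>p * w\<close> boxes; its last
  \<open>p\<close> boxes can then be removed \<open>w\<close> times as a horizontal hook.\<close>

lemma partition_with_core:
  assumes "is_core p \<gamma>" "p > 0"
  shows "\<exists>\<mu>. is_partition \<mu> \<and> part_size \<mu> = part_size \<gamma> + p * w \<and> core_of p \<mu> = \<gamma>"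
proof -
  have \<gamma>: "is_partition \<gamma>" using assms by (simp add: is_core_def)
  define \<mu> where "\<mu> = (\<lambda>w. \<gamma>(0 := \<gamma> 0 + p * w))"
  have part: "is_partition (\<mu> w)" for w
  proof -
    have "antimono (\<mu> w)"
      using partition_antimono[OF \<gamma>] by (auto simp: \<mu>_def antimono_def trans_le_add1)
    moreover have "{i. \<mu> w i \<noteq> 0} \<subseteq> insert 0 {i. \<gamma> i \<noteq> 0}" by (auto simp: \<mu>_def)
    then have "finite {i. \<mu> w i \<noteq> 0}" using \<gamma> by (auto simp: is_partition_def intro: finite_subset)
    ultimately show ?thesis by (simp add: is_partition_def)
  qed
  have step: "removes_hook p (\<mu> (Suc w)) (\<mu> w)" for w
  proof -
    define H where "H = {0::nat} \<times> {\<mu> w 0..<\<mu> (Suc w) 0}"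
    have d: "diagram (\<mu> w) = diagram (\<mu> (Suc w)) - H"
      by (auto simp: H_def diagram_def \<mu>_def split: if_splits)
    have "H \<subseteq> rim (\<mu> (Suc w))"
      using partition_antimono[OF \<gamma>, of 0 1] by (auto simp: H_def rim_def diagram_def \<mu>_def)
    moreover have "card H = p" by (simp add: H_def \<mu>_def card_cartesian_product)
    moreover have "edge_connected H"
      unfolding edge_connected_def
    proof (intro ballI)
      fix x y assume "x \<in> H" "y \<in> H"
      let ?R = "\<lambda>u v. u \<in> H \<and> v \<in> H \<and> share_edge u v"
      have sym: "?R\<^sup>*\<^sup>* u v \<Longrightarrow> ?R\<^sup>*\<^sup>* v u" for u v
        by (rule sympD[OF symp_rtranclp]) (auto simp: symp_def share_edge_def)
      obtain a b where ab: "x = (0, a)" "y = (0, b)" "(0, a) \<in> H" "(0, b) \<in> H"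
        using \<open>x \<in> H\<close> \<open>y \<in> H\<close> by (auto simp: H_def)
      have *: "?R\<^sup>*\<^sup>* (0, a) (0, b)" if "a \<le> b" "(0, a) \<in> H" "(0, b) \<in> H" for a b
        using that by (intro row_connected) (auto simp: H_def)
      show "?R\<^sup>*\<^sup>* x y" using *[of a b] sym[OF *[of b a]] ab by (cases "a \<le> b") auto
    qed
    ultimately have "is_hook p (\<mu> (Suc w)) H" unfolding is_hook_def using d part[of w] by blast
    then show ?thesis unfolding removes_hook_def using d part[of w] by blast
  qed
  have "(removes_hook p)\<^sup>*\<^sup>* (\<mu> w) (\<mu> 0)" for w
    by (induction w) (auto intro: converse_rtranclp_into_rtranclp step)
  moreover have "\<mu> 0 = \<gamma>" by (auto simp: \<mu>_def)
  ultimately have "core_of p (\<mu> w) = \<gamma>" using core_of_eqI[OF part assms(2)] assms(1) by metis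
  moreover have "part_size (\<mu> w) = part_size \<gamma> + p * w" for w
  proof (induction w)
    case (Suc w)
    then show ?case using removes_hook_counts[OF part assms(2) step[of w]] by simp
  qed (simp add: \<open>\<mu> 0 = \<gamma>\<close>)
  ultimately show ?thesis using part by blast
qed

section \<open>Central characters\<close>

text \<open>On symmetric sums of monomials the characters agree because \<open>\<sigma>\<close>
  matches the contents and merely permutes the exponents in \<open>Q\<close>. A general central
  element is peeled off class by class: the outer induction bounds the number of moved points, the
  inner one counts the permutations in the support that move the largest number.\<close>

lemma central_characters_eq:
  fixes z :: "'r::comm_ring_1 galg"
  assumes T1: "column_tab n r1 c1" and T2: "column_tab n r2 c2"
    and cont: "image_mset (\<lambda>i. of_int (int (c1 i) - int (r1 i)) :: 'r) (mset_set {1..n}) =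
      image_mset (\<lambda>i. of_int (int (c2 i) - int (r2 i))) (mset_set {1..n})"
    and z: "central n z"
  shows "tab.omega n r1 c1 z = tab.omega n r2 c2 z"
proof -
  interpret A: column_tab n r1 c1 by (rule T1)
  interpret B: column_tab n r2 c2 by (rule T2)
  define a where "a = (\<lambda>i. of_int (A.content i) :: 'r)"
  define b where "b = (\<lambda>i. of_int (B.content i) :: 'r)"
  have "image_mset a (mset_set {1..n}) = image_mset b (mset_set {1..n})"
    using cont by (simp add: a_def b_def A.content_def B.content_def)
  then obtain \<sigma> where \<sigma>: "\<sigma> permutes {1..n}" "\<forall>i\<in>{1..n}. a i = b (\<sigma> i)"
    by (rule image_mset_eq_implies_permutes[OF finite_atLeastAtMost])
  have mono: "A.omega (\<Sum>\<alpha>\<in>Q. JM_monomial \<alpha> n :: 'r galg) = B.omega (\<Sum>\<alpha>\<in>Q. JM_monomial \<alpha> n :: 'r galg)"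
    if Q: "\<forall>\<alpha>\<in>Q. \<forall>\<sigma>. \<sigma> permutes {1..n} \<longrightarrow> \<alpha> \<circ> \<sigma> \<in> Q"
      and cent: "central n (\<Sum>\<alpha>\<in>Q. JM_monomial \<alpha> n :: 'r galg)" for Q
  proof -
    have i\<sigma>: "inv' \<sigma> permutes {1..n}" using \<sigma>(1) by (rule permutes_inv)
    have inv: "\<sigma> \<circ> inv' \<sigma> = id" "inv' \<sigma> \<circ> \<sigma> = id" using permutes_inv_o[OF \<sigma>(1)] by auto
    have "A.omega (\<Sum>\<alpha>\<in>Q. JM_monomial \<alpha> n :: 'r galg) = (\<Sum>\<alpha>\<in>Q. \<Prod>i\<in>{1..n}. a i ^ \<alpha> i)"
      using A.omega_sum_monomials[OF cent] by (simp add: a_def)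
    also have "\<dots> = (\<Sum>\<alpha>\<in>Q. \<Prod>i\<in>{1..n}. b (\<sigma> i) ^ \<alpha> i)"
      using \<sigma>(2) by (intro sum.cong prod.cong) auto
    also have "\<dots> = (\<Sum>\<alpha>\<in>Q. \<Prod>i\<in>{1..n}. b i ^ (\<alpha> \<circ> inv' \<sigma>) i)"
    proof (rule sum.cong[OF refl])
      fix \<alpha>
      have "(\<Prod>i\<in>{1..n}. b i ^ (\<alpha> \<circ> inv' \<sigma>) i) = (\<Prod>i\<in>{1..n}. b (\<sigma> i) ^ (\<alpha> \<circ> inv' \<sigma>) (\<sigma> i))"
        by (subst prod.permute[OF \<sigma>(1)]) (simp add: comp_def)
      then show "(\<Prod>i\<in>{1..n}. b (\<sigma> i) ^ \<alpha> i) = (\<Prod>i\<in>{1..n}. b i ^ (\<alpha> \<circ> inv' \<sigma>) i)"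
        using permutes_inverses[OF \<sigma>(1)] by simp
    qed
    also have "\<dots> = (\<Sum>\<alpha>\<in>Q. \<Prod>i\<in>{1..n}. b i ^ \<alpha> i)"
      by (rule sum.reindex_bij_witness[of _ "\<lambda>\<alpha>. \<alpha> \<circ> \<sigma>" "\<lambda>\<alpha>. \<alpha> \<circ> inv' \<sigma>"])
        (use Q \<sigma>(1) i\<sigma> in \<open>auto simp: comp_assoc inv\<close>)
    also have "\<dots> = B.omega (\<Sum>\<alpha>\<in>Q. JM_monomial \<alpha> n :: 'r galg)"
      using B.omega_sum_monomials[OF cent] by (simp add: b_def)
    finally show ?thesis .
  qed
  have main: "\<forall>z. central n z \<longrightarrow> (\<forall>g. lk z g \<noteq> 0 \<longrightarrow> card (moved g) < s) \<longrightarrow> A.omega z = B.omega (z :: 'r galg)" for s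
  proof (induction s)
    case 0
    show ?case
    proof (intro allI impI)
      fix z :: "'r galg" assume "\<forall>g. lk z g \<noteq> 0 \<longrightarrow> card (moved g) < 0"
      then have "z = 0" by (intro poly_mapping_eqI) auto
      then show "A.omega z = B.omega z" by simp
    qed
  next
    case (Suc s)
    define T where "T = (\<lambda>z :: 'r galg. {g. card (moved g) = s \<and> lk z g \<noteq> 0})"
    have finT: "finite (T z)" for z
      by (rule finite_subset[OF _ finite_keys[of z]]) (auto simp: T_def in_keys_iff)
    have "central n z \<Longrightarrow> (\<forall>g. lk z g \<noteq> 0 \<longrightarrow> card (moved g) < Suc s) \<Longrightarrow> A.omega z = B.omega z" for z :: "'r galg"
    proof (induction "card (T z)" arbitrary: z rule: less_induct)
      case less
      show ?case
      proof (cases "T z = {}")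
        case True
        then have "\<forall>g. lk z g \<noteq> 0 \<longrightarrow> card (moved g) < s" using less.prems(2) by (auto simp: T_def less_Suc_eq)
        then show ?thesis using Suc.IH less.prems(1) by blast
      next
        case False
        then obtain g0 where g0: "card (moved g0) = s" "lk z g0 \<noteq> 0" by (auto simp: T_def)
        have cz: "supp_in n z" "\<And>g h. g \<in> Sn n \<Longrightarrow> lk z (g + h - g) = lk z h"
          using less.prems(1) by (auto simp: central_iff_class_function)
        have "g0 \<in> Sn n" using cz(1) g0(2) by (auto simp: supp_in_iff)
        then obtain Q where Q: "finite Q" "\<forall>\<alpha>\<in>Q. \<forall>\<sigma>. \<sigma> permutes {1..n} \<longrightarrow> \<alpha> \<circ> \<sigma> \<in> Q"
          "\<And>g. card (moved g0) \<le> card (moved g) \<Longrightarrow>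
            lk (\<Sum>\<alpha>\<in>Q. JM_monomial \<alpha> n :: 'r galg) g = (if \<exists>c\<in>Sn n. g = c + g0 - c then 1 else 0)"
          using class_leading_term[of g0 n, where ?'r = 'r] by blast
        define M where "M = (\<Sum>\<alpha>\<in>Q. JM_monomial \<alpha> n :: 'r galg)"
        have M: "central n M"
          unfolding M_def using Q(1)
        proof (rule central_sum_monomials)
          fix \<alpha> k assume *: "\<alpha> \<in> Q" "1 \<le> k" "k < n"
          then have "transpose k (Suc k) permutes {1..n}" by (intro permutes_swap_id) auto
          then show "\<alpha> \<circ> transpose k (Suc k) \<in> Q" using Q(2) *(1) by blast
        qed
        \<comment> \<open>This clears the class of \<open>g0\<close> and changes no other
          coefficient at a permutation moving at least \<open>s\<close> points; those moving fewer
          are left to the outer induction.\<close>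
        define z' where "z' = z - Sc (lk z g0) * M"
        have z': "central n z'" unfolding z'_def by (intro central_diff central_mult central_Sc M less.prems)
        have lz': "lk z' g = (if \<exists>c\<in>Sn n. g = c + g0 - c then 0 else lk z g)" if "s \<le> card (moved g)" for g
          using Q(3)[of g] that g0(1) cz(2) by (auto simp: z'_def lookup_minus M_def)
        have "T z' \<subseteq> T z" using lz' by (auto simp: T_def split: if_splits)
        moreover have "g0 \<in> T z - T z'"
        proof -
          have "\<exists>c\<in>Sn n. g0 = c + g0 - c" by (intro bexI[of _ 0]) auto
          then show ?thesis using lz'[of g0] g0 by (auto simp: T_def)
        qed
        ultimately have "card (T z') < card (T z)" by (intro psubset_card_mono finT) blast
        moreover have "\<forall>g. lk z' g \<noteq> 0 \<longrightarrow> card (moved g) < Suc s"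
        proof (intro allI impI)
          fix g assume "lk z' g \<noteq> 0"
          then show "card (moved g) < Suc s"
            using lz'[of g] less.prems(2) by (cases "s \<le> card (moved g)") (auto split: if_splits)
        qed
        ultimately have "A.omega z' = B.omega z'" using less.hyps z' by blast
        moreover have "A.omega M = B.omega M" using mono[OF Q(2)] M by (simp add: M_def)
        ultimately show ?thesis
          by (simp add: z'_def A.omega_diff B.omega_diff A.omega_Sc_mult B.omega_Sc_mult)
      qed
    qed
    then show ?case by blast
  qed
  define s where "s = Suc (Max (insert 0 ((\<lambda>g. card (moved g)) ` Sn n)))"
  have "card (moved g) < s" if "lk z g \<noteq> 0" for g
  proof -
    have "g \<in> Sn n" using that z by (auto simp: central_def supp_in_iff)
    then show ?thesis by (auto simp: s_def less_Suc_eq_le intro!: Max_ge)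
  qed
  then show ?thesis using main[of s] z by blast
qed

lemma proots_linear_factors:
  fixes f :: "'a \<Rightarrow> 'r::idom"
  assumes "finite A"
  shows "proots (\<Prod>i\<in>A. [:f i, 1:]) = image_mset (\<lambda>i. - f i) (mset_set A)"
  using assms
proof (induction A rule: finite_induct)
  case (insert x A)
  have "(\<Prod>i\<in>A. [:f i, 1:]) \<noteq> 0" using insert(1) by simp
  then have "proots ([:f x, 1:] * (\<Prod>i\<in>A. [:f i, 1:])) = proots [:f x, 1:] + proots (\<Prod>i\<in>A. [:f i, 1:])"
    by (intro proots_mult) auto
  moreover have "proots [:f x, 1:] = {#- f x#}" by simp
  moreover have "(\<Prod>i\<in>insert x A. [:f i, 1:]) = [:f x, 1:] * (\<Prod>i\<in>A. [:f i, 1:])"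
    using insert(1,2) by (rule prod.insert)
  ultimately show ?case using insert by simp
qed simp

text \<open>Both characters of \<open>JM_poly\<close> at an indeterminate are products of linear
  factors, whose roots with multiplicity are the negatives of the contents.\<close>

lemma central_characters_eq_imp:
  assumes T1: "column_tab n r1 c1" and T2: "column_tab n r2 c2"
    and eq: "\<And>z :: 'r::idom galg. central n z \<Longrightarrow> tab.omega n r1 c1 z = tab.omega n r2 c2 z"
  shows "image_mset (\<lambda>i. of_int (int (c1 i) - int (r1 i)) :: 'r) (mset_set {1..n}) =
      image_mset (\<lambda>i. of_int (int (c2 i) - int (r2 i))) (mset_set {1..n})"
proof -
  interpret A: column_tab n r1 c1 by (rule T1)
  interpret B: column_tab n r2 c2 by (rule T2)
  define Z where "Z = JM_poly n ([:0, 1:] :: 'r poly)"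
  \<comment> \<open>The coefficients of the powers of the indeterminate. They are central over
    \<open>'r\<close>, and the integer weights in \<open>omega\<close> make it commute with taking
    them.\<close>
  define z where "z = (\<lambda>k. Poly_Mapping.map (\<lambda>p. coeff p k) Z)"
  have lz: "lk (z k) g = coeff (lk Z g) k" for k g
    by (simp add: z_def Poly_Mapping.map.rep_eq when_def)
  have "central n Z" unfolding Z_def by (rule central_JM_poly)
  then have cz: "central n (z k)" for k
    by (auto simp: central_iff_class_function lz supp_in_iff)
  have cm: "coeff (of_int m * q) k = of_int m * coeff q k" for m k and q :: "'r poly"
    by (simp add: of_int_poly)
  have "coeff (A.omega Z) k = A.omega (z k)" "coeff (B.omega Z) k = B.omega (z k)" for k
    by (simp_all add: A.omega_def B.omega_def coeff_sum cm lz)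
  then have "A.omega Z = B.omega Z" using eq[OF cz] by (intro poly_eqI) simp
  then have "(\<Prod>i\<in>{1..n}. [:of_int (A.content i), 1:]) = (\<Prod>i\<in>{1..n}. [:of_int (B.content i), 1 :: 'r:])"
    unfolding Z_def A.omega_JM_poly B.omega_JM_poly by (simp add: of_int_poly)
  then have "image_mset (\<lambda>i. - of_int (A.content i) :: 'r) (mset_set {1..n}) =
      image_mset (\<lambda>i. - of_int (B.content i)) (mset_set {1..n})"
    using proots_linear_factors[OF finite_atLeastAtMost] by metis
  then have "image_mset uminus (image_mset (\<lambda>i. - of_int (A.content i) :: 'r) (mset_set {1..n})) =
      image_mset uminus (image_mset (\<lambda>i. - of_int (B.content i)) (mset_set {1..n}))" by simp
  then show ?thesis by (simp add: A.content_def B.content_def comp_def image_mset.compositionality)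
qed

subsection \<open>Column-reading tableaux\<close>

lemma rank_bijection:
  fixes key :: "'a \<Rightarrow> nat"
  assumes D: "finite D" and inj: "inj_on key D"
  shows "\<exists>t. bij_betw t D {1..card D} \<and> (\<forall>x\<in>D. \<forall>y\<in>D. t x < t y \<longleftrightarrow> key x < key y)"
proof -
  define t where "t = (\<lambda>x. card {y \<in> D. key y \<le> key x})"
  have less: "t x < t y" if "x \<in> D" "y \<in> D" "key x < key y" for x y
  proof -
    have "{z \<in> D. key z \<le> key x} \<subset> {z \<in> D. key z \<le> key y}"
    proof (rule psubsetI)
      have "y \<in> {z \<in> D. key z \<le> key y}" "y \<notin> {z \<in> D. key z \<le> key x}" using that by auto
      then show "{z \<in> D. key z \<le> key x} \<noteq> {z \<in> D. key z \<le> key y}" by blast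
    qed (use that in auto)
    then show ?thesis unfolding t_def using D by (intro psubset_card_mono) auto
  qed
  have iff: "t x < t y \<longleftrightarrow> key x < key y" if "x \<in> D" "y \<in> D" for x y
    using less[OF that] less[OF that(2,1)] inj_onD[OF inj _ that]
    by (cases "key x" "key y" rule: linorder_cases) auto
  have inj_t: "inj_on t D"
  proof (rule inj_onI)
    fix x y assume xy: "x \<in> D" "y \<in> D" "t x = t y"
    then have "key x = key y" using iff[of x y] iff[of y x] by auto
    then show "x = y" using inj_onD[OF inj] xy by auto
  qed
  have "t ` D \<subseteq> {1..card D}"
  proof
    fix a assume "a \<in> t ` D"
    then obtain x where x: "x \<in> D" "a = t x" by blast
    have "card {x} \<le> t x" unfolding t_def using D x(1) by (intro card_mono) auto
    moreover have "t x \<le> card D" unfolding t_def using D by (intro card_mono) auto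
    ultimately show "a \<in> {1..card D}" using x by simp
  qed
  then have "t ` D = {1..card D}" by (intro card_subset_eq) (simp_all add: card_image[OF inj_t])
  then show ?thesis using inj_t iff by (intro exI[of _ t]) (simp add: bij_betw_def)
qed

lemma lex_key_less:
  assumes "b < K" "d < (K::nat)"
  shows "a * K + b < c * K + d \<longleftrightarrow> a < c \<or> (a = c \<and> b < d)"
proof -
  have less: "a * K + b < c * K + d" if "a < c" "b < K" for a b c d
  proof -
    have "a * K + b < Suc a * K" using that(2) by simp
    also have "\<dots> \<le> c * K" using that(1) by (intro mult_le_mono1) simp
    finally show ?thesis by simp
  qed
  show ?thesis using less[of a c b d] less[of c a d b] assms
    by (cases a c rule: linorder_cases) auto
qed

definition column_reading :: "(nat \<Rightarrow> nat) \<Rightarrow> (nat \<times> nat \<Rightarrow> nat) \<Rightarrow> bool" where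
  "column_reading \<mu> t \<longleftrightarrow> t \<in> tableaux \<mu> \<and> (\<forall>x\<in>diagram \<mu>. \<forall>y\<in>diagram \<mu>.
     t x < t y \<longleftrightarrow> snd x < snd y \<or> (snd x = snd y \<and> fst x < fst y))"

definition reading :: "(nat \<Rightarrow> nat) \<Rightarrow> nat \<times> nat \<Rightarrow> nat" where
  "reading \<mu> = (SOME t. column_reading \<mu> t)"

definition box_of :: "(nat \<Rightarrow> nat) \<Rightarrow> nat \<Rightarrow> nat \<times> nat" where
  "box_of \<mu> = the_inv_into (diagram \<mu>) (reading \<mu>)"

lemma reading:
  assumes \<mu>: "is_partition \<mu>" shows "column_reading \<mu> (reading \<mu>)"
proof -
  have "finite (fst ` diagram \<mu>)" using finite_diagram[OF \<mu>] by simp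
  then obtain K where "\<forall>k\<in>fst ` diagram \<mu>. k < K" using finite_nat_set_iff_bounded by blast
  then have K: "fst x < K" if "x \<in> diagram \<mu>" for x using that by blast
  \<comment> \<open>As \<open>K\<close> exceeds all rows, the order of the keys is the lexicographic
    order by column and then row.\<close>
  define key where "key = (\<lambda>x :: nat \<times> nat. snd x * K + fst x)"
  have less: "key x < key y \<longleftrightarrow> snd x < snd y \<or> (snd x = snd y \<and> fst x < fst y)"
    if "x \<in> diagram \<mu>" "y \<in> diagram \<mu>" for x y
    unfolding key_def using K[OF that(1)] K[OF that(2)] by (rule lex_key_less)
  have "inj_on key (diagram \<mu>)"
  proof (rule inj_onI)
    fix x y assume "x \<in> diagram \<mu>" "y \<in> diagram \<mu>" "key x = key y"
    then have "\<not> key x < key y" "\<not> key y < key x" by auto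
    then show "x = y" using less[OF \<open>x \<in> diagram \<mu>\<close> \<open>y \<in> diagram \<mu>\<close>] less[OF \<open>y \<in> diagram \<mu>\<close> \<open>x \<in> diagram \<mu>\<close>]
      by (auto simp: prod_eq_iff)
  qed
  from rank_bijection[OF finite_diagram[OF \<mu>] this] obtain t where
    t: "bij_betw t (diagram \<mu>) {1..card (diagram \<mu>)}"
      "\<And>x y. x \<in> diagram \<mu> \<Longrightarrow> y \<in> diagram \<mu> \<Longrightarrow> t x < t y \<longleftrightarrow> key x < key y" by blast
  define t' where "t' = (\<lambda>x. if x \<in> diagram \<mu> then t x else 0)"
  have "bij_betw t' (diagram \<mu>) {1..part_size \<mu>}"
  proof -
    have "bij_betw t' (diagram \<mu>) {1..card (diagram \<mu>)} = bij_betw t (diagram \<mu>) {1..card (diagram \<mu>)}"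
      by (rule bij_betw_cong) (simp add: t'_def)
    then show ?thesis using t(1) card_diagram[OF \<mu>] by simp
  qed
  then have "column_reading \<mu> t'"
    using t(2) less by (auto simp: column_reading_def tableaux_def t'_def)
  then show ?thesis unfolding reading_def using someI[of "column_reading \<mu>" t'] by blast
qed

lemma reading_bij: "is_partition \<mu> \<Longrightarrow> bij_betw (reading \<mu>) (diagram \<mu>) {1..part_size \<mu>}"
  using reading[of \<mu>] by (auto simp: column_reading_def tableaux_def)

lemma box_of:
  assumes "is_partition \<mu>"
  shows "x \<in> diagram \<mu> \<Longrightarrow> box_of \<mu> (reading \<mu> x) = x"
    and "a \<in> {1..part_size \<mu>} \<Longrightarrow> reading \<mu> (box_of \<mu> a) = a"
    and "a \<in> {1..part_size \<mu>} \<Longrightarrow> box_of \<mu> a \<in> diagram \<mu>"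
  using reading_bij[OF assms]
  by (auto simp: box_of_def bij_betw_def the_inv_into_f_f f_the_inv_into_f the_inv_into_into)

lemma column_tab_reading:
  assumes \<mu>: "is_partition \<mu>" and n: "part_size \<mu> = n"
  shows "column_tab n (\<lambda>a. fst (box_of \<mu> a)) (\<lambda>a. snd (box_of \<mu> a))"
proof
  note b = box_of[OF \<mu>, unfolded n]
  show "inj_on (\<lambda>x. (fst (box_of \<mu> x), snd (box_of \<mu> x))) {1..n}"
    by (rule inj_onI) (metis b(2) prod.collapse)
  show "\<exists>y\<in>{1..n}. fst (box_of \<mu> y) = i \<and> snd (box_of \<mu> y) = j"
    if x: "x \<in> {1..n}" "i \<le> fst (box_of \<mu> x)" "j \<le> snd (box_of \<mu> x)" for x i j
  proof -
    have "(i, j) \<in> diagram \<mu>"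
      using diagram_down[OF \<mu>, of "fst (box_of \<mu> x)" "snd (box_of \<mu> x)" i j] b(3)[OF x(1)] x by simp
    then show ?thesis
      using b(1) bij_betwE[OF reading_bij[OF \<mu>]] n by (intro bexI[of _ "reading \<mu> (i, j)"]) auto
  qed
  show "x < y \<longleftrightarrow> snd (box_of \<mu> x) < snd (box_of \<mu> y) \<or>
      (snd (box_of \<mu> x) = snd (box_of \<mu> y) \<and> fst (box_of \<mu> x) < fst (box_of \<mu> y))"
    if "x \<in> {1..n}" "y \<in> {1..n}" for x y
  proof -
    have "reading \<mu> (box_of \<mu> x) < reading \<mu> (box_of \<mu> y) \<longleftrightarrow> snd (box_of \<mu> x) < snd (box_of \<mu> y) \<or>
      (snd (box_of \<mu> x) = snd (box_of \<mu> y) \<and> fst (box_of \<mu> x) < fst (box_of \<mu> y))"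
      using reading[OF \<mu>] b(3)[OF that(1)] b(3)[OF that(2)] unfolding column_reading_def by blast
    then show ?thesis by (simp only: b(2) that)
  qed
qed

definition om :: "(nat \<Rightarrow> nat) \<Rightarrow> 'r::comm_ring_1 galg \<Rightarrow> 'r" where
  "om \<mu> = tab.omega (part_size \<mu>) (\<lambda>a. fst (box_of \<mu> a)) (\<lambda>a. snd (box_of \<mu> a))"

lemma contents_diagram:
  assumes \<mu>: "is_partition \<mu>" and n: "part_size \<mu> = n"
  shows "image_mset (\<lambda>a. f (int (snd (box_of \<mu> a)) - int (fst (box_of \<mu> a)))) (mset_set {1..n}) =
    image_mset (\<lambda>x. f (box_content x)) (mset_set (diagram \<mu>))"
proof -
  have "mset_set {1..n} = image_mset (reading \<mu>) (mset_set (diagram \<mu>))"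
    using reading_bij[OF \<mu>] n by (simp add: bij_betw_def image_mset_mset_set)
  then have "image_mset (\<lambda>a. f (int (snd (box_of \<mu> a)) - int (fst (box_of \<mu> a)))) (mset_set {1..n}) =
    image_mset (\<lambda>x. f (int (snd (box_of \<mu> (reading \<mu> x))) - int (fst (box_of \<mu> (reading \<mu> x))))) (mset_set (diagram \<mu>))"
    by (simp add: image_mset.compositionality comp_def)
  also have "\<dots> = image_mset (\<lambda>x. f (box_content x)) (mset_set (diagram \<mu>))"
    using finite_diagram[OF \<mu>] box_of(1)[OF \<mu>]
    by (intro image_mset_cong) (auto simp: box_content_def)
  finally show ?thesis .
qed

lemma om_eq_iff:
  assumes \<mu>: "is_partition \<mu>" "part_size \<mu> = n" and \<nu>: "is_partition \<nu>" "part_size \<nu> = n"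
  shows "(\<forall>z :: 'r::idom galg. central n z \<longrightarrow> om \<mu> z = om \<nu> z) \<longleftrightarrow>
    (\<forall>a :: 'r. card {x \<in> diagram \<mu>. of_int (box_content x) = a} = card {x \<in> diagram \<nu>. of_int (box_content x) = a})"
proof -
  have "(\<forall>z :: 'r galg. central n z \<longrightarrow> om \<mu> z = om \<nu> z) \<longleftrightarrow>
    image_mset (\<lambda>x. of_int (box_content x) :: 'r) (mset_set (diagram \<mu>)) =
    image_mset (\<lambda>x. of_int (box_content x)) (mset_set (diagram \<nu>))"
    (is "_ \<longleftrightarrow> ?M \<mu> = ?M \<nu>")
    unfolding om_def \<mu>(2) \<nu>(2) contents_diagram[OF \<mu>, symmetric] contents_diagram[OF \<nu>, symmetric]
    using central_characters_eq[OF column_tab_reading[OF \<mu>] column_tab_reading[OF \<nu>], where ?'r = 'r]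
      central_characters_eq_imp[OF column_tab_reading[OF \<mu>] column_tab_reading[OF \<nu>], where ?'r = 'r]
    by blast
  also have "\<dots> \<longleftrightarrow> (\<forall>a. count (?M \<mu>) a = count (?M \<nu>) a)" by (simp add: multiset_eq_iff)
  finally show ?thesis
    by (simp add: count_image_mset_eq_card_vimage finite_diagram \<mu> \<nu>)
qed

section \<open>Central characters indexed by partitions\<close>

definition partitions_of :: "nat \<Rightarrow> (nat \<Rightarrow> nat) set" where
  "partitions_of n = {\<mu>. is_partition \<mu> \<and> part_size \<mu> = n}"

lemma finite_partitions_of: "finite (partitions_of n)"
proof -
  have sub: "diagram \<mu> \<subseteq> {..<n} \<times> {..<n}" if "\<mu> \<in> partitions_of n" for \<mu>
  proof
    fix x assume x: "x \<in> diagram \<mu>"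
    obtain i j where ij: "x = (i, j)" by fastforce
    have \<mu>: "is_partition \<mu>" "card (diagram \<mu>) = n" using that by (auto simp: partitions_of_def card_diagram)
    have "{..i} \<times> {0} \<subseteq> diagram \<mu>" "{0} \<times> {..j} \<subseteq> diagram \<mu>"
      using diagram_down[OF \<mu>(1), of i j] x ij by auto
    then have "card ({..i} \<times> {0::nat}) \<le> n" "card ({0::nat} \<times> {..j}) \<le> n"
      using card_mono[OF finite_diagram[OF \<mu>(1)]] \<mu>(2) by metis+
    then show "x \<in> {..<n} \<times> {..<n}" by (simp add: ij card_cartesian_product)
  qed
  have "finite (diagram ` partitions_of n)"
    by (rule finite_subset[of _ "Pow ({..<n} \<times> {..<n})"]) (use sub in auto)
  then show ?thesis by (rule finite_imageD) (auto intro!: inj_onI diagram_inject)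
qed

definition Rs :: "(nat \<Rightarrow> nat) \<Rightarrow> sperm set" where
  "Rs \<mu> = tab.Rst (part_size \<mu>) (\<lambda>a. fst (box_of \<mu> a))"
definition Cs :: "(nat \<Rightarrow> nat) \<Rightarrow> sperm set" where
  "Cs \<mu> = tab.Cst (part_size \<mu>) (\<lambda>a. snd (box_of \<mu> a))"

lemma tab_of: "\<mu> \<in> partitions_of n \<Longrightarrow> column_tab n (\<lambda>a. fst (box_of \<mu> a)) (\<lambda>a. snd (box_of \<mu> a))"
  by (rule column_tab_reading) (auto simp: partitions_of_def)

lemma tab_of': "\<mu> \<in> partitions_of n \<Longrightarrow> tab n (\<lambda>a. fst (box_of \<mu> a)) (\<lambda>a. snd (box_of \<mu> a))"
  using tab_of column_tab.axioms(1) by blast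

lemma om_alt:
  assumes "\<mu> \<in> partitions_of n"
  shows "om \<mu> z = (\<Sum>c\<in>Cs \<mu>. \<Sum>r\<in>Rs \<mu>. of_int (sgn_perm c) * lk z (c + r))"
  using assms tab.omega_def[OF tab_of'[OF assms]]
  by (auto simp: om_def Rs_def Cs_def partitions_of_def)

context
  fixes \<mu> n assumes \<mu>: "\<mu> \<in> partitions_of n"
begin

interpretation column_tab n "\<lambda>a. fst (box_of \<mu> a)" "\<lambda>a. snd (box_of \<mu> a)" by (rule tab_of[OF \<mu>])

lemma om_omega: "om \<mu> = omega"
  using \<mu> by (auto simp: om_def partitions_of_def)

lemma om_mult: "central n x \<Longrightarrow> central n y \<Longrightarrow> om \<mu> (x * y) = om \<mu> x * om \<mu> y"
  and om_power: "central n x \<Longrightarrow> om \<mu> (x ^ k) = om \<mu> x ^ k"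
  and om_add: "om \<mu> (x + y) = om \<mu> x + om \<mu> y"
  and om_diff: "om \<mu> (x - y) = om \<mu> x - om \<mu> y"
  and om_Sc: "om \<mu> (Sc a) = a"
  and om_1: "om \<mu> 1 = 1"
  and om_0: "om \<mu> 0 = 0"
  and om_Sc_mult: "om \<mu> (Sc a * x) = a * om \<mu> x"
  and om_sum: "om \<mu> (sum f A) = (\<Sum>i\<in>A. om \<mu> (f i))"
  and om_prod_list: "(\<And>x. x \<in> set xs \<Longrightarrow> central n x) \<Longrightarrow> om \<mu> (prod_list xs) = prod_list (map (om \<mu>) xs)"
  unfolding om_omega
  by (simp_all add: omega_mult omega_power omega_add omega_diff omega_Sc_mult omega_sum omega_prod_list)

end

text \<open>Lagrange interpolation without denominators: for each \<open>m\<close> other than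
  \<open>l\<close> take an element separating the two, shift it to vanish at \<open>m\<close>, and
  multiply. The product survives at \<open>l\<close> because the values lie in a domain.\<close>

lemma separate:
  fixes ph :: "'l \<Rightarrow> 'a::ring_1 \<Rightarrow> 'r::idom"
  assumes mult: "\<And>x y. x \<in> Z \<Longrightarrow> y \<in> Z \<Longrightarrow> x * y \<in> Z"
    "\<And>l x y. l \<in> P \<Longrightarrow> x \<in> Z \<Longrightarrow> y \<in> Z \<Longrightarrow> ph l (x * y) = ph l x * ph l y"
    and one: "1 \<in> Z" "\<And>l. l \<in> P \<Longrightarrow> ph l 1 = 1"
    and shift: "\<And>l m x. l \<in> P \<Longrightarrow> m \<in> P \<Longrightarrow> x \<in> Z \<Longrightarrow> \<exists>y\<in>Z. \<forall>k\<in>P. ph k y = ph k x - ph l x"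
    and dist: "\<And>l m. l \<in> P \<Longrightarrow> m \<in> P \<Longrightarrow> l \<noteq> m \<Longrightarrow> \<exists>x\<in>Z. ph l x \<noteq> ph m x"
    and P: "finite P" "l \<in> P"
  shows "\<exists>x\<in>Z. ph l x \<noteq> 0 \<and> (\<forall>m\<in>P - {l}. ph m x = 0)"
proof -
  have "Q \<subseteq> P - {l} \<Longrightarrow> \<exists>x\<in>Z. ph l x \<noteq> 0 \<and> (\<forall>m\<in>Q. ph m x = 0)" if "finite Q" for Q
    using that
  proof (induction Q rule: finite_induct)
    case empty
    then show ?case using one P(2) by (intro bexI[of _ 1]) auto
  next
    case (insert m Q)
    then obtain x where x: "x \<in> Z" "ph l x \<noteq> 0" "\<forall>m\<in>Q. ph m x = 0" by blast
    have m: "m \<in> P" "l \<noteq> m" using insert.prems by auto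
    then obtain y where y: "y \<in> Z" "ph l y \<noteq> ph m y" using dist[OF P(2)] by blast
    obtain y' where y': "y' \<in> Z" "\<forall>k\<in>P. ph k y' = ph k y - ph m y"
      using shift[OF m(1,1) y(1)] by blast
    have "ph l (x * y') \<noteq> 0" using x y y' P(2) mult(2) by auto
    moreover have "ph k (x * y') = 0" if "k \<in> insert m Q" for k
      using that x y' m insert.prems mult(2)[of k x y'] by auto
    ultimately show ?case using mult(1)[OF x(1) y'(1)] by blast
  qed
  then show ?thesis using P(1) by blast
qed

subsection \<open>Counting conjugacy classes\<close>

definition cyc_exp :: "nat \<Rightarrow> sperm \<Rightarrow> nat \<Rightarrow> nat" where
  "cyc_exp n g = (SOME \<alpha>. top_term n \<alpha> g)"

text \<open>The conjugate of the cycle type of \<open>g\<close>: part \<open>k\<close> counts the cycles of length above \<open>k\<close>.\<close>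

definition cyc_part :: "nat \<Rightarrow> sperm \<Rightarrow> nat \<Rightarrow> nat" where
  "cyc_part n g k = (if k = 0 then n - (\<Sum>i\<in>{1..n}. cyc_exp n g i)
     else card {i \<in> {1..n}. k \<le> cyc_exp n g i})"

lemma cyc_exp: "g \<in> Sn n \<Longrightarrow> top_term n (cyc_exp n g) g"
  unfolding cyc_exp_def using top_term_exists[of g n] by (rule someI_ex)

text \<open>The left side is the number of moved points: a nontrivial cycle has one point more than
  its exponent.\<close>

lemma cyc_exp_bound:
  assumes "g \<in> Sn n"
  shows "(\<Sum>i\<in>{1..n}. cyc_exp n g i) + card {i \<in> {1..n}. 1 \<le> cyc_exp n g i} \<le> n"
proof -
  let ?a = "cyc_exp n g"
  have "(\<Sum>i\<in>{1..n}. ?a i) + card {i \<in> {1..n}. 1 \<le> ?a i} = (\<Sum>i\<in>{1..n}. ?a i + (if 1 \<le> ?a i then 1 else 0))"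
    by (simp add: sum.distrib sum.If_cases Int_def)
  also have "\<dots> = top_size n ?a" unfolding top_size_def by (intro sum.cong) auto
  also have "\<dots> = card (moved g)" using top_term_card[OF cyc_exp[OF assms]] by simp
  also have "\<dots> \<le> card {1..n}" using assms by (intro card_mono) (auto simp: Sn_iff_moved)
  finally show ?thesis by simp
qed

text \<open>The exponents are cycle lengths minus one, so \<open>n\<close> minus their sum is the
  number of all cycles, fixed points included; this is part 0. By double counting the remaining
  parts add up to the sum of the exponents.\<close>

lemma cyc_part_partition:
  assumes g: "g \<in> Sn n"
  shows "cyc_part n g \<in> partitions_of n"
proof -
  let ?a = "cyc_exp n g"
  have le: "?a i \<le> n" if "i \<in> {1..n}" for i
    using member_le_sum[of i "{1..n}" ?a] that cyc_exp_bound[OF g] by simp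
  have "cyc_part n g (Suc k) \<le> cyc_part n g k" for k
  proof (cases "k = 0")
    case True
    then show ?thesis using cyc_exp_bound[OF g] by (simp add: cyc_part_def)
  next
    case False
    then show ?thesis unfolding cyc_part_def by (simp, intro card_mono) auto
  qed
  then have anti: "antimono (cyc_part n g)"
    using lift_Suc_antimono_le[of "cyc_part n g"] by (simp add: antimono_def)
  have zero: "cyc_part n g k = 0" if "k \<notin> {0..n}" for k
  proof -
    have "{i \<in> {1..n}. k \<le> ?a i} = {}" using le that by force
    then show ?thesis using that by (simp only: cyc_part_def) simp
  qed
  have sub: "{k. cyc_part n g k \<noteq> 0} \<subseteq> {0..n}"
  proof
    fix k assume "k \<in> {k. cyc_part n g k \<noteq> 0}"
    then show "k \<in> {0..n}" using zero[of k] by (cases "k \<in> {0..n}") simp_all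
  qed
  have part: "is_partition (cyc_part n g)"
    using anti sub finite_subset[OF sub] by (simp add: is_partition_def)
  have "part_size (cyc_part n g) = (\<Sum>k\<in>{0..n}. cyc_part n g k)"
    unfolding part_size_def by (rule sum.mono_neutral_left) (use sub in auto)
  also have "\<dots> = cyc_part n g 0 + (\<Sum>k\<in>{1..n}. cyc_part n g k)"
    by (simp add: sum.atLeast_Suc_atMost)
  also have "(\<Sum>k\<in>{1..n}. cyc_part n g k) = (\<Sum>k\<in>{1..n}. \<Sum>i\<in>{1..n}. if k \<le> ?a i then 1 else 0)"
    by (intro sum.cong refl) (simp add: cyc_part_def sum.If_cases Int_def)
  also have "\<dots> = (\<Sum>i\<in>{1..n}. \<Sum>k\<in>{1..n}. if k \<le> ?a i then 1 else 0)" by (rule sum.swap)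
  also have "\<dots> = (\<Sum>i\<in>{1..n}. ?a i)"
  proof (rule sum.cong[OF refl])
    fix i assume i: "i \<in> {1..n}"
    have "{k \<in> {1..n}. k \<le> ?a i} = {1..?a i}" using le[OF i] by auto
    then show "(\<Sum>k\<in>{1..n}. if k \<le> ?a i then 1 else 0) = ?a i"
      by (simp add: sum.If_cases Int_def)
  qed
  finally have "part_size (cyc_part n g) = cyc_part n g 0 + (\<Sum>i\<in>{1..n}. ?a i)" .
  moreover have "cyc_part n g 0 = n - (\<Sum>i\<in>{1..n}. ?a i)" by (simp only: cyc_part_def refl if_True)
  ultimately have "part_size (cyc_part n g) = n" using cyc_exp_bound[OF g] by linarith
  then show ?thesis using part by (simp add: partitions_of_def)
qed

text \<open>Differences of consecutive counts \<open>k \<le> cyc_exp n g i\<close> recover how often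
  each exponent occurs, and this determines the class.\<close>

lemma cyc_part_conjugate:
  assumes g: "g \<in> Sn n" and h: "h \<in> Sn n" and eq: "cyc_part n g = cyc_part n h"
  shows "\<exists>c\<in>Sn n. h = c + g - c"
proof (rule top_term_conjugate[OF cyc_exp[OF g] cyc_exp[OF h]])
  have c: "card {i \<in> {1..n}. f i = k} + card {i \<in> {1..n}. Suc k \<le> f i} = card {i \<in> {1..n}. k \<le> f i}"
    for f :: "nat \<Rightarrow> nat" and k
    by (subst card_Un_disjoint[symmetric]) (auto intro!: arg_cong[where f = card])
  have ge: "card {i \<in> {1..n}. k \<le> cyc_exp n g i} = card {i \<in> {1..n}. k \<le> cyc_exp n h i}" for k
    using fun_cong[OF eq, of k] by (cases "k = 0") (auto simp: cyc_part_def)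
  have "card {i \<in> {1..n}. cyc_exp n g i = k} = card {i \<in> {1..n}. cyc_exp n h i = k}" for k
    using c[of "cyc_exp n g" k] c[of "cyc_exp n h" k] ge[of k] ge[of "Suc k"] by linarith
  then show "image_mset (cyc_exp n g) (mset_set {1..n}) = image_mset (cyc_exp n h) (mset_set {1..n})"
    by (intro multiset_eqI) (simp add: count_image_mset_eq_card_vimage)
qed

lemma central_cyc_part:
  assumes "central n z" "g \<in> Sn n" "h \<in> Sn n" "cyc_part n g = cyc_part n h"
  shows "lk z g = lk z h"
  using cyc_part_conjugate[OF assms(2-4)] assms(1) by (auto simp: central_iff_class_function)

lemma sum_fun_apply: "(\<Sum>a\<in>A. F a) x = (\<Sum>a\<in>A. F a x)"
  by (induction A rule: infinite_finite_induct) auto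

text \<open>In characteristic 0 different contents stay different in the field, so equal characters
  would give equal diagonal counts.\<close>

lemma om_separates:
  assumes \<mu>: "\<mu> \<in> partitions_of n" and \<nu>: "\<nu> \<in> partitions_of n" and ne: "\<mu> \<noteq> \<nu>"
  shows "\<exists>z :: 'r::field_char_0 galg. central n z \<and> om \<mu> z \<noteq> om \<nu> z"
proof (rule ccontr)
  assume "\<not> ?thesis"
  then have "\<forall>z :: 'r galg. central n z \<longrightarrow> om \<mu> z = om \<nu> z" by blast
  then have all: "\<forall>a :: 'r. card {x \<in> diagram \<mu>. of_int (box_content x) = a} =
      card {x \<in> diagram \<nu>. of_int (box_content x) = a}"
    using om_eq_iff[of \<mu> n \<nu>, where ?'r = 'r] \<mu> \<nu> by (simp add: partitions_of_def)
  have "card {x \<in> diagram \<mu>. of_int (box_content x) = (of_int c :: 'r)} =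
      card {x \<in> diagram \<nu>. of_int (box_content x) = (of_int c :: 'r)}" for c
    using all by blast
  then have "diag_count \<mu> c = diag_count \<nu> c" for c by (simp add: diag_count_def)
  then show False using diag_count_inject[of \<mu> \<nu>] \<mu> \<nu> ne by (simp add: partitions_of_def)
qed

text \<open>
  There are no more classes than partitions, so the linearly independent central characters span
  the dual of the centre.
\<close>

lemma central_eq_0:
  fixes z :: "'r::field_char_0 galg"
  assumes z: "central n z" and om0: "\<And>\<mu>. \<mu> \<in> partitions_of n \<Longrightarrow> om \<mu> z = 0"
  shows "z = 0"
proof (rule ccontr)
  assume z0: "z \<noteq> 0"
  let ?P = "partitions_of n"
  let ?Z = "{x :: 'r galg. central n x}"
  have "\<exists>x\<in>?Z. om l x \<noteq> 0 \<and> (\<forall>m\<in>?P - {l}. om m x = 0)" if l: "l \<in> ?P" for l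
  proof (rule separate[where P = ?P])
    show "\<exists>y\<in>?Z. \<forall>k\<in>?P. om k y = om k x - om l x" if "x \<in> ?Z" for x l
      using that by (intro bexI[of _ "x - Sc (om l x)"]) (auto simp: om_diff om_Sc central_diff central_Sc)
    show "\<exists>x\<in>?Z. om l x \<noteq> om m x" if "l \<in> ?P" "m \<in> ?P" "l \<noteq> m" for l m
      using om_separates[OF that, where ?'r = 'r] by blast
  qed (use l in \<open>auto simp: finite_partitions_of central_mult central_1 om_mult om_1\<close>)
  then have "\<forall>l\<in>?P. \<exists>x :: 'r galg. central n x \<and> om l x \<noteq> 0 \<and> (\<forall>m\<in>?P - {l}. om m x = 0)" by blast
  from bchoice[OF this] obtain zz where
    zz0: "\<forall>l\<in>?P. central n (zz l) \<and> om l (zz l) \<noteq> 0 \<and> (\<forall>m\<in>?P - {l}. om m (zz l) = (0 :: 'r))" by blast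
  have zz: "\<And>l. l \<in> ?P \<Longrightarrow> central n (zz l)" "\<And>l. l \<in> ?P \<Longrightarrow> om l (zz l) \<noteq> 0"
    "\<And>l m. l \<in> ?P \<Longrightarrow> m \<in> ?P \<Longrightarrow> m \<noteq> l \<Longrightarrow> om m (zz l) = (0 :: 'r)"
    using zz0 by blast+
  define V where "V = (\<lambda>l. lk (zz l)) ` ?P"
  \<comment> \<open>If \<open>z\<close> were not 0, adjoining it to \<open>V\<close> would give one
    more independent class function than there are partitions, whereas class functions are spanned
    by indicators indexed by partitions.\<close>
  define S where "S = insert (lk z) V"
  define om' where "om' = (\<lambda>\<mu> (f :: sperm \<Rightarrow> 'r). \<Sum>c\<in>Cs \<mu>. \<Sum>r\<in>Rs \<mu>. of_int (sgn_perm c) * f (c + r))"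
  have om': "om' l (lk x) = om l x" if "l \<in> ?P" for l x
    by (simp add: om'_def om_alt[OF that])
  have lin: "om' l (\<Sum>v\<in>A. (\<lambda>x. u v * v x)) = (\<Sum>v\<in>A. u v * om' l v)" for l u and A :: "(sperm \<Rightarrow> 'r) set"
  proof -
    have "om' l (\<Sum>v\<in>A. (\<lambda>x. u v * v x)) =
        (\<Sum>c\<in>Cs l. \<Sum>r\<in>Rs l. \<Sum>v\<in>A. u v * (of_int (sgn_perm c) * v (c + r)))"
      by (simp add: om'_def sum_fun_apply sum_distrib_left mult.left_commute)
    also have "\<dots> = (\<Sum>c\<in>Cs l. \<Sum>v\<in>A. \<Sum>r\<in>Rs l. u v * (of_int (sgn_perm c) * v (c + r)))"
      by (intro sum.cong refl sum.swap)
    also have "\<dots> = (\<Sum>v\<in>A. \<Sum>c\<in>Cs l. \<Sum>r\<in>Rs l. u v * (of_int (sgn_perm c) * v (c + r)))"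
      by (rule sum.swap)
    finally show ?thesis by (simp add: om'_def sum_distrib_left)
  qed
  have finS: "finite S" "finite V" using finite_partitions_of by (auto simp: S_def V_def)
  have injV: "inj_on (\<lambda>l. lk (zz l)) ?P"
  proof (rule inj_onI)
    fix l m assume lm: "l \<in> ?P" "m \<in> ?P" "lk (zz l) = lk (zz m)"
    then have "zz l = zz m" by (intro poly_mapping_eqI) simp
    then show "l = m" using zz(2)[OF lm(1)] zz(3)[OF lm(2,1)] by auto
  qed
  have zV: "lk z \<notin> V"
  proof
    assume "lk z \<in> V"
    then obtain l where "l \<in> ?P" "lk z = lk (zz l)" by (auto simp: V_def)
    then show False using zz(2)[of l] om0[of l] om'[of l z] om'[of l "zz l"] by simp
  qed
  have "fun_space.independent S"
  proof
    assume "fun_space.dependent S"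
    then obtain u where u: "\<exists>v\<in>S. u v \<noteq> 0" "(\<Sum>v\<in>S. (\<lambda>x. u v * v x)) = 0"
      unfolding fun_space.dependent_finite[OF finS(1)] by blast
    \<comment> \<open>The character of \<open>l\<close> kills \<open>z\<close> and all of
      \<open>V\<close> except \<open>lk (zz l)\<close>, and so isolates one coefficient of the
      relation.\<close>
    have uV: "u (lk (zz l)) = 0" if l: "l \<in> ?P" for l
    proof -
      have "om' l (\<Sum>v\<in>S. (\<lambda>x. u v * v x)) = 0" by (simp add: u(2) om'_def)
      then have "0 = (\<Sum>v\<in>S. u v * om' l v)" by (simp only: lin)
      also have "\<dots> = u (lk z) * om' l (lk z) + (\<Sum>v\<in>V. u v * om' l v)"
        unfolding S_def using zV finS(2) by simp
      also have "(\<Sum>v\<in>V. u v * om' l v) = (\<Sum>m\<in>?P. u (lk (zz m)) * om l (zz m))"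
        unfolding V_def using om'[OF l] by (subst sum.reindex[OF injV]) (simp add: comp_def)
      also have "\<dots> = (\<Sum>m\<in>?P. if m = l then u (lk (zz l)) * om l (zz l) else 0)"
        using zz(3) l by (intro sum.cong) auto
      also have "\<dots> = u (lk (zz l)) * om l (zz l)" using l finite_partitions_of by simp
      finally show ?thesis using zz(2)[OF l] om0[OF l] om'[OF l, of z] by simp
    qed
    have "(\<Sum>v\<in>V. (\<lambda>x. u v * v x)) = 0"
    proof (rule sum.neutral, rule ballI)
      fix v assume "v \<in> V"
      then have "u v = 0" using uV by (auto simp: V_def)
      then show "(\<lambda>x. u v * v x) = 0" by (simp add: fun_eq_iff)
    qed
    then have uz: "(\<lambda>x. u (lk z) * lk z x) = 0" using u(2) zV finS(2) by (simp add: S_def)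
    obtain g where "lk z g \<noteq> 0" using z0 by (metis poly_mapping_eqI lookup_zero)
    then have "u (lk z) = 0" using fun_cong[OF uz, of g] by simp
    then show False using u(1) uV by (auto simp: S_def V_def)
  qed
  \<comment> \<open>The indicator of the class labelled by \<open>\<kappa>\<close>; it is 0 if no
    permutation carries this label.\<close>
  define I where "I = (\<lambda>\<kappa> g. if g \<in> Sn n \<and> cyc_part n g = \<kappa> then 1 else (0 :: 'r))"
  have span: "lk x \<in> fun_space.span (I ` ?P)" if x: "central n x" for x
  proof -
    define a where "a = (\<lambda>\<kappa>. lk x (SOME g. g \<in> Sn n \<and> cyc_part n g = \<kappa>))"
    have "lk x = (\<Sum>\<kappa>\<in>?P. (\<lambda>g. a \<kappa> * I \<kappa> g))"
    proof
      fix g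
      show "lk x g = (\<Sum>\<kappa>\<in>?P. (\<lambda>g. a \<kappa> * I \<kappa> g)) g"
      proof (cases "g \<in> Sn n")
        case True
        have "\<exists>h. h \<in> Sn n \<and> cyc_part n h = cyc_part n g" using True by blast
        from someI_ex[OF this] have "a (cyc_part n g) = lk x g"
          unfolding a_def using central_cyc_part[OF x _ True] by blast
        moreover have "(\<Sum>\<kappa>\<in>?P. a \<kappa> * I \<kappa> g) = (\<Sum>\<kappa>\<in>?P. if \<kappa> = cyc_part n g then a \<kappa> else 0)"
          using True by (intro sum.cong) (auto simp: I_def)
        ultimately show ?thesis
          using cyc_part_partition[OF True] finite_partitions_of by (simp add: sum_fun_apply)
      next
        case False
        then show ?thesis using x by (simp add: sum_fun_apply I_def central_def supp_in_iff)
      qed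
    qed
    then show ?thesis by (simp only:) (intro fun_space.span_sum fun_space.span_scale fun_space.span_base imageI)
  qed
  then have "S \<subseteq> fun_space.span (I ` ?P)" using z zz(1) by (auto simp: S_def V_def)
  then have "card S \<le> card (I ` ?P)"
    using fun_space.independent_span_bound[OF _ \<open>fun_space.independent S\<close>] finite_partitions_of by blast
  also have "\<dots> \<le> card ?P" by (rule card_image_le[OF finite_partitions_of])
  also have "\<dots> < card S" using zV finS(2) card_image[OF injV] by (simp add: S_def V_def)
  finally show False by simp
qed

subsection \<open>Reduction of coefficients\<close>

definition cm :: "int galg \<Rightarrow> 'r::comm_ring_1 galg" where
  "cm = Poly_Mapping.map of_int"

lemma lk_cm [simp]: "lk (cm x) g = of_int (lk x g)"
  by (simp add: cm_def Poly_Mapping.map.rep_eq when_def)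

lemma cm_mult: "cm (x * y) = cm x * cm y"
proof (rule poly_mapping_eqI)
  fix g
  have k: "Poly_Mapping.keys (cm x :: 'a galg) \<subseteq> Poly_Mapping.keys x" by (auto simp: in_keys_iff)
  show "lk (cm (x * y)) g = lk (cm x * cm y :: 'a galg) g"
    by (simp add: lk_mult[OF order_refl finite_keys, of x y g] lk_mult[OF k finite_keys, of "cm y" g])
qed

lemma lk_Sc: "lk (Sc a) g = (if g = 0 then a else 0)"
  by (simp add: Sc_def lookup_single when_def)

lemma cm_simps: "cm (x - y) = cm x - cm y" "cm (Sc a) = Sc (of_int a)" "cm 1 = 1" "cm 0 = 0"
  by (rule poly_mapping_eqI, simp add: lookup_minus lk_Sc lookup_one when_def)+

lemma cm_prod_list: "cm (prod_list xs) = prod_list (map cm xs)"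
  by (induction xs) (simp_all add: cm_simps cm_mult)

lemma central_cm: "central n x \<Longrightarrow> central n (cm x)"
  by (auto simp: central_iff_class_function supp_in_iff)

lemma om_cm: "\<mu> \<in> partitions_of n \<Longrightarrow> om \<mu> (cm x) = of_int (om \<mu> x)"
  by (simp add: om_alt)

text \<open>
  Lifting \<open>e\<close> to the integral group ring, the product of the differences with all its central
  characters vanishes there, and reduces to a power of \<open>e\<close>.
\<close>

lemma idempotent_eq_0:
  fixes e :: "'r::comm_ring_1 galg"
  assumes e: "central n e" "e * e = e" and int: "\<And>g. lk e g \<in> range of_int"
    and om0: "\<And>\<mu>. \<mu> \<in> partitions_of n \<Longrightarrow> om \<mu> e = 0"
  shows "e = 0"
proof -
  \<comment> \<open>The value at 0 is prescribed so that the support does not grow. As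
    \<open>lift\<close> depends on the coefficient alone, \<open>z\<close> remains a class
    function.\<close>
  define lift where "lift = (\<lambda>a :: 'r. if a = 0 then 0 else SOME k. of_int k = a)"
  have lift: "of_int (lift (lk e g)) = lk e g" for g
  proof -
    obtain k where "of_int k = lk e g" using int[of g] by (metis imageE)
    then have "of_int (SOME k. of_int k = lk e g) = lk e g" by (rule someI)
    then show ?thesis by (simp add: lift_def)
  qed
  define z where "z = Poly_Mapping.map lift e"
  have lz: "lk z g = lift (lk e g)" for g
    by (simp add: z_def Poly_Mapping.map.rep_eq when_def lift_def)
  have z: "central n z" using e(1) by (auto simp: central_iff_class_function supp_in_iff lz lift_def)
  have ze: "cm z = e" by (rule poly_mapping_eqI) (simp add: lz lift)
  obtain ms where ms: "set ms = partitions_of n" using finite_list[OF finite_partitions_of] by blast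
  define y where "y = prod_list (map (\<lambda>\<mu>. z - Sc (om \<mu> z)) ms)"
  have yc: "central n y" unfolding y_def
    by (rule central_prod_list) (auto intro!: central_diff central_Sc z)
  have "om \<nu> y = 0" if \<nu>: "\<nu> \<in> partitions_of n" for \<nu>
  proof -
    have "om \<nu> y = prod_list (map (\<lambda>\<mu>. om \<nu> z - om \<mu> z) ms)"
      unfolding y_def
      by (subst om_prod_list[OF \<nu>]) (auto simp: comp_def om_diff[OF \<nu>] om_Sc[OF \<nu>] intro!: central_diff central_Sc z)
    moreover have "0 \<in> set (map (\<lambda>\<mu>. om \<nu> z - om \<mu> z) ms)" using ms \<nu> by auto
    ultimately show ?thesis by (simp add: prod_list_zero_iff)
  qed
  \<comment> \<open>Over the rationals the characters detect 0, and integers embed there, so the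
    integral element \<open>y\<close> itself vanishes.\<close>
  then have "cm y = (0 :: rat galg)" by (intro central_eq_0[of n] central_cm yc) (simp add: om_cm)
  then have "(of_int (lk y g) :: rat) = 0" for g by (metis lk_cm lookup_zero)
  then have "y = 0" by (intro poly_mapping_eqI) simp
  then have "0 = (cm y :: 'r galg)" by (simp add: cm_simps)
  also have "cm y = prod_list (map (\<lambda>\<mu>. e) ms)"
  proof -
    \<comment> \<open>The scalar \<open>om \<mu> z\<close> reduces to \<open>om \<mu> e\<close>, so
      every factor of \<open>y\<close> reduces to \<open>e\<close>.\<close>
    have "(of_int (om \<mu> z) :: 'r) = 0" if "\<mu> \<in> set ms" for \<mu>
      using om_cm[of \<mu> n z, where ?'a = 'r] om0[of \<mu>] that ms ze by simp
    then show ?thesis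
      unfolding y_def cm_prod_list map_map
      by (intro arg_cong[where f = prod_list] map_cong) (auto simp: cm_simps ze Sc_simps)
  qed
  also have "\<dots> = e ^ length ms" by (induction ms) auto
  finally have "e ^ length ms = 0" by simp
  moreover have "e ^ Suc k = e" for k by (induction k) (simp_all add: e(2))
  ultimately show ?thesis
  proof (cases "length ms")
    case 0
    then have "(1 :: 'r galg) = 0" using \<open>e ^ length ms = 0\<close> by simp
    then show ?thesis by (metis mult_1_right mult_zero_right)
  qed (metis)
qed

section \<open>Blocks and cores\<close>

lemma prime_subfield_closed:
  "0 \<in> prime_subfield" "1 \<in> prime_subfield"
  "a \<in> prime_subfield \<Longrightarrow> b \<in> prime_subfield \<Longrightarrow> a + b \<in> prime_subfield"
  "a \<in> prime_subfield \<Longrightarrow> b \<in> prime_subfield \<Longrightarrow> a - b \<in> prime_subfield"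
  "a \<in> prime_subfield \<Longrightarrow> b \<in> prime_subfield \<Longrightarrow> a * b \<in> prime_subfield"
  "of_int k \<in> prime_subfield"
proof -
  show "0 \<in> prime_subfield" "1 \<in> prime_subfield" "of_int k \<in> prime_subfield"
    unfolding prime_subfield_def by (metis of_int_0 rangeI, metis of_int_1 rangeI, rule rangeI)
  assume "a \<in> prime_subfield" "b \<in> prime_subfield"
  then obtain k l where "a = of_int k" "b = of_int l" by (auto simp: prime_subfield_def)
  then have "a + b = of_int (k + l)" "a - b = of_int (k - l)" "a * b = of_int (k * l)" by simp_all
  then show "a + b \<in> prime_subfield" "a - b \<in> prime_subfield" "a * b \<in> prime_subfield"
    unfolding prime_subfield_def by blast+
qed

lemma prime_subfield_sum: "(\<And>i. i \<in> A \<Longrightarrow> f i \<in> prime_subfield) \<Longrightarrow> sum f A \<in> prime_subfield"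
  by (induction A rule: infinite_finite_induct) (auto simp: prime_subfield_closed)

lemma finite_prime_subfield:
  assumes "CHAR('f::field) > 0" shows "finite (prime_subfield :: 'f set)"
proof -
  have "(of_int k :: 'f) \<in> of_int ` {0..<int CHAR('f)}" for k
  proof -
    have "int CHAR('f) dvd k - k mod int CHAR('f)" by simp
    then have "(of_int (k - k mod int CHAR('f)) :: 'f) = 0" by (simp only: of_int_eq_0_iff_char_dvd)
    then have "(of_int k :: 'f) = of_int (k mod int CHAR('f))" by simp
    moreover have "k mod int CHAR('f) \<in> {0..<int CHAR('f)}" using assms by simp
    ultimately show ?thesis by blast
  qed
  then have "(prime_subfield :: 'f set) \<subseteq> of_int ` {0..<int CHAR('f)}" by (auto simp: prime_subfield_def)
  then show ?thesis by (rule finite_subset) simp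
qed

section \<open>The centre over the prime subfield\<close>

definition Zp :: "nat \<Rightarrow> 'f::field galg set" where
  "Zp n = {x. central n x \<and> (\<forall>g. lk x g \<in> prime_subfield)}"

lemma Zp_central: "x \<in> Zp n \<Longrightarrow> central n x"
  by (simp add: Zp_def)

lemma Zp_closed: "x \<in> Zp n \<Longrightarrow> y \<in> Zp n \<Longrightarrow> x - y \<in> Zp n" "x \<in> Zp n \<Longrightarrow> y \<in> Zp n \<Longrightarrow> x * y \<in> Zp n"
  "1 \<in> Zp n" "0 \<in> Zp n" "a \<in> prime_subfield \<Longrightarrow> Sc a \<in> Zp n"
proof -
  show "x - y \<in> Zp n" if "x \<in> Zp n" "y \<in> Zp n"
    using that by (auto simp: Zp_def central_diff lookup_minus prime_subfield_closed)
  show "x * y \<in> Zp n" if xy: "x \<in> Zp n" "y \<in> Zp n"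
  proof -
    have "Poly_Mapping.keys x \<subseteq> Sn n" using xy(1) by (auto simp: Zp_def central_def supp_in_def)
    then have "lk (x * y) g \<in> prime_subfield" for g
      unfolding lk_mult[OF \<open>Poly_Mapping.keys x \<subseteq> Sn n\<close> finite_Sn]
      using xy by (intro prime_subfield_sum prime_subfield_closed) (auto simp: Zp_def)
    then show ?thesis using xy by (auto simp: Zp_def central_mult)
  qed
  show "1 \<in> Zp n" "0 \<in> Zp n" by (auto simp: Zp_def central_1 central_0 lookup_one when_def prime_subfield_closed)
  show "Sc a \<in> Zp n" if "a \<in> prime_subfield" using that by (auto simp: Zp_def central_Sc lk_Sc prime_subfield_closed)
qed

lemma Zp_power: "x \<in> Zp n \<Longrightarrow> x ^ k \<in> Zp n"
  by (induction k) (auto simp: Zp_closed)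

lemma om_prime_subfield: "\<mu> \<in> partitions_of n \<Longrightarrow> x \<in> Zp n \<Longrightarrow> om \<mu> x \<in> prime_subfield"
  unfolding om_alt by (intro prime_subfield_sum prime_subfield_closed) (auto simp: Zp_def)

lemma finite_Zp:
  assumes "CHAR('f::field) > 0" shows "finite (Zp n :: 'f galg set)"
proof -
  let ?F = "{f. \<forall>g. (g \<in> Sn n \<longrightarrow> f g \<in> (prime_subfield :: 'f set)) \<and> (g \<notin> Sn n \<longrightarrow> f g = 0)}"
  have "finite ?F" by (rule finite_set_of_finite_funs[OF finite_Sn finite_prime_subfield[OF assms]])
  moreover have "lk ` (Zp n :: 'f galg set) \<subseteq> ?F" by (auto simp: Zp_def central_def supp_in_iff)
  ultimately have "finite (lk ` (Zp n :: 'f galg set))" by (rule rev_finite_subset)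
  then show ?thesis by (rule finite_imageD) (auto intro!: inj_onI poly_mapping_eqI)
qed

text \<open>A central element is a combination of the indicators of the level sets of its
  coefficients. These are class functions with values 0 and 1, hence in \<open>Zp n\<close>.\<close>

lemma om_eq_on_Zp:
  fixes z :: "'f::field galg"
  assumes \<mu>: "\<mu> \<in> partitions_of n" and \<nu>: "\<nu> \<in> partitions_of n"
    and eq: "\<And>x :: 'f galg. x \<in> Zp n \<Longrightarrow> om \<mu> x = om \<nu> x" and z: "central n z"
  shows "om \<mu> z = om \<nu> z"
proof -
  define I where "I = (\<lambda>a. Poly_Mapping.map (\<lambda>b. if b = a \<and> a \<noteq> 0 then 1 else 0 :: 'f) z)"
  have lI: "lk (I a) g = (if lk z g = a \<and> a \<noteq> 0 then 1 else 0)" for a g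
    by (auto simp: I_def Poly_Mapping.map.rep_eq when_def)
  have I: "I a \<in> Zp n" for a
    using z by (auto simp: Zp_def central_iff_class_function supp_in_iff lI prime_subfield_closed)
  have z_eq: "z = (\<Sum>a\<in>lk z ` Sn n. Sc a * I a)"
  proof (rule poly_mapping_eqI)
    fix g
    have "lk (\<Sum>a\<in>lk z ` Sn n. Sc a * I a) g = (\<Sum>a\<in>lk z ` Sn n. if a = lk z g then lk z g else 0)"
      unfolding lookup_sum by (intro sum.cong refl) (auto simp: lI)
    also have "\<dots> = lk z g" using z by (auto simp: central_def supp_in_iff)
    finally show "lk z g = lk (\<Sum>a\<in>lk z ` Sn n. Sc a * I a) g" by simp
  qed
  have "om \<kappa> z = (\<Sum>a\<in>lk z ` Sn n. a * om \<kappa> (I a))" if "\<kappa> \<in> partitions_of n" for \<kappa>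
    using arg_cong[OF z_eq, of "om \<kappa>"] by (simp only: om_sum[OF that] om_Sc_mult[OF that])
  then show ?thesis using eq[OF I] \<mu> \<nu> by simp
qed

lemma om_eq_iff_core:
  assumes \<mu>: "\<mu> \<in> partitions_of n" and \<nu>: "\<nu> \<in> partitions_of n"
    and p: "prime p" "CHAR('f::field) = p"
  shows "(\<forall>z\<in>Zp n :: 'f galg set. om \<mu> z = om \<nu> z) \<longleftrightarrow> core_of p \<mu> = core_of p \<nu>"
proof -
  have p0: "p > 0" using p(1) by (rule prime_gt_0_nat)
  have parts: "is_partition \<mu>" "part_size \<mu> = n" "is_partition \<nu>" "part_size \<nu> = n"
    using \<mu> \<nu> by (auto simp: partitions_of_def)
  have "(\<forall>z\<in>Zp n :: 'f galg set. om \<mu> z = om \<nu> z) \<longleftrightarrow> (\<forall>z :: 'f galg. central n z \<longrightarrow> om \<mu> z = om \<nu> z)"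
    using om_eq_on_Zp[OF \<mu> \<nu>] Zp_central by blast
  also have "\<dots> \<longleftrightarrow> (\<forall>a :: 'f. card {x \<in> diagram \<mu>. of_int (box_content x) = a} =
      card {x \<in> diagram \<nu>. of_int (box_content x) = a})"
    by (rule om_eq_iff[OF parts])
  also have "\<dots> \<longleftrightarrow> (\<forall>r. residue_count p \<mu> r = residue_count p \<nu> r)"
  proof -
    have "(of_int c :: 'f) = of_int r \<longleftrightarrow> int p dvd c - r" for c r
    proof -
      have "(of_int c :: 'f) = of_int r \<longleftrightarrow> (of_int (c - r) :: 'f) = 0" by simp
      also have "\<dots> \<longleftrightarrow> int p dvd c - r" by (simp only: of_int_eq_0_iff_char_dvd p(2))
      finally show ?thesis .
    qed
    then have rc: "residue_count p \<kappa> r = card {x \<in> diagram \<kappa>. (of_int (box_content x) :: 'f) = of_int r}" for \<kappa> r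
      by (simp add: residue_count_def)
    show ?thesis
    proof
      assume "\<forall>a :: 'f. card {x \<in> diagram \<mu>. of_int (box_content x) = a} =
        card {x \<in> diagram \<nu>. of_int (box_content x) = a}"
      then show "\<forall>r. residue_count p \<mu> r = residue_count p \<nu> r" unfolding rc by blast
    next
      assume r: "\<forall>r. residue_count p \<mu> r = residue_count p \<nu> r"
      show "\<forall>a :: 'f. card {x \<in> diagram \<mu>. of_int (box_content x) = a} =
        card {x \<in> diagram \<nu>. of_int (box_content x) = a}"
      proof
        fix a :: 'f
        show "card {x \<in> diagram \<mu>. of_int (box_content x) = a} = card {x \<in> diagram \<nu>. of_int (box_content x) = a}"
        proof (cases "a \<in> range of_int")
          case True
          then show ?thesis using r unfolding rc by auto
        next
          \<comment> \<open>The contents lie in the prime subfield, so no box of either diagram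
            takes the value \<open>a\<close>.\<close>
          case False
          then have "{x \<in> diagram \<kappa>. of_int (box_content x) = a} = {}" for \<kappa> by blast
          then show ?thesis by (simp only:)
        qed
      qed
    qed
  qed
  also have "\<dots> \<longleftrightarrow> core_of p \<mu> = core_of p \<nu>"
    using core_of_eq_iff[OF parts(1,3) p0] parts by simp
  finally show ?thesis .
qed

text \<open>By the pigeonhole principle the powers become periodic, from \<open>i\<close> on with
  period \<open>d\<close>. The exponent \<open>i * d\<close> is late enough and a multiple of the
  period, so doubling it changes nothing.\<close>

lemma idempotent_power:
  fixes x :: "'a::monoid_mult"
  assumes fin: "finite (range (\<lambda>k. x ^ k))"
  shows "\<exists>N\<ge>1. x ^ N * x ^ N = x ^ N"
proof -
  have "\<not> inj (\<lambda>k. x ^ Suc k)"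
  proof
    assume "inj (\<lambda>k. x ^ Suc k)"
    then have "infinite (range (\<lambda>k. x ^ Suc k))" by (rule range_inj_infinite)
    moreover have "range (\<lambda>k. x ^ Suc k) \<subseteq> range (\<lambda>k. x ^ k)" by blast
    ultimately show False using fin finite_subset by blast
  qed
  then obtain a b where ab: "x ^ Suc a = x ^ Suc b" "a < b"
    unfolding inj_def by (metis linorder_neqE_nat)
  define i where "i = Suc a"
  define d where "d = b - a"
  have d: "d \<ge> 1" "x ^ i = x ^ (i + d)" using ab by (auto simp: i_def d_def)
  have step: "x ^ (m + d) = x ^ m" if im: "i \<le> m" for m
  proof -
    obtain k where k: "m = k + i" using im by (metis le_add_diff_inverse2)
    have "x ^ (m + d) = x ^ k * x ^ (i + d)" by (simp only: k add.assoc power_add)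
    then show ?thesis unfolding k power_add[of x k i] d(2)[symmetric] .
  qed
  have mult: "x ^ (m + k * d) = x ^ m" if "i \<le> m" for m k
  proof (induction k)
    case (Suc k)
    have e: "m + Suc k * d = (m + k * d) + d" by simp
    show ?case unfolding e using step[of "m + k * d"] Suc that by auto
  qed simp
  have "i \<le> i * d" using d(1) by simp
  then have "x ^ (i * d) * x ^ (i * d) = x ^ (i * d)"
    using mult[of "i * d" i] by (simp add: power_add)
  moreover have "i * d \<ge> 1" using d(1) by (simp add: i_def)
  ultimately show ?thesis by blast
qed

lemma idempotent_om:
  fixes e :: "'f::field galg"
  assumes "\<mu> \<in> partitions_of n" "e \<in> Zp n" "e * e = e"
  shows "om \<mu> e = 0 \<or> om \<mu> e = 1"
proof -
  have "om \<mu> e * om \<mu> e = om \<mu> e" using om_mult[OF assms(1) Zp_central Zp_central, OF assms(2,2)] assms(3) by simp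
  then show ?thesis by simp
qed

text \<open>An element of the finite ring \<open>Zp n\<close> whose characters vanish at all cores
  but \<open>\<gamma>\<close> has an idempotent power; there a nonzero value can only have become
  1.\<close>

lemma core_idempotent:
  assumes p: "prime p" "CHAR('f::field) = p" and \<gamma>: "\<gamma> \<in> core_of p ` partitions_of n"
  shows "\<exists>e\<in>Zp n :: 'f galg set. e * e = e \<and>
    (\<forall>\<mu>\<in>partitions_of n. om \<mu> e = (if core_of p \<mu> = \<gamma> then 1 else 0))"
proof -
  let ?L = "core_of p ` partitions_of n"
  let ?Z = "Zp n :: 'f galg set"
  \<comment> \<open>Partitions with the same core have the same character on \<open>Zp n\<close>, so
    separation is possible only with one representative for each core.\<close>
  define rep where "rep = (\<lambda>\<gamma>. SOME \<mu>. \<mu> \<in> partitions_of n \<and> core_of p \<mu> = \<gamma>)"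
  have rep: "rep \<delta> \<in> partitions_of n" "core_of p (rep \<delta>) = \<delta>" if "\<delta> \<in> ?L" for \<delta>
  proof -
    have "\<exists>\<mu>. \<mu> \<in> partitions_of n \<and> core_of p \<mu> = \<delta>" using that by blast
    from someI_ex[OF this] show "rep \<delta> \<in> partitions_of n" "core_of p (rep \<delta>) = \<delta>" by (simp_all add: rep_def)
  qed
  have "\<exists>x\<in>?Z. om (rep \<gamma>) x \<noteq> 0 \<and> (\<forall>m\<in>?L - {\<gamma>}. om (rep m) x = 0)"
  proof (rule separate[where P = ?L and Z = ?Z and ph = "\<lambda>\<delta>. om (rep \<delta>)"])
    show "\<exists>y\<in>?Z. \<forall>k\<in>?L. om (rep k) y = om (rep k) x - om (rep l) x" if "l \<in> ?L" "x \<in> ?Z" for x l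
      using that(2) om_prime_subfield[OF rep(1)[OF that(1)] that(2)]
      by (intro bexI[of _ "x - Sc (om (rep l) x)"] ballI Zp_closed)
        (auto simp: om_diff[OF rep(1)] om_Sc[OF rep(1)])
    show "\<exists>x\<in>?Z. om (rep l) x \<noteq> om (rep m) x" if "l \<in> ?L" "m \<in> ?L" "l \<noteq> m" for l m
      using om_eq_iff_core[OF rep(1)[OF that(1)] rep(1)[OF that(2)] p] rep(2) that by metis
    show "om (rep l) (x * y) = om (rep l) x * om (rep l) y" if "l \<in> ?L" "x \<in> ?Z" "y \<in> ?Z" for l x y
      using that om_mult[OF rep(1)] Zp_central by blast
    show "om (rep l) (1 :: 'f galg) = 1" if "l \<in> ?L" for l using om_1[OF rep(1)[OF that]] .
  qed (use \<gamma> in \<open>auto simp: finite_partitions_of Zp_closed\<close>)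
  then obtain x where x: "x \<in> ?Z" "om (rep \<gamma>) x \<noteq> 0" "\<And>m. m \<in> ?L \<Longrightarrow> m \<noteq> \<gamma> \<Longrightarrow> om (rep m) x = 0" by blast
  have "range (\<lambda>k. x ^ k) \<subseteq> ?Z" using Zp_power[OF x(1)] by blast
  moreover have "finite ?Z" by (rule finite_Zp) (use p prime_gt_0_nat in simp)
  ultimately have "finite (range (\<lambda>k. x ^ k))" by (rule finite_subset)
  then obtain N where N: "N \<ge> 1" "x ^ N * x ^ N = x ^ N" using idempotent_power by blast
  have "om \<mu> (x ^ N) = (if core_of p \<mu> = \<gamma> then 1 else 0)" if \<mu>: "\<mu> \<in> partitions_of n" for \<mu>
  proof -
    let ?r = "rep (core_of p \<mu>)"
    have r: "?r \<in> partitions_of n" "core_of p ?r = core_of p \<mu>" using rep[of "core_of p \<mu>"] \<mu> by auto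
    have "om \<mu> x = om ?r x" using om_eq_iff_core[OF \<mu> r(1) p] r(2) x(1) by simp
    then have e: "om \<mu> (x ^ N) = om ?r x ^ N" using om_power[OF \<mu> Zp_central[OF x(1)]] by simp
    show ?thesis
    proof (cases "core_of p \<mu> = \<gamma>")
      case True
      then have "om \<mu> (x ^ N) \<noteq> 0" using e x(2) by simp
      then show ?thesis using True idempotent_om[OF \<mu> Zp_power[OF x(1)] N(2)] by simp
    next
      case False
      then show ?thesis using e x(3)[of "core_of p \<mu>"] \<mu> N(1) by simp
    qed
  qed
  then show ?thesis using Zp_power[OF x(1)] N(2) by blast
qed

section \<open>Primitive central idempotents\<close>

definition prim :: "nat \<Rightarrow> 'f::field galg \<Rightarrow> bool" where
  "prim n e \<longleftrightarrow> e \<in> Zp n \<and> e * e = e \<and> e \<noteq> 0 \<and>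
    \<not> (\<exists>e1\<in>Zp n. \<exists>e2\<in>Zp n. e1 * e1 = e1 \<and> e2 * e2 = e2 \<and> e1 \<noteq> 0 \<and> e2 \<noteq> 0 \<and>
      e1 * e2 = 0 \<and> e2 * e1 = 0 \<and> e = e1 + e2)"

lemma idempotent_om_nonzero:
  fixes e :: "'f::field galg"
  assumes "e \<in> Zp n" "e * e = e" "e \<noteq> 0"
  shows "\<exists>\<mu>\<in>partitions_of n. om \<mu> e = 1"
proof (rule ccontr)
  assume "\<not> ?thesis"
  then have "\<And>\<mu>. \<mu> \<in> partitions_of n \<Longrightarrow> om \<mu> e = 0" using idempotent_om[OF _ assms(1,2)] by blast
  then have "e = 0" using assms by (intro idempotent_eq_0[of n]) (auto simp: Zp_def prime_subfield_def)
  then show False using assms(3) by simp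
qed

lemma Zp_commute:
  assumes "x \<in> Zp n" "y \<in> Zp n" shows "x * y = y * (x :: 'f::field galg)"
  using central_commute[OF Zp_central[OF assms(1)]] Zp_central[OF assms(2)] by (simp add: central_def)

text \<open>Otherwise \<open>a = a * b + (a - a * b)\<close> would split \<open>a\<close> into two
  nonzero orthogonal idempotents.\<close>

lemma prim_absorbs:
  fixes a b :: "'f::field galg"
  assumes a: "prim n a" and b: "b \<in> Zp n" "b * b = b" and ne: "a * b \<noteq> 0"
  shows "a = a * b"
proof (rule ccontr)
  assume "a \<noteq> a * b"
  then have ne2: "a - a * b \<noteq> 0" by simp
  have aZ: "a \<in> Zp n" "a * a = a" using a by (auto simp: prim_def)
  have comm: "b * a = a * b" using Zp_commute[OF b(1) aZ(1)] .
  have ab: "a * b * (a * b) = a * b" by (metis aZ(2) b(2) comm mult.assoc)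
  have aab: "a * (a * b) = a * b" by (simp add: aZ(2) flip: mult.assoc)
  have aba: "a * b * a = a * b" by (simp add: mult.assoc comm) (simp add: aab)
  have "(a - a * b) * (a - a * b) = a - a * b" "a * b * (a - a * b) = 0" "(a - a * b) * (a * b) = 0"
    by (simp_all only: left_diff_distrib right_diff_distrib ab aab aba aZ(2)) simp_all
  moreover have "a = a * b + (a - a * b)" by simp
  moreover have "a * b \<in> Zp n" "a - a * b \<in> Zp n" using aZ b by (auto intro!: Zp_closed)
  ultimately show False using a ab ne ne2 unfolding prim_def by blast
qed

text \<open>In a splitting of \<open>e \<gamma>\<close> each summand has character 1 at some
  partition with core \<open>\<gamma>\<close>. Characters with equal core coincide on
  \<open>Zp n\<close>, so both summands would have value 1 there although their product is 0.
  Conversely a primitive \<open>x\<close> has value 1 somewhere, so its product with the idempotent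
  of that core is nonzero and each absorbs the other.\<close>

lemma prim_cores:
  fixes e :: "(nat \<Rightarrow> nat) \<Rightarrow> 'f::field galg"
  assumes p: "prime p" "CHAR('f) = p"
    and e: "\<And>\<gamma>. \<gamma> \<in> core_of p ` partitions_of n \<Longrightarrow> e \<gamma> \<in> Zp n \<and> e \<gamma> * e \<gamma> = e \<gamma> \<and>
    (\<forall>\<mu>\<in>partitions_of n. om \<mu> (e \<gamma>) = (if core_of p \<mu> = \<gamma> then 1 else 0))"
  shows "bij_betw e (core_of p ` partitions_of n) {x. prim n x}"
proof -
  let ?L = "core_of p ` partitions_of n"
  have om_e: "om \<mu> (e \<gamma>) = (if core_of p \<mu> = \<gamma> then 1 else 0)"
    if "\<gamma> \<in> ?L" "\<mu> \<in> partitions_of n" for \<mu> \<gamma> using e that by blast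
  have inj: "inj_on e ?L"
  proof (rule inj_onI)
    fix \<gamma> \<delta> assume *: "\<gamma> \<in> ?L" "\<delta> \<in> ?L" "e \<gamma> = e \<delta>"
    obtain \<mu> where "\<mu> \<in> partitions_of n" "core_of p \<mu> = \<gamma>" using *(1) by blast
    then show "\<gamma> = \<delta>" using om_e[OF *(1), of \<mu>] om_e[OF *(2), of \<mu>] *(3) by (auto split: if_splits)
  qed
  have prim_e: "prim n (e \<gamma>)" if \<gamma>: "\<gamma> \<in> ?L" for \<gamma>
  proof -
    obtain \<mu> where \<mu>: "\<mu> \<in> partitions_of n" "core_of p \<mu> = \<gamma>" using \<gamma> by blast
    have "om \<mu> (0 :: 'f galg) = 0" by (rule om_0[OF \<mu>(1)])
    then have "e \<gamma> \<noteq> 0" using om_e[OF \<gamma> \<mu>(1)] \<mu>(2) by auto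
    moreover have False
      if d: "e1 \<in> Zp n" "e2 \<in> Zp n" "e1 * e1 = e1" "e2 * e2 = e2" "e1 \<noteq> 0" "e2 \<noteq> 0" "e1 * e2 = 0" "e \<gamma> = e1 + e2"
      for e1 e2
    proof -
      have z: "om \<nu> (0 :: 'f galg) = 0" if "\<nu> \<in> partitions_of n" for \<nu> by (rule om_0[OF that])
      have sum: "om \<nu> e1 + om \<nu> e2 = om \<nu> (e \<gamma>)" "om \<nu> e1 * om \<nu> e2 = 0" if \<nu>: "\<nu> \<in> partitions_of n" for \<nu>
        using om_add[OF \<nu>, of e1 e2] om_mult[OF \<nu> Zp_central[OF d(1)] Zp_central[OF d(2)]]
          z[OF \<nu>] d(7,8) by simp_all
      have one: "core_of p \<nu> = \<gamma>" if \<nu>: "\<nu> \<in> partitions_of n" "om \<nu> e1 = 1 \<or> om \<nu> e2 = 1" for \<nu>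
      proof (rule ccontr)
        assume "core_of p \<nu> \<noteq> \<gamma>"
        then have "om \<nu> e1 + om \<nu> e2 = 0" using sum(1)[OF \<nu>(1)] om_e[OF \<gamma> \<nu>(1)] by simp
        then show False using sum(2)[OF \<nu>(1)] \<nu>(2) by auto
      qed
      obtain \<nu>1 where \<nu>1: "\<nu>1 \<in> partitions_of n" "om \<nu>1 e1 = 1" using idempotent_om_nonzero[OF d(1,3,5)] by blast
      obtain \<nu>2 where \<nu>2: "\<nu>2 \<in> partitions_of n" "om \<nu>2 e2 = 1" using idempotent_om_nonzero[OF d(2,4,6)] by blast
      have "core_of p \<nu>1 = core_of p \<nu>2" using one[OF \<nu>1(1)] one[OF \<nu>2(1)] \<nu>1(2) \<nu>2(2) by simp
      then have "om \<nu>1 e1 = om \<nu>2 e1" using om_eq_iff_core[OF \<nu>1(1) \<nu>2(1) p] d(1) by blast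
      then show False using sum(2)[OF \<nu>2(1)] \<nu>1(2) \<nu>2(2) by simp
    qed
    ultimately show ?thesis using e[OF \<gamma>] unfolding prim_def by blast
  qed
  have "x \<in> e ` ?L" if x: "prim n x" for x
  proof -
    have xZ: "x \<in> Zp n" "x * x = x" "x \<noteq> 0" using x by (auto simp: prim_def)
    obtain \<mu> where \<mu>: "\<mu> \<in> partitions_of n" "om \<mu> x = 1" using idempotent_om_nonzero[OF xZ] by blast
    define \<gamma> where "\<gamma> = core_of p \<mu>"
    have \<gamma>: "\<gamma> \<in> ?L" using \<mu>(1) by (simp add: \<gamma>_def)
    have eZ: "e \<gamma> \<in> Zp n" "e \<gamma> * e \<gamma> = e \<gamma>" using e[OF \<gamma>] by auto
    have "om \<mu> (x * e \<gamma>) = 1"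
      using om_mult[OF \<mu>(1) Zp_central[OF xZ(1)] Zp_central[OF eZ(1)]] \<mu>(2) om_e[OF \<gamma> \<mu>(1)] by (simp add: \<gamma>_def)
    moreover have "om \<mu> (0 :: 'f galg) = 0" by (rule om_0[OF \<mu>(1)])
    ultimately have ne: "x * e \<gamma> \<noteq> 0" by auto
    have "x = x * e \<gamma>" by (rule prim_absorbs[OF x eZ ne])
    also have "\<dots> = e \<gamma>"
      using prim_absorbs[OF prim_e[OF \<gamma>] xZ(1,2)] ne Zp_commute[OF xZ(1) eZ(1)] by simp
    finally show ?thesis using \<gamma> by blast
  qed
  then show ?thesis using inj prim_e by (auto simp: bij_betw_def)
qed

subsection \<open>Translation to functions on the symmetric group\<close>

text \<open>Passes from convolutions on \<open>sperm\<close> to functions on all maps, as in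
  \<open>group_algebra\<close>. \<open>Abs_sperm\<close> has a specified value only at permutations,
  hence the case distinction.\<close>

definition to_fun :: "nat \<Rightarrow> 'f::zero galg \<Rightarrow> (nat \<Rightarrow> nat) \<Rightarrow> 'f" where
  "to_fun n x = (\<lambda>f. if f permutes {1..n} then lk x (Abs_sperm f) else 0)"

lemma to_fun_ap [simp]: "g \<in> Sn n \<Longrightarrow> to_fun n x (ap g) = lk x g"
  by (simp add: to_fun_def Sn_def ap_inverse)

lemma permutes_obtain_ap:
  assumes "f permutes {1..n}" obtains g where "g \<in> Sn n" "f = ap g"
  using assms bij_betw_imp_surj_on[OF bij_betw_ap_Sn[of n]] by (metis image_iff mem_Collect_eq)

lemma to_fun_inject:
  assumes "supp_in n x" "supp_in n y" "to_fun n x = to_fun n y"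
  shows "x = y"
proof (rule poly_mapping_eqI)
  fix g
  have "to_fun n x (ap g) = to_fun n y (ap g)" by (simp only: assms(3))
  then show "lk x g = lk y g"
    using assms(1,2) by (cases "g \<in> Sn n") (auto simp: supp_in_iff)
qed

lemma to_fun_surj:
  assumes "\<And>f. \<not> f permutes {1..n} \<Longrightarrow> a f = 0"
  shows "\<exists>x. supp_in n x \<and> to_fun n x = a \<and> (\<forall>g. lk x g = a (ap g))"
proof -
  have "finite {g. a (ap g) \<noteq> 0}"
    by (rule finite_subset[OF _ finite_Sn[of n]]) (use assms in \<open>auto simp: Sn_def\<close>)
  then have l: "lk (Abs_poly_mapping (\<lambda>g. a (ap g))) g = a (ap g)" for g by simp
  have "to_fun n (Abs_poly_mapping (\<lambda>g. a (ap g))) = a"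
  proof
    fix f show "to_fun n (Abs_poly_mapping (\<lambda>g. a (ap g))) f = a f"
    proof (cases "f permutes {1..n}")
      case True
      then obtain g where "g \<in> Sn n" "f = ap g" by (rule permutes_obtain_ap)
      then show ?thesis using l by simp
    next
      case False
      then show ?thesis using assms by (simp add: to_fun_def)
    qed
  qed
  moreover have "supp_in n (Abs_poly_mapping (\<lambda>g. a (ap g)))"
    unfolding supp_in_iff l using assms by (auto simp: Sn_def)
  ultimately show ?thesis using l by blast
qed

lemma sum_permutes: "(\<Sum>f | f permutes {1..n}. F f) = (\<Sum>g\<in>Sn n. F (ap g))"
  using sum.reindex_bij_betw[OF bij_betw_ap_Sn, of F n] by simp

abbreviation galgebra :: "nat \<Rightarrow> ((nat \<Rightarrow> nat) \<Rightarrow> 'f::field) ring" where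
  "galgebra n \<equiv> group_algebra prime_subfield (sym_group n)"

lemma carrier_sym_group: "carrier (sym_group n) = {f. f permutes {1..n}}"
  by (simp add: sym_group_def)

lemma galgebra_mult:
  assumes "supp_in n x"
  shows "to_fun n x \<otimes>\<^bsub>galgebra n\<^esub> to_fun n y = to_fun n (x * y)"
proof
  fix f
  show "(to_fun n x \<otimes>\<^bsub>galgebra n\<^esub> to_fun n y) f = to_fun n (x * y) f"
  proof (cases "f permutes {1..n}")
    case True
    then obtain g where g: "g \<in> Sn n" "f = ap g" by (rule permutes_obtain_ap)
    have "(to_fun n x \<otimes>\<^bsub>galgebra n\<^esub> to_fun n y) f =
      (\<Sum>h | h permutes {1..n}. to_fun n x h * to_fun n y (inv' h \<circ> f))"
      using True by (simp add: group_algebra_def carrier_sym_group sym_group_mult inv_sym_group)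
    also have "\<dots> = (\<Sum>h\<in>Sn n. lk x h * lk y (- h + g))"
      unfolding sum_permutes
    proof (rule sum.cong[OF refl])
      fix h assume h: "h \<in> Sn n"
      have "inv' (ap h) \<circ> f = ap (- h + g)" by (auto simp: g(2) ap_uminus)
      then show "to_fun n x (ap h) * to_fun n y (inv' (ap h) \<circ> f) = lk x h * lk y (- h + g)"
        using h g(1) Sn_closed by simp
    qed
    also have "\<dots> = lk (x * y) g" using lk_mult[of x "Sn n" y g] assms by (simp add: supp_in_def)
    finally show ?thesis using g by simp
  next
    case False
    then show ?thesis by (simp add: group_algebra_def carrier_sym_group to_fun_def)
  qed
qed

lemma galgebra_carrier:
  "carrier (galgebra n) = to_fun n ` {x :: 'f::field galg. supp_in n x \<and> (\<forall>g. lk x g \<in> prime_subfield)}"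
  (is "_ = to_fun n ` ?K")
proof (intro equalityI subsetI)
  fix a :: "(nat \<Rightarrow> nat) \<Rightarrow> 'f" assume "a \<in> carrier (galgebra n)"
  then have a: "\<And>f. a f \<in> prime_subfield" "\<And>f. \<not> f permutes {1..n} \<Longrightarrow> a f = 0"
    by (auto simp: group_algebra_def carrier_sym_group)
  obtain x where "supp_in n x" "to_fun n x = a" "\<forall>g. lk x g = a (ap g)" using to_fun_surj[of n a] a(2) by blast
  then show "a \<in> to_fun n ` ?K" using a(1) by (intro image_eqI[of _ _ x]) auto
next
  fix a :: "(nat \<Rightarrow> nat) \<Rightarrow> 'f" assume "a \<in> to_fun n ` ?K"
  then show "a \<in> carrier (galgebra n)"
    by (auto simp: group_algebra_def carrier_sym_group to_fun_def prime_subfield_closed)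
qed

lemma centre_carrier: "carrier (ring_centre (galgebra n)) = to_fun n ` (Zp n :: 'f::field galg set)"
proof -
  let ?K = "{x :: 'f galg. supp_in n x \<and> (\<forall>g. lk x g \<in> prime_subfield)}"
  have "(\<forall>y\<in>carrier (galgebra n). to_fun n x \<otimes>\<^bsub>galgebra n\<^esub> y = y \<otimes>\<^bsub>galgebra n\<^esub> to_fun n x) \<longleftrightarrow> central n x"
    if x: "x \<in> ?K" for x
  proof
    assume c: "\<forall>y\<in>carrier (galgebra n). to_fun n x \<otimes>\<^bsub>galgebra n\<^esub> y = y \<otimes>\<^bsub>galgebra n\<^esub> to_fun n x"
    show "central n x"
    proof (rule centralI)
      fix g assume g: "g \<in> Sn n"
      have U: "U g \<in> ?K" using g by (auto simp: supp_in_U lk_U prime_subfield_closed)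
      then have "to_fun n (x * U g) = to_fun n (U g * x)"
        using c x by (simp add: galgebra_carrier galgebra_mult)
      then show "U g * x = x * U g"
        using x U by (intro to_fun_inject[of n]) (simp_all add: supp_in_mult)
    qed (use x in simp)
  next
    assume "central n x"
    then show "\<forall>y\<in>carrier (galgebra n). to_fun n x \<otimes>\<^bsub>galgebra n\<^esub> y = y \<otimes>\<^bsub>galgebra n\<^esub> to_fun n x"
      using x central_commute[of n x] by (auto simp: galgebra_carrier galgebra_mult)
  qed
  then show ?thesis
    by (auto simp: ring_centre_def galgebra_carrier Zp_def central_def[of n] intro!: image_eqI)
qed

lemma to_fun_add: "to_fun n (x + y) = to_fun n x + to_fun n y" and to_fun_0: "to_fun n 0 = 0"
  by (auto simp: to_fun_def lookup_add fun_eq_iff)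

lemma Zp_to_fun_inject: "x \<in> Zp n \<Longrightarrow> y \<in> Zp n \<Longrightarrow> to_fun n x = to_fun n y \<longleftrightarrow> x = y"
  using to_fun_inject[of n x y] by (auto simp: Zp_def central_def)

text \<open>\<open>to_fun n\<close> is injective on \<open>Zp n\<close>, maps it onto the centre and
  respects sums and products, so a splitting on one side is a splitting on the other.\<close>

lemma blocks_sym_group: "blocks (sym_group n) = to_fun n ` {x :: 'f::field galg. prim n x}"
proof -
  let ?C = "ring_centre (galgebra n) :: ((nat \<Rightarrow> nat) \<Rightarrow> 'f) ring"
  have ops: "\<zero>\<^bsub>?C\<^esub> = 0" "x \<oplus>\<^bsub>?C\<^esub> y = x + y" "x \<otimes>\<^bsub>?C\<^esub> y = x \<otimes>\<^bsub>galgebra n\<^esub> y" for x y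
    by (simp_all add: ring_centre_def group_algebra_def)
  have mult: "to_fun n x \<otimes>\<^bsub>?C\<^esub> to_fun n y = to_fun n (x * y)" if "x \<in> Zp n" for x y
    using that by (simp add: ops galgebra_mult Zp_def central_def)
  have idem: "idempotent_in ?C (to_fun n x) \<longleftrightarrow> x * x = x" if "x \<in> Zp n" for x
    using that Zp_to_fun_inject[of "x * x" n x] by (auto simp: idempotent_in_def centre_carrier mult Zp_closed)
  have zero: "to_fun n x = 0 \<longleftrightarrow> x = 0" if "x \<in> Zp n" for x :: "'f galg"
    using Zp_to_fun_inject[OF that Zp_closed(4)] by (simp add: to_fun_0)
  have ex: "(\<exists>a. idempotent_in ?C a \<and> P a) \<longleftrightarrow> (\<exists>x\<in>Zp n. x * x = x \<and> P (to_fun n x))" for P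
  proof
    assume "\<exists>a. idempotent_in ?C a \<and> P a"
    then obtain a where a: "idempotent_in ?C a" "P a" by blast
    then obtain x where "x \<in> Zp n" "a = to_fun n x" by (auto simp: idempotent_in_def centre_carrier)
    then show "\<exists>x\<in>Zp n. x * x = x \<and> P (to_fun n x)" using a idem by blast
  qed (use idem in blast)
  have main: "primitive_idempotent ?C (to_fun n x) \<longleftrightarrow> prim n x" if x: "x \<in> Zp n" for x
  proof -
    have "(\<exists>e1 e2. idempotent_in ?C e1 \<and> idempotent_in ?C e2 \<and> e1 \<noteq> \<zero>\<^bsub>?C\<^esub> \<and> e2 \<noteq> \<zero>\<^bsub>?C\<^esub> \<and>
        e1 \<otimes>\<^bsub>?C\<^esub> e2 = \<zero>\<^bsub>?C\<^esub> \<and> e2 \<otimes>\<^bsub>?C\<^esub> e1 = \<zero>\<^bsub>?C\<^esub> \<and> to_fun n x = e1 \<oplus>\<^bsub>?C\<^esub> e2) \<longleftrightarrow>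
      (\<exists>e1. idempotent_in ?C e1 \<and> (\<exists>e2. idempotent_in ?C e2 \<and> e1 \<noteq> 0 \<and> e2 \<noteq> 0 \<and>
        e1 \<otimes>\<^bsub>?C\<^esub> e2 = 0 \<and> e2 \<otimes>\<^bsub>?C\<^esub> e1 = 0 \<and> to_fun n x = e1 + e2))"
      unfolding ops(1,2) by blast
    also have "\<dots> \<longleftrightarrow> (\<exists>y\<in>Zp n. y * y = y \<and> (\<exists>w\<in>Zp n. w * w = w \<and> to_fun n y \<noteq> 0 \<and> to_fun n w \<noteq> 0 \<and>
        to_fun n y \<otimes>\<^bsub>?C\<^esub> to_fun n w = 0 \<and> to_fun n w \<otimes>\<^bsub>?C\<^esub> to_fun n y = 0 \<and>
        to_fun n x = to_fun n y + to_fun n w))"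
      unfolding ex ..
    also have "\<dots> \<longleftrightarrow> (\<exists>y\<in>Zp n. y * y = y \<and> (\<exists>w\<in>Zp n. w * w = w \<and> y \<noteq> 0 \<and> w \<noteq> 0 \<and>
        y * w = 0 \<and> w * y = 0 \<and> x = y + w))"
    proof (intro bex_cong refl conj_cong)
      fix y w :: "'f galg" assume yw: "y \<in> Zp n" "w \<in> Zp n"
      have "y + w = y - (0 - w)" by simp
      then have "y + w \<in> Zp n" using yw by (metis Zp_closed(1,4))
      then show "(to_fun n x = to_fun n y + to_fun n w) = (x = y + w)"
        using Zp_to_fun_inject[OF x] by (simp flip: to_fun_add)
    qed (simp_all add: mult zero Zp_closed)
    finally show ?thesis
      unfolding primitive_idempotent_def prim_def using idem[OF x] zero[OF x] x ops(1) by auto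
  qed
  show ?thesis
  proof (intro equalityI subsetI)
    fix a :: "(nat \<Rightarrow> nat) \<Rightarrow> 'f" assume "a \<in> blocks (sym_group n)"
    then have a: "primitive_idempotent ?C a" by (simp add: blocks_def)
    then have "a \<in> to_fun n ` Zp n"
      unfolding primitive_idempotent_def idempotent_in_def centre_carrier by blast
    then obtain x where "x \<in> Zp n" "a = to_fun n x" by blast
    then show "a \<in> to_fun n ` {x. prim n x}" using a main by blast
  next
    fix a :: "(nat \<Rightarrow> nat) \<Rightarrow> 'f" assume "a \<in> to_fun n ` {x. prim n x}"
    then obtain x where x: "prim n x" "a = to_fun n x" by blast
    then have "x \<in> Zp n" by (simp add: prim_def)
    then show "a \<in> blocks (sym_group n)" using main x by (simp add: blocks_def)
  qed
qed

subsection \<open>The action on Specht modules\<close>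

lemma galg_act:
  "tabloid_module_act n (to_fun n e) v T = (\<Sum>g\<in>Sn n. lk e g * v (tabloid_act (ap (- g)) T))"
  unfolding tabloid_module_act_apply sum_permutes by (intro sum.cong) (simp_all add: ap_uminus)

text \<open>Reconciles the setwise condition in \<open>column_stabiliser\<close> with the pointwise
  one in \<open>Cst\<close>; an injection of a finite fibre into itself is onto.\<close>

lemma preserves_fibres_iff:
  fixes f :: "nat \<Rightarrow> 'a"
  assumes "k \<in> Sn n"
  shows "(\<forall>i. ap k ` {a \<in> {1..n}. f a = i} = {a \<in> {1..n}. f a = i}) \<longleftrightarrow> (\<forall>a\<in>{1..n}. f (ap k a) = f a)"
proof
  assume *: "\<forall>i. ap k ` {a \<in> {1..n}. f a = i} = {a \<in> {1..n}. f a = i}"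
  show "\<forall>a\<in>{1..n}. f (ap k a) = f a"
  proof
    fix a assume "a \<in> {1..n}"
    then have "ap k a \<in> ap k ` {b \<in> {1..n}. f b = f a}" by blast
    then show "f (ap k a) = f a" using *[rule_format, of "f a"] by auto
  qed
next
  assume *: "\<forall>a\<in>{1..n}. f (ap k a) = f a"
  show "\<forall>i. ap k ` {a \<in> {1..n}. f a = i} = {a \<in> {1..n}. f a = i}"
  proof
    fix i
    let ?A = "{a \<in> {1..n}. f a = i}"
    have sub: "ap k ` ?A \<subseteq> ?A"
    proof
      fix b assume "b \<in> ap k ` ?A"
      then obtain a where a: "a \<in> {1..n}" "f a = i" "b = ap k a" by blast
      then show "b \<in> ?A" using * Sn_image[OF assms, of a] by simp
    qed
    show "ap k ` ?A = ?A"
      by (rule card_subset_eq[OF _ sub]) (simp_all add: card_image inj_on_def)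
  qed
qed

context
  fixes \<mu> :: "nat \<Rightarrow> nat" and n :: nat
  assumes \<mu>: "\<mu> \<in> partitions_of n"
begin

private lemma part: "is_partition \<mu>" "part_size \<mu> = n"
  using \<mu> by (auto simp: partitions_of_def)

interpretation column_tab n "\<lambda>a. fst (box_of \<mu> a)" "\<lambda>a. snd (box_of \<mu> a)" by (rule tab_of[OF \<mu>])

private lemma reading_tableau: "reading \<mu> \<in> tableaux \<mu>"
  using reading[OF part(1)] by (simp add: column_reading_def)

private lemma entries:
  "row_entries \<mu> (reading \<mu>) i = {a \<in> {1..n}. fst (box_of \<mu> a) = i}"
  "col_entries \<mu> (reading \<mu>) i = {a \<in> {1..n}. snd (box_of \<mu> a) = i}"
proof -
  note b = box_of[OF part(1), unfolded part(2)]
  have N: "reading \<mu> x \<in> {1..n}" if "x \<in> diagram \<mu>" for x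
    using bij_betwE[OF reading_bij[OF part(1)]] part(2) that by simp
  have img: "reading \<mu> ` {x \<in> diagram \<mu>. P x} = {a \<in> {1..n}. P (box_of \<mu> a)}" for P
  proof (intro equalityI subsetI)
    fix a assume "a \<in> {a \<in> {1..n}. P (box_of \<mu> a)}"
    then show "a \<in> reading \<mu> ` {x \<in> diagram \<mu>. P x}"
      using b(2,3) by (intro image_eqI[of _ _ "box_of \<mu> a"]) auto
  next
    fix a assume "a \<in> reading \<mu> ` {x \<in> diagram \<mu>. P x}"
    then show "a \<in> {a \<in> {1..n}. P (box_of \<mu> a)}" using N b(1) by auto
  qed
  show "row_entries \<mu> (reading \<mu>) i = {a \<in> {1..n}. fst (box_of \<mu> a) = i}"
    "col_entries \<mu> (reading \<mu>) i = {a \<in> {1..n}. snd (box_of \<mu> a) = i}"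
    unfolding row_entries_def col_entries_def by (rule img)+
qed

private lemma tableau_ap: "g \<in> Sn n \<Longrightarrow> s \<in> tableaux \<mu> \<Longrightarrow> ap g \<circ> s \<in> tableaux \<mu>"
  "g \<in> Sn n \<Longrightarrow> s \<in> tableaux \<mu> \<Longrightarrow> tabloid_act (ap g) (tabloid \<mu> s) = tabloid \<mu> (ap g \<circ> s)"
  using tabloid_act_tabloid[of "ap g" \<mu> s] part(2) by (auto simp: Sn_def)

text \<open>Tabloids correspond to the left cosets of the row stabiliser of the reading
  tableau.\<close>

private lemma tabloid_eq_iff:
  assumes g: "g \<in> Sn n" and c: "c \<in> Sn n"
  shows "tabloid \<mu> (ap g \<circ> reading \<mu>) = tabloid \<mu> (ap c \<circ> reading \<mu>) \<longleftrightarrow> - c + g \<in> Rst"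
proof -
  let ?t = "reading \<mu>" and ?R = "\<lambda>i. {a \<in> {1..n}. fst (box_of \<mu> a) = i}"
  have row: "row_entries \<mu> (ap h \<circ> ?t) i = ap h ` ?R i" for h i
    unfolding entries(1)[symmetric] by (auto simp: row_entries_def)
  have k: "- c + g \<in> Sn n" using g c by blast
  have "tabloid \<mu> (ap g \<circ> ?t) = tabloid \<mu> (ap c \<circ> ?t) \<longleftrightarrow>
    (\<forall>i. row_entries \<mu> (ap g \<circ> ?t) i = row_entries \<mu> (ap c \<circ> ?t) i)"
  proof
    assume "tabloid \<mu> (ap g \<circ> ?t) = tabloid \<mu> (ap c \<circ> ?t)"
    moreover have "ap g \<circ> ?t \<in> tabloid \<mu> (ap g \<circ> ?t)"
      using tableau_ap(1)[OF g reading_tableau] by (simp add: tabloid_def)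
    ultimately show "\<forall>i. row_entries \<mu> (ap g \<circ> ?t) i = row_entries \<mu> (ap c \<circ> ?t) i"
      by (simp add: tabloid_def)
  qed (simp add: tabloid_def)
  also have "\<dots> \<longleftrightarrow> (\<forall>i. ap (- c + g) ` ?R i = ?R i)"
  proof -
    have "ap g ` A = ap c ` A \<longleftrightarrow> ap (- c + g) ` A = A" for A
    proof -
      have "ap (- c + g) ` A = ap (- c) ` ap g ` A" by (simp add: image_image)
      moreover have "ap (- c) ` ap c ` A = A" "ap c ` ap (- c) ` B = B" for B by (simp_all add: image_image)
      ultimately show ?thesis by metis
    qed
    then show ?thesis unfolding row by (simp only:)
  qed
  also have "\<dots> \<longleftrightarrow> - c + g \<in> Rst"
    unfolding preserves_fibres_iff[OF k] Rst_def using k by simp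
  finally show ?thesis .
qed

private lemma column_stabiliser_eq: "column_stabiliser \<mu> (reading \<mu>) = ap ` Cst"
proof (intro equalityI subsetI)
  fix f assume "f \<in> column_stabiliser \<mu> (reading \<mu>)"
  then have f: "f permutes {1..n}" "\<forall>i. f ` {a \<in> {1..n}. snd (box_of \<mu> a) = i} = {a \<in> {1..n}. snd (box_of \<mu> a) = i}"
    by (simp_all add: column_stabiliser_def part(2) entries(2))
  from f(1) obtain g where g: "g \<in> Sn n" "f = ap g" by (rule permutes_obtain_ap)
  then have "g \<in> Cst" using f(2) preserves_fibres_iff[OF g(1), of "\<lambda>a. snd (box_of \<mu> a)"] by (simp add: Cst_def)
  then show "f \<in> ap ` Cst" using g by blast
next
  fix f assume "f \<in> ap ` Cst"
  then obtain g where g: "g \<in> Cst" "f = ap g" by blast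
  then have gS: "g \<in> Sn n" by (simp add: Cst_def)
  have "\<forall>i. ap g ` {a \<in> {1..n}. snd (box_of \<mu> a) = i} = {a \<in> {1..n}. snd (box_of \<mu> a) = i}"
    using preserves_fibres_iff[OF gS, of "\<lambda>a. snd (box_of \<mu> a)"] g(1) by (simp add: Cst_def)
  then show "f \<in> column_stabiliser \<mu> (reading \<mu>)"
    using gS by (simp add: g(2) column_stabiliser_def part(2) entries(2) Sn_def)
qed

private lemma polytabloid_sum:
  "polytabloid \<mu> (reading \<mu>) T =
    (\<Sum>c\<in>Cst. of_int (sgn_perm c) * (if T = tabloid \<mu> (ap c \<circ> reading \<mu>) then 1 else (0::'f::field)))"
proof -
  have "inj_on ap Cst" by (auto simp: inj_on_def ap_inject)
  then have "polytabloid \<mu> (reading \<mu>) T =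
    (\<Sum>c\<in>Cst. of_int (sign (ap c)) * basis_vec (tabloid_act (ap c) (tabloid \<mu> (reading \<mu>))) T :: 'f)"
    unfolding polytabloid_apply column_stabiliser_eq by (subst sum.reindex) (simp_all add: comp_def)
  also have "\<dots> = (\<Sum>c\<in>Cst. of_int (sgn_perm c) * (if T = tabloid \<mu> (ap c \<circ> reading \<mu>) then 1 else 0))"
    by (intro sum.cong refl)
      (simp add: basis_vec_def tableau_ap(2)[OF st_Sn(2) reading_tableau] sgn_perm.rep_eq)
  finally show ?thesis .
qed

text \<open>
  The coefficients of \<open>kap * rho\<close> are those of the polytabloid, read through \<open>g \<mapsto> {g t}\<close>.
\<close>

private lemma polytabloid_lk:
  assumes g: "g \<in> Sn n"
  shows "polytabloid \<mu> (reading \<mu>) (tabloid \<mu> (ap g \<circ> reading \<mu>)) = lk (kap * rho :: 'f::field galg) g"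
  unfolding polytabloid_sum lk_kap_rho using tabloid_eq_iff[OF g st_Sn(2)] by (intro sum.cong) auto

text \<open>At tabloids this is \<open>central_kap_rho\<close> read off coefficientwise; at all
  other arguments both sides vanish because the group permutes the tabloids.\<close>

private lemma act_polytabloid_reading:
  fixes e :: "'f::field galg"
  assumes e: "central n e"
  shows "tabloid_module_act n (to_fun n e) (polytabloid \<mu> (reading \<mu>)) T = om \<mu> e * polytabloid \<mu> (reading \<mu>) T"
proof (cases "\<exists>g\<in>Sn n. T = tabloid \<mu> (ap g \<circ> reading \<mu>)")
  case True
  then obtain g where g: "g \<in> Sn n" "T = tabloid \<mu> (ap g \<circ> reading \<mu>)" by blast
  have "tabloid_module_act n (to_fun n e) (polytabloid \<mu> (reading \<mu>)) T =
    (\<Sum>h\<in>Sn n. lk e h * lk (kap * rho) (- h + g))"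
    unfolding galg_act
  proof (rule sum.cong[OF refl])
    fix h assume h: "h \<in> Sn n"
    have "tabloid_act (ap (- h)) T = tabloid \<mu> (ap (- h) \<circ> (ap g \<circ> reading \<mu>))"
      unfolding g(2) using h g(1) by (intro tableau_ap reading_tableau) blast+
    also have "ap (- h) \<circ> (ap g \<circ> reading \<mu>) = ap (- h + g) \<circ> reading \<mu>" by (simp add: fun_eq_iff)
    finally have T: "tabloid_act (ap (- h)) T = tabloid \<mu> (ap (- h + g) \<circ> reading \<mu>)" .
    have hg: "- h + g \<in> Sn n" using h g(1) by blast
    show "lk e h * polytabloid \<mu> (reading \<mu>) (tabloid_act (ap (- h)) T) = lk e h * lk (kap * rho) (- h + g)"
      unfolding T polytabloid_lk[OF hg] ..
  qed
  also have "\<dots> = lk (e * (kap * rho)) g"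
    using lk_mult[of e "Sn n"] e by (simp add: central_def supp_in_def)
  also have "\<dots> = om \<mu> e * polytabloid \<mu> (reading \<mu>) T"
    unfolding central_kap_rho[OF e] g(2) polytabloid_lk[OF g(1)] om_omega[OF \<mu>] by simp
  finally show ?thesis .
next
  case False
  have zero: "polytabloid \<mu> (reading \<mu>) T' = (0 :: 'f)" if "\<not> (\<exists>g\<in>Sn n. T' = tabloid \<mu> (ap g \<circ> reading \<mu>))" for T'
    unfolding polytabloid_sum using that st_Sn(2) by (intro sum.neutral ballI) auto
  have "polytabloid \<mu> (reading \<mu>) (tabloid_act (ap (- h)) T) = (0 :: 'f)" if h: "h \<in> Sn n" for h
  proof (rule zero)
    show "\<not> (\<exists>g\<in>Sn n. tabloid_act (ap (- h)) T = tabloid \<mu> (ap g \<circ> reading \<mu>))"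
    proof
      assume "\<exists>g\<in>Sn n. tabloid_act (ap (- h)) T = tabloid \<mu> (ap g \<circ> reading \<mu>)"
      then obtain g where g: "g \<in> Sn n" "tabloid_act (ap (- h)) T = tabloid \<mu> (ap g \<circ> reading \<mu>)" by blast
      have "ap h \<circ> ap (- h) = id" by (simp add: fun_eq_iff)
      then have "T = tabloid_act (ap h) (tabloid_act (ap (- h)) T)" by (simp only: tabloid_act_comp tabloid_act_id)
      also have "\<dots> = tabloid \<mu> (ap h \<circ> (ap g \<circ> reading \<mu>))"
        unfolding g(2) using h g(1) by (intro tableau_ap reading_tableau)
      also have "ap h \<circ> (ap g \<circ> reading \<mu>) = ap (h + g) \<circ> reading \<mu>" by (simp add: fun_eq_iff)
      finally show False using False h g(1) by blast
    qed
  qed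
  then show ?thesis unfolding galg_act using zero[OF False] by simp
qed

private lemma tableau_obtain:
  assumes "s \<in> tableaux \<mu>"
  obtains g where "g \<in> Sn n" "s = ap g \<circ> reading \<mu>"
proof -
  note b = box_of[OF part(1), unfolded part(2)]
  define f where "f = (\<lambda>a. if a \<in> {1..n} then s (box_of \<mu> a) else a)"
  have s: "bij_betw s (diagram \<mu>) {1..n}" "\<And>x. x \<notin> diagram \<mu> \<Longrightarrow> s x = 0"
    using assms part(2) by (auto simp: tableaux_def)
  have "bij_betw (box_of \<mu>) {1..n} (diagram \<mu>)"
    by (rule bij_betw_byWitness[of _ "reading \<mu>"])
      (use b bij_betwE[OF reading_bij[OF part(1)]] part(2) in auto)
  then have "bij_betw (s \<circ> box_of \<mu>) {1..n} {1..n}" using s(1) by (rule bij_betw_trans)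
  moreover have "bij_betw f {1..n} {1..n} = bij_betw (s \<circ> box_of \<mu>) {1..n} {1..n}"
    by (rule bij_betw_cong) (simp add: f_def)
  ultimately have "f permutes {1..n}" by (intro bij_imp_permutes) (auto simp: f_def)
  then obtain g where g: "g \<in> Sn n" "f = ap g" by (rule permutes_obtain_ap)
  have "s x = f (reading \<mu> x)" for x
  proof (cases "x \<in> diagram \<mu>")
    case True
    then have "reading \<mu> x \<in> {1..n}" using bij_betwE[OF reading_bij[OF part(1)]] part(2) by simp
    then show ?thesis using b(1)[OF True] by (simp add: f_def)
  next
    case False
    then have "reading \<mu> x = 0" using reading_tableau unfolding tableaux_def by blast
    then show ?thesis using s(2)[OF False] by (simp add: f_def)
  qed
  then have "s = ap g \<circ> reading \<mu>" using g(2) by auto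
  then show ?thesis using that g(1) by blast
qed

text \<open>Every polytabloid is a translate of that of the reading tableau, and the coefficients of
  a central \<open>e\<close> are unchanged when the sum is reindexed by conjugation.\<close>

private lemma act_polytabloid:
  fixes e :: "'f::field galg"
  assumes e: "central n e" and s: "s \<in> tableaux \<mu>"
  shows "tabloid_module_act n (to_fun n e) (polytabloid \<mu> s) T = om \<mu> e * polytabloid \<mu> s T"
proof -
  obtain g where g: "g \<in> Sn n" "s = ap g \<circ> reading \<mu>" using s by (rule tableau_obtain)
  have P: "polytabloid \<mu> s T = (polytabloid \<mu> (reading \<mu>) (tabloid_act (ap (- g)) T) :: 'f)" for T
  proof -
    have gp: "ap g permutes {1..part_size \<mu>}" using g(1) part(2) by (simp add: Sn_def)
    have "polytabloid \<mu> s T = tabloid_module_act (part_size \<mu>) (\<lambda>h. if h = ap g then 1 else 0) (polytabloid \<mu> (reading \<mu>)) T"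
      unfolding g(2) polytabloid_act[OF gp reading_tableau] ..
    also have "\<dots> = (\<Sum>h\<in>Sn n. if h = g then polytabloid \<mu> (reading \<mu>) (tabloid_act (ap (- g)) T) else 0)"
      unfolding tabloid_module_act_apply part(2) sum_permutes
      by (intro sum.cong refl) (auto simp: ap_inject ap_uminus)
    finally show ?thesis using g(1) by simp
  qed
  have bij: "bij_betw (\<lambda>h. g + h - g) (Sn n) (Sn n)"
  proof (rule bij_betw_byWitness[of _ "\<lambda>h. - g + h + g"])
    show "\<forall>h\<in>Sn n. - g + (g + h - g) + g = h" "\<forall>h\<in>Sn n. g + (- g + h + g) - g = h"
      by (simp_all add: add.assoc[symmetric] diff_conv_add_uminus del: add_uminus_conv_diff)
        (simp_all add: add.assoc)
  qed (use g(1) in blast)+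
  have "tabloid_module_act n (to_fun n e) (polytabloid \<mu> s) T =
    (\<Sum>h\<in>Sn n. lk e h * polytabloid \<mu> (reading \<mu>) (tabloid_act (ap (- g)) (tabloid_act (ap (- h)) T)))"
    by (simp add: galg_act P)
  also have "\<dots> = (\<Sum>h\<in>Sn n. lk e (g + h - g) *
      polytabloid \<mu> (reading \<mu>) (tabloid_act (ap (- g)) (tabloid_act (ap (- (g + h - g))) T)))"
    by (rule sum.reindex_bij_betw[OF bij, symmetric])
  also have "\<dots> = (\<Sum>h\<in>Sn n. lk e h * polytabloid \<mu> (reading \<mu>) (tabloid_act (ap (- h)) (tabloid_act (ap (- g)) T)))"
  proof (rule sum.cong[OF refl])
    fix h
    have "ap (- g) \<circ> ap (- (g + h - g)) = ap (- h) \<circ> ap (- g)"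
    proof
      fix x
      have "- g + - (g + h - g) = - h + - g"
        by (simp only: diff_conv_add_uminus minus_add minus_minus add.assoc[symmetric] left_minus add_0_left)
      then show "(ap (- g) \<circ> ap (- (g + h - g))) x = (ap (- h) \<circ> ap (- g)) x"
        by (metis ap_plus comp_apply)
    qed
    moreover have "lk e (g + h - g) = lk e h" using e g(1) by (simp add: central_iff_class_function)
    ultimately show "lk e (g + h - g) * polytabloid \<mu> (reading \<mu>) (tabloid_act (ap (- g)) (tabloid_act (ap (- (g + h - g))) T)) =
      lk e h * polytabloid \<mu> (reading \<mu>) (tabloid_act (ap (- h)) (tabloid_act (ap (- g)) T))"
      by (simp only: tabloid_act_comp)
  qed
  also have "\<dots> = om \<mu> e * polytabloid \<mu> s T"
    using act_polytabloid_reading[OF e, of "tabloid_act (ap (- g)) T"] by (simp add: galg_act P)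
  finally show ?thesis .
qed

lemma act_specht:
  fixes e :: "'f::field galg"
  assumes e: "central n e" and v: "v \<in> specht_module \<mu>"
  shows "tabloid_module_act n (to_fun n e) v = (\<lambda>T. om \<mu> e * v T)"
proof -
  let ?V = "{v :: 'f tabloid_vec. tabloid_module_act n (to_fun n e) v = (\<lambda>T. om \<mu> e * v T)}"
  have "fun_space.subspace ?V"
    unfolding fun_space.subspace_def
  proof (intro conjI ballI allI)
    show "0 \<in> ?V" by (auto simp: galg_act)
    show "x + y \<in> ?V" if "x \<in> ?V" "y \<in> ?V" for x y
    proof -
      have "tabloid_module_act n (to_fun n e) (x + y) T =
        tabloid_module_act n (to_fun n e) x T + tabloid_module_act n (to_fun n e) y T" for T
        by (simp add: galg_act distrib_left sum.distrib)
      then show ?thesis using that by (simp add: fun_eq_iff distrib_left)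
    qed
    show "(\<lambda>T. c * x T) \<in> ?V" if "x \<in> ?V" for c x
    proof -
      have "tabloid_module_act n (to_fun n e) (\<lambda>T. c * x T) T = c * tabloid_module_act n (to_fun n e) x T" for T
        by (simp add: galg_act sum_distrib_left mult.left_commute)
      then show ?thesis using that by (simp add: fun_eq_iff mult.left_commute)
    qed
  qed
  moreover have "polytabloid \<mu> ` tableaux \<mu> \<subseteq> ?V"
  proof
    fix v assume "v \<in> (polytabloid \<mu> ` tableaux \<mu> :: 'f tabloid_vec set)"
    then obtain s where s: "s \<in> tableaux \<mu>" "v = polytabloid \<mu> s" by blast
    show "v \<in> ?V" unfolding s(2) mem_Collect_eq by (rule ext) (rule act_polytabloid[OF e s(1)])
  qed
  ultimately have "specht_module \<mu> \<subseteq> ?V" unfolding specht_module_def by (intro fun_space.span_minimal)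
  then show ?thesis using v by blast
qed

text \<open>With value 1 the idempotent acts as the identity. With value 0 it annihilates the
  module, which is not 0 because the polytabloid of the reading tableau has a coefficient 1.\<close>

lemma lies_in_block_iff:
  fixes e :: "'f::field galg"
  assumes e: "central n e" and om: "om \<mu> e = 0 \<or> om \<mu> e = 1"
  shows "lies_in_block (tabloid_module_act n) (specht_module \<mu>) (to_fun n e) \<longleftrightarrow> om \<mu> e = 1"
proof
  assume "om \<mu> e = 1"
  then have "tabloid_module_act n (to_fun n e) v = v" if "v \<in> specht_module \<mu>" for v
    using act_specht[OF e that] by simp
  then show "lies_in_block (tabloid_module_act n) (specht_module \<mu>) (to_fun n e)"
    by (simp add: lies_in_block_def)
next
  assume l: "lies_in_block (tabloid_module_act n) (specht_module \<mu>) (to_fun n e)"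
  show "om \<mu> e = 1"
  proof (rule ccontr)
    assume "om \<mu> e \<noteq> 1"
    then have "om \<mu> e = 0" using om by simp
    then have z: "tabloid_module_act n (to_fun n e) v = (\<lambda>T. 0)" if "v \<in> specht_module \<mu>" for v
      using act_specht[OF e that] by simp
    have "(polytabloid \<mu> (reading \<mu>) :: 'f tabloid_vec) \<in> specht_module \<mu>"
      unfolding specht_module_def by (intro fun_space.span_base imageI reading_tableau)
    then have "(polytabloid \<mu> (reading \<mu>) :: 'f tabloid_vec) \<in> tabloid_module_act n (to_fun n e) ` specht_module \<mu>"
      using l by (simp add: lies_in_block_def)
    then have p0: "polytabloid \<mu> (reading \<mu>) = (\<lambda>T. 0 :: 'f)" using z by auto
    have "polytabloid \<mu> (reading \<mu>) (tabloid \<mu> (ap 0 \<circ> reading \<mu>)) = (1 :: 'f)"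
      unfolding polytabloid_lk[OF Sn_closed(1)] by (rule lk_kap_rho_0)
    then show False by (simp add: p0)
  qed
qed

end

theorem theorem1:
  fixes p n :: nat
  assumes "prime p"
    and "CHAR('f::field) = p"
  shows "\<exists>B :: (nat \<Rightarrow> nat) \<times> nat \<Rightarrow> (nat \<Rightarrow> nat) \<Rightarrow> 'f.
           bij_betw B (block_labels p n) (blocks (sym_group n)) \<and>
           (\<forall>\<mu> \<gamma> w. is_partition \<mu> \<and> part_size \<mu> = n \<and> (\<gamma>, w) \<in> block_labels p n \<longrightarrow>
              (lies_in_block (tabloid_module_act n) (specht_module \<mu>) (B (\<gamma>, w)) \<longleftrightarrow>
               core_of p \<mu> = \<gamma>))"
proof -
  have p0: "p > 0" using assms(1) by (rule prime_gt_0_nat)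
  let ?L = "core_of p ` partitions_of n"
  have "\<forall>\<gamma>\<in>?L. \<exists>e :: 'f galg. e \<in> Zp n \<and> e * e = e \<and>
    (\<forall>\<mu>\<in>partitions_of n. om \<mu> e = (if core_of p \<mu> = \<gamma> then 1 else 0))"
    using core_idempotent[OF assms] by blast
  from bchoice[OF this] obtain e :: "(nat \<Rightarrow> nat) \<Rightarrow> 'f galg" where
    e: "\<forall>\<gamma>\<in>?L. e \<gamma> \<in> Zp n \<and> e \<gamma> * e \<gamma> = e \<gamma> \<and>
      (\<forall>\<mu>\<in>partitions_of n. om \<mu> (e \<gamma>) = (if core_of p \<mu> = \<gamma> then 1 else 0))" by blast
  have "bij_betw e ?L {x. prim n x}" by (rule prim_cores[OF assms]) (rule bspec[OF e])
  moreover have "bij_betw (to_fun n) {x :: 'f galg. prim n x} (blocks (sym_group n))"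
    unfolding bij_betw_def blocks_sym_group using Zp_to_fun_inject by (auto simp: inj_on_def prim_def)
  ultimately have eb: "bij_betw (to_fun n \<circ> e) ?L (blocks (sym_group n))" by (rule bij_betw_trans)
  \<comment> \<open>A label is determined by its core: the size equation fixes the weight since
    \<open>p > 0\<close>.\<close>
  have "bij_betw fst (block_labels p n) ?L"
    unfolding bij_betw_def
  proof
    show "inj_on fst (block_labels p n)"
      using p0 by (auto simp: inj_on_def block_labels_def)
    show "fst ` block_labels p n = ?L"
    proof (intro equalityI subsetI)
      fix \<gamma> assume "\<gamma> \<in> fst ` block_labels p n"
      then obtain w where "(\<gamma>, w) \<in> block_labels p n" by force
      then have "is_core p \<gamma>" "n = part_size \<gamma> + p * w" by (simp_all add: block_labels_def)
      then show "\<gamma> \<in> ?L" using partition_with_core[of p \<gamma> w] p0 by (auto simp: partitions_of_def)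
    next
      fix \<gamma> assume "\<gamma> \<in> ?L"
      then obtain \<mu> where "is_partition \<mu>" "part_size \<mu> = n" "\<gamma> = core_of p \<mu>" by (auto simp: partitions_of_def)
      then obtain w where "(\<gamma>, w) \<in> block_labels p n"
        using core_of_props[of \<mu> p] p0 by (auto simp: block_labels_def)
      then show "\<gamma> \<in> fst ` block_labels p n" by force
    qed
  qed
  then have "bij_betw (to_fun n \<circ> e \<circ> fst) (block_labels p n) (blocks (sym_group n))"
    and fst: "\<And>x. x \<in> block_labels p n \<Longrightarrow> fst x \<in> ?L"
    using eb by (auto intro: bij_betw_trans dest: bij_betwE)
  moreover have "lies_in_block (tabloid_module_act n) (specht_module \<mu>) ((to_fun n \<circ> e \<circ> fst) (\<gamma>, w)) \<longleftrightarrow>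
      core_of p \<mu> = \<gamma>"
    if "is_partition \<mu>" "part_size \<mu> = n" "(\<gamma>, w) \<in> block_labels p n" for \<mu> \<gamma> w
  proof -
    have \<mu>: "\<mu> \<in> partitions_of n" using that by (simp add: partitions_of_def)
    have "\<gamma> \<in> ?L" using fst[OF that(3)] by simp
    then have E: "central n (e \<gamma>)" "om \<mu> (e \<gamma>) = (if core_of p \<mu> = \<gamma> then 1 else 0)"
      using bspec[OF e] \<mu> Zp_central by blast+
    then show ?thesis using lies_in_block_iff[OF \<mu> E(1)] by simp
  qed
  ultimately show ?thesis by blast
qed

end
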